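(* Let $n\ge1$, $1\le p\le\infty$ and $d\ge 1$. For every $x\in\mathcal{P}^{\ge d}$ and every $t\ge0$, $$\|P_t(x)\|_p\le (d+3)e^{-td}\|x\|_p,$$ and $$\|L(x)\|_p\ge \frac{d}{4}\|x\|_p.$$
   Context: $\mathbb{F}_n$ is the free group on generators $g_1,\dots,g_n$ with unit $e$, and $\lambda$ is its left regular representation on $\ell_2(\mathbb{F}_n)$. $\widehat{\mathbb{F}}_n$ is the von Neumann algebra generated by $\{\lambda_g\}$, with canonical faithful tracial state $\tau(x)=\langle x\delta_e,\delta_e\rangle$. For $1\le p<\infty$, $\|x\|_p=\tau((x^*x)^{p/2})^{1/p}$, and $\|\cdot\|_\infty$ is the operator norm. A polynomial is a finite sum $\sum_g x_g\lambda_g$, $x_g\in\mathbb{C}$. $|g|$ denotes word length with respect to $g_1^{\pm1},\dots,g_n^{\pm1}$. $P_t(\sum_g x_g\lambda_g)=\sum_g e^{-t|g|}x_g\lambda_g$ for $t\ge0$ and $L(\sum_g x_g\lambda_g)=\sum_g|g|x_g\lambda_g$. $\mathcal{P}^{\ge d}$ is the complex linear span of $\{\lambda_g:|g|\ge d\}$ (no holomorphy is assumed). *)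

theory Defs
  imports "HOL-Probability.Probability"
begin

text \<open>Free group F_n: elements are reduced words over letters (i, s), i < n standing for
  generator g_(i+1), s = True for exponent +1 and s = False for exponent -1.\<close>

type_synonym letter = "nat \<times> bool"
type_synonym word = "letter list"

definition reduced :: "word \<Rightarrow> bool" where
  "reduced w \<longleftrightarrow> (\<forall>i. Suc i < length w \<longrightarrow>
      \<not> (fst (w!i) = fst (w!Suc i) \<and> snd (w!i) \<noteq> snd (w!Suc i)))"

definition FG :: "nat \<Rightarrow> word set" where
  "FG n = {w. reduced w \<and> (\<forall>a\<in>set w. fst a < n)}"

text \<open>wcancel (rev w) v is the free reduction of w v, for reduced w and v.\<close>
fun wcancel :: "word \<Rightarrow> word \<Rightarrow> word" where
  "wcancel [] v = v"
| "wcancel (a#r) [] = rev (a#r)"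
| "wcancel (a#r) (b#v) =
     (if fst a = fst b \<and> snd a \<noteq> snd b then wcancel r v else rev (a#r) @ (b#v))"

definition wmul :: "word \<Rightarrow> word \<Rightarrow> word" where
  "wmul w v = wcancel (rev w) v"

definition winv :: "word \<Rightarrow> word" where
  "winv w = rev (map (\<lambda>a. (fst a, \<not> snd a)) w)"

text \<open>Polynomials sum_g x_g lambda_g, identified with their coefficient functions.\<close>

definition fsupp :: "(word \<Rightarrow> complex) \<Rightarrow> word set" where
  "fsupp x = {g. x g \<noteq> 0}"

definition is_poly :: "nat \<Rightarrow> (word \<Rightarrow> complex) \<Rightarrow> bool" where
  "is_poly n x \<longleftrightarrow> finite (fsupp x) \<and> fsupp x \<subseteq> FG n"

text \<open>Product in the group algebra (= convolution; also lambda(x) applied to a finitely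
  supported vector of l2(F_n)).\<close>
definition conv :: "(word \<Rightarrow> complex) \<Rightarrow> (word \<Rightarrow> complex) \<Rightarrow> word \<Rightarrow> complex" where
  "conv x y g = (\<Sum>h\<in>fsupp x. \<Sum>k\<in>fsupp y. if wmul h k = g then x h * y k else 0)"

definition adj :: "(word \<Rightarrow> complex) \<Rightarrow> word \<Rightarrow> complex" where
  "adj x g = cnj (x (winv g))"

definition unit_el :: "word \<Rightarrow> complex" where
  "unit_el g = (if g = [] then 1 else 0)"

fun cpow :: "(word \<Rightarrow> complex) \<Rightarrow> nat \<Rightarrow> word \<Rightarrow> complex" where
  "cpow x 0 = unit_el"
| "cpow x (Suc k) = conv x (cpow x k)"

text \<open>tau(x) = <x delta_e, delta_e> = coefficient at the unit.\<close>
definition tau :: "(word \<Rightarrow> complex) \<Rightarrow> complex" where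
  "tau x = x []"

definition l2sq :: "(word \<Rightarrow> complex) \<Rightarrow> real" where
  "l2sq \<xi> = (\<Sum>g\<in>fsupp \<xi>. (cmod (\<xi> g))^2)"

text \<open>Operator norm of lambda(x) on l2(F_n), computed on the dense subspace of
  finitely supported vectors.\<close>
definition opnorm :: "nat \<Rightarrow> (word \<Rightarrow> complex) \<Rightarrow> real" where
  "opnorm n x = Sup {sqrt (l2sq (conv x \<xi>)) | \<xi>. is_poly n \<xi> \<and> l2sq \<xi> \<le> 1}"

text \<open>Spectral distribution of x*x with respect to tau: the unique compactly supported
  probability measure on [0,oo) whose moments are tau((x*x)^k).\<close>
definition spec_meas :: "(word \<Rightarrow> complex) \<Rightarrow> real measure" where
  "spec_meas x = (THE \<mu>. prob_space \<mu> \<and> sets \<mu> = sets (borel :: real measure) \<and>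
      (\<exists>R. AE t in \<mu>. 0 \<le> t \<and> t \<le> R) \<and>
      (\<forall>k. integrable \<mu> (\<lambda>t. t ^ k) \<and>
           complex_of_real (\<integral>t. t ^ k \<partial>\<mu>) = tau (cpow (conv (adj x) x) k)))"

text \<open>||x||_p = tau((x*x)^(p/2))^(1/p) for p < oo, operator norm for p = oo.\<close>
definition lpnorm :: "nat \<Rightarrow> ennreal \<Rightarrow> (word \<Rightarrow> complex) \<Rightarrow> real" where
  "lpnorm n p x = (if p = \<infinity> then opnorm n x
     else (\<integral>t. t powr (enn2real p / 2) \<partial>(spec_meas x)) powr (1 / enn2real p))"

definition Pt :: "real \<Rightarrow> (word \<Rightarrow> complex) \<Rightarrow> word \<Rightarrow> complex" where
  "Pt t x g = complex_of_real (exp (- t * real (length g))) * x g"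

definition Lop :: "(word \<Rightarrow> complex) \<Rightarrow> word \<Rightarrow> complex" where
  "Lop x g = of_nat (length g) * x g"

end

theory Submission
  imports Defs "HOL-Library.Poly_Mapping" "HOL-Real_Asymp.Real_Asymp"
begin

text \<open>A radial multiplier \<open>m (|g|)\<close> on the free group is bounded on the von Neumann algebra by the trace
  norm of the Hankel matrix \<open>m (i + j) - m (i + j + 2)\<close> (Haagerup, Szwarc). Only the values \<open>m k\<close> with
  \<open>k \<ge> d\<close> are prescribed, so the lower ones are chosen to make an explicit factorization of the Hankel matrix
  cheap: cost \<open>(d + 1) r ^ d\<close> for \<open>m k = r ^ k\<close>, and cost \<open>4 / d\<close> for \<open>m k = 1 / k\<close>, which inverts \<open>L\<close>.

  The passage from the operator norm to the \<open>p\<close>-norms uses real interpolation. Multipliers by real even functions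
  are symmetric for the trace pairing, hence also bounded on \<open>L\<^sup>1\<close>. Splitting \<open>x\<close> at height \<open>a\<close> then gives
  \<open>\<tau> ((|T x| - C a)\<^sub>+) \<le> C \<tau> ((|x| - a)\<^sub>+)\<close> for every \<open>a > 0\<close>, and integrating against
  \<open>p (p - 1) a\<^bsup>p - 2\<^esup> da\<close> yields the bound \<open>C\<close> on the \<open>p\<close>-norms. All truncations are approximated by
  polynomials in \<open>x\<^sup>* x\<close>, so that one never leaves the group algebra.\<close>

section \<open>The moment problem on a bounded interval\<close>

text \<open>\<open>lpnorm\<close> sees \<open>x\<close> only through the measure
  \<open>spec_meas x\<close>, which is specified by its moments. This is why a moment problem on a
  bounded interval has to be solved first, and why the operators that are truncated have the form
  \<open>x * poly_eval q (star x * x)\<close>. For the same reason an element that is to be small in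
  L^1 is always carried as a product of two elements: the squares of their L^2 norms are integrals
  of polynomials against the spectral measure, while an L^1 norm is not.

  The parity pattern of the chosen lower values comes from the tree. One step along the common ray
  of two vertices raises both indices by one, so the Hankel differences link \<open>m k\<close> only
  to \<open>m (k + 2)\<close>. Prescribing these differences for \<open>k < d\<close> (zero for
  \<open>r ^ k\<close>, constant for \<open>1 / k\<close>) fixes each value below \<open>d\<close>
  by the first index of the same parity that is at least \<open>d\<close>.

  The generators are countably many throughout, and F_n is a subgroup; the set \<open>S\<close> that
  accompanies supports and operator bounds stands for this subgroup.\<close>

text \<open>These are the factorial moments of the binomial weights:
  \<open>(N choose j) * (j choose k)\<close> equals
  \<open>(N choose k) * ((N - k) choose (j - k))\<close>, and the binomial theorem does the rest. A
  general commutative ring is allowed because \<open>x\<close> and \<open>y\<close> will be the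
  polynomials t and B - t.\<close>

lemma sum_bernstein_choose:
  fixes x y :: "'a::comm_ring_1"
  shows "(\<Sum>j\<le>N. of_nat (j choose k) * (of_nat (N choose j) * x ^ j * y ^ (N - j))) 
    = of_nat (N choose k) * x ^ k * (x + y) ^ (N - k)"
proof (cases "k \<le> N")
  case True
  have "(\<Sum>j\<le>N. of_nat (j choose k) * (of_nat (N choose j) * x ^ j * y ^ (N - j)))
      = (\<Sum>j\<in>{k..N}. of_nat (j choose k) * (of_nat (N choose j) * x ^ j * y ^ (N - j)))"
    by (rule sum.mono_neutral_right) (auto simp: binomial_eq_0 not_le)
  also have "\<dots> = (\<Sum>i\<le>N-k. of_nat ((i+k) choose k) * (of_nat (N choose (i+k)) * x ^ (i+k) * y ^ (N - (i+k))))"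
    using True by (intro sum.reindex_bij_witness[of _ "\<lambda>i. i + k" "\<lambda>j. j - k"]) auto
  also have "\<dots> = (\<Sum>i\<le>N-k. of_nat (N choose k) * x ^ k * (of_nat ((N-k) choose i) * x ^ i * y ^ (N - k - i)))"
  proof (rule sum.cong[OF refl])
    fix i assume "i \<in> {..N-k}"
    then have "(N choose (i+k)) * ((i+k) choose k) = (N choose k) * ((N-k) choose i)"
      using choose_mult[of k "i+k" N] True by simp
    then have "(of_nat (N choose (i+k)) * of_nat ((i+k) choose k) :: 'a) = of_nat (N choose k) * of_nat ((N-k) choose i)"
      by (metis of_nat_mult)
    moreover have "N - (i+k) = N - k - i" by simp
    ultimately show "of_nat ((i+k) choose k) * (of_nat (N choose (i+k)) * x ^ (i+k) * y ^ (N - (i+k))) =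
        of_nat (N choose k) * x ^ k * (of_nat ((N-k) choose i) * x ^ i * y ^ (N - k - i))"
      by (metis (no_types, opaque_lifting) power_add mult.assoc mult.commute)
  qed
  also have "\<dots> = of_nat (N choose k) * x ^ k * (x + y) ^ (N - k)"
    by (simp add: sum_distrib_left[symmetric] binomial_ring)
  finally show ?thesis .
next
  case False
  then show ?thesis by (simp add: binomial_eq_0)
qed

lemma choose_ratio_prod:
  assumes "k \<le> N"
  shows "real (j choose k) / real (N choose k) = (\<Prod>i<k. (real j - real i) / (real N - real i))"
proof -
  have *: "real (m choose k) = (\<Prod>i<k. real m - real i) / fact k" for m
    using gbinomial_prod_rev[of "real m" k] by (simp add: binomial_gbinomial atLeast0LessThan)
  show ?thesis using assms by (simp add: * prod_dividef)
qed

text \<open>Turns factorial moments into ordinary ones. Both terms are products of \<open>k\<close>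
  factors of modulus at most 1, so their difference is at most the sum of the differences of the
  factors; \<open>2 * k \<le> N\<close> keeps every denominator above \<open>N / 2\<close>, which is
  the source of the factor 2.\<close>

lemma choose_ratio_approx:
  assumes "2 * k \<le> N" "j \<le> N" "N > 0"
  shows "\<bar>real (j choose k) / real (N choose k) - (real j / real N) ^ k\<bar> \<le> 2 * real k * real k / real N"
proof -
  \<comment> \<open>This includes \<open>j < i\<close>, where the quotient is negative but
    \<open>i - j \<le> i \<le> N - i\<close>.\<close>
  have b: "\<bar>(real j - real i) / (real N - real i)\<bar> \<le> 1" if "i < k" for i
    using assms that by (simp add: abs_le_iff)
  have d: "\<bar>(real j - real i) / (real N - real i) - real j / real N\<bar> \<le> 2 * real k / real N" if "i < k" for i
  proof -
    have p: "real N - real i > 0" "real N > 0" using assms that by auto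
    have "(real j - real i) / (real N - real i) - real j / real N 
        = - (real i * (real N - real j) / ((real N - real i) * real N))"
      using p by (simp add: field_simps)
    also have "\<bar>\<dots>\<bar> = (real i / real N) * ((real N - real j) / (real N - real i))"
      using p assms by (subst abs_minus_cancel, subst abs_of_nonneg) (auto simp: mult_ac)
    also have "\<dots> \<le> (real k / real N) * 2"
      using p assms that by (intro mult_mono) (auto simp: field_simps)
    finally show ?thesis by (simp add: mult.commute)
  qed
  have "\<bar>real (j choose k) / real (N choose k) - (real j / real N) ^ k\<bar>
    = norm ((\<Prod>i<k. (real j - real i) / (real N - real i)) - (\<Prod>i<k. real j / real N))"
    using assms by (simp add: choose_ratio_prod)
  also have "\<dots> \<le> (\<Sum>i<k. norm ((real j - real i) / (real N - real i) - real j / real N))"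
    using b assms by (intro norm_prod_diff) auto
  also have "\<dots> \<le> (\<Sum>i<k. 2 * real k / real N)"
    using d by (intro sum_mono) auto
  finally show ?thesis by (simp add: field_simps)
qed

definition bounded_prob :: "real \<Rightarrow> real measure \<Rightarrow> bool" where
  "bounded_prob B \<mu> \<longleftrightarrow> prob_space \<mu> \<and> sets \<mu> = sets (borel :: real measure) \<and> (AE t in \<mu>. 0 \<le> t \<and> t \<le> B)"

lemma bounded_prob_integrable_cont:
  fixes f :: "real \<Rightarrow> real"
  assumes "bounded_prob B \<mu>" "continuous_on UNIV f"
  shows "integrable \<mu> f"
proof -
  interpret prob_space \<mu> using assms by (simp add: bounded_prob_def)
  have s[measurable_cong]: "sets \<mu> = sets borel" using assms by (simp add: bounded_prob_def)
  have [measurable]: "f \<in> borel_measurable borel" using assms(2) by (rule borel_measurable_continuous_onI)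
  have "bounded (f ` {0..B})"
    by (intro compact_imp_bounded compact_continuous_image continuous_on_subset[OF assms(2)]) auto
  then obtain K where K: "\<And>x. x \<in> {0..B} \<Longrightarrow> norm (f x) \<le> K"
    unfolding bounded_iff by blast
  show ?thesis
  proof (rule integrable_const_bound[of _ K])
    have "AE t in \<mu>. 0 \<le> t \<and> t \<le> B" using assms(1) by (simp add: bounded_prob_def)
    then show "AE t in \<mu>. norm (f t) \<le> K" by eventually_elim (use K in auto)
  qed measurable
qed

lemma power_over_fact_tendsto_0: "(\<lambda>n. x ^ n / fact n) \<longlonglongrightarrow> 0" for x :: real
  using summable_LIMSEQ_zero[OF summable_exp[of x]] by (simp add: field_simps)

text \<open>On a bounded interval the Taylor remainder of the characteristic function is at most a
  multiple of \<open>(\<bar>t\<bar> * R) ^ n / fact n\<close>, which tends to 0. Hence the moments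
  determine the characteristic function, and this determines the measure.\<close>

lemma bounded_prob_unique:
  assumes "bounded_prob B \<mu>" "bounded_prob B' \<nu>"
    and m: "\<And>k. (\<integral>t. t ^ k \<partial>\<mu>) = (\<integral>t. t ^ k \<partial>\<nu>)"
  shows "\<mu> = \<nu>"
proof -
  define R where "R = max 1 (max B B')"
  have "x \<le> R" if "x \<le> B \<or> x \<le> B'" for x using that by (auto simp: R_def)
  then have bp: "bounded_prob R \<mu>" "bounded_prob R \<nu>"
    using assms(1,2) eventually_mono[of "\<lambda>t. 0 \<le> t \<and> t \<le> B" "ae_filter \<mu>" "\<lambda>t. 0 \<le> t \<and> t \<le> R"]
      eventually_mono[of "\<lambda>t. 0 \<le> t \<and> t \<le> B'" "ae_filter \<nu>" "\<lambda>t. 0 \<le> t \<and> t \<le> R"]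
    unfolding bounded_prob_def by blast+
  have rd: "real_distribution \<mu>" "real_distribution \<nu>"
    using assms by (auto simp: bounded_prob_def real_distribution_def real_distribution_axioms_def)
  have ap: "cmod (char M t - (\<Sum>k \<le> n. ((\<i> * t)^k / fact k) * (\<integral>x. x^k \<partial>M))) \<le> 2 * ((\<bar>t\<bar> * R)^n / fact n)"
    if M: "bounded_prob R M" and M': "real_distribution M" for M t n
  proof -
    interpret real_distribution M by fact
    have step: "cmod (char M t - (\<Sum>k \<le> n. ((\<i> * t)^k / fact k) * expectation (\<lambda>x. x^k))) \<le> (2*\<bar>t\<bar>^n / fact n) * expectation (\<lambda>x. \<bar>x\<bar>^n)"
      by (rule char_approx1) (intro bounded_prob_integrable_cont[OF M] continuous_intros)
    have "expectation (\<lambda>x. \<bar>x\<bar>^n) \<le> R ^ n"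
    proof (rule integral_le_const)
      show "integrable M (\<lambda>x. \<bar>x\<bar> ^ n)"
        by (intro bounded_prob_integrable_cont[OF M] continuous_intros)
      have "AE x in M. 0 \<le> x \<and> x \<le> R" using M by (simp add: bounded_prob_def)
      then show "AE x in M. \<bar>x\<bar> ^ n \<le> R ^ n" by eventually_elim (auto intro: power_mono)
    qed
    then have "2 * \<bar>t\<bar> ^ n / fact n * expectation (\<lambda>x. \<bar>x\<bar>^n) \<le> 2 * \<bar>t\<bar> ^ n / fact n * R ^ n"
      by (rule mult_left_mono) simp
    with step show ?thesis by (simp add: power_mult_distrib)
  qed
  have "char \<mu> t = char \<nu> t" for t
  proof -
    have "cmod (char \<mu> t - char \<nu> t) \<le> 4 * ((\<bar>t\<bar> * R)^n / fact n)" for n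
    proof -
      let ?S = "(\<Sum>k \<le> n. ((\<i> * t)^k / fact k) * (\<integral>x. x^k \<partial>\<nu>))"
      have "cmod (char \<mu> t - ?S) \<le> 2 * ((\<bar>t\<bar> * R)^n / fact n)"
        using ap[OF bp(1) rd(1), of t n] by (simp add: m)
      moreover have "cmod (char \<nu> t - ?S) \<le> 2 * ((\<bar>t\<bar> * R)^n / fact n)"
        using ap[OF bp(2) rd(2), of t n] .
      ultimately show ?thesis
        using norm_triangle_ineq4[of "char \<mu> t - ?S" "char \<nu> t - ?S"] by simp
    qed
    moreover have "(\<lambda>n. 4 * ((\<bar>t\<bar> * R)^n / fact n)) \<longlonglongrightarrow> 4 * 0"
      by (intro tendsto_mult tendsto_const power_over_fact_tendsto_0 )
    ultimately have "cmod (char \<mu> t - char \<nu> t) \<le> 4 * 0"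
      by (meson LIMSEQ_le_const)
    then show ?thesis by simp
  qed
  then show ?thesis using Levy_uniqueness rd by blast
qed

lemma bounded_prob_poly_integral:
  assumes "bounded_prob B \<mu>"
  shows "(\<integral>t. poly p t \<partial>\<mu>) = (\<Sum>i\<le>degree p. coeff p i * (\<integral>t. t ^ i \<partial>\<mu>))"
  unfolding poly_altdef
  by (subst Bochner_Integration.integral_sum)
     (auto intro!: bounded_prob_integrable_cont[OF assms] continuous_intros)

text \<open>The three positivity assumptions are what a vector state gives for an operator between 0
  and \<open>B\<close>. The functional is evaluated on the Bernstein polynomials of degree N; the
  values are the masses of a discrete measure on the points \<open>B * j / N\<close>, and a weak
  limit of these measures represents \<Lambda>.\<close>

theorem hausdorff_moment_problem:
  fixes \<Lambda> :: "real poly \<Rightarrow> real"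
  assumes B: "B > 0"
    and add: "\<And>p q. \<Lambda> (p + q) = \<Lambda> p + \<Lambda> q"
    and smult: "\<And>c p. \<Lambda> (smult c p) = c * \<Lambda> p"
    and one: "\<Lambda> 1 = 1"
    and sq: "\<And>q. \<Lambda> (q * q) \<ge> 0"
    and lo: "\<And>q. \<Lambda> ([:0, 1:] * (q * q)) \<ge> 0"
    and hi: "\<And>q. \<Lambda> ([:B, -1:] * (q * q)) \<ge> 0"
  shows "\<exists>\<mu>. bounded_prob B \<mu> \<and> (\<forall>p. \<Lambda> p = (\<integral>t. poly p t \<partial>\<mu>))"
proof -
  have sum: "\<Lambda> (\<Sum>i\<in>I. f i) = (\<Sum>i\<in>I. \<Lambda> (f i))" for f :: "nat \<Rightarrow> real poly" and I
  proof -
    have "\<Lambda> 0 = 0" using smult[of 0 0] by simp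
    then show ?thesis by (induction I rule: infinite_finite_induct) (auto simp: add)
  qed
  define X where "X = [:0, 1::real:]"
  define Y where "Y = [:B, -1::real:]"
  have lo': "\<Lambda> (X * (q * q)) \<ge> 0" and hi': "\<Lambda> (Y * (q * q)) \<ge> 0" for q
    unfolding X_def Y_def by (rule lo, rule hi)
  have XY: "X + Y = [:B:]" by (simp add: X_def Y_def)
  \<comment> \<open>Positivity on \<open>X * Y\<close> times a square is not among the assumptions;
    it follows from \<open>B * X * Y = Y * X\<^sup>2 + X * Y\<^sup>2\<close>.\<close>
  have Bsq: "X * Y * (q * q) = smult (1/B) (Y * ((X * q) * (X * q)) + X * ((Y * q) * (Y * q)))" for q
  proof -
    have "Y * ((X * q) * (X * q)) + X * ((Y * q) * (Y * q)) = (X + Y) * (X * Y * (q * q))"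
      by (simp add: algebra_simps)
    then show ?thesis using B by (simp add: XY smult_smult)
  qed
  have pos: "\<Lambda> (X ^ j * Y ^ k) \<ge> 0" if "even (j + k)" for j k
  proof (cases "even j")
    case True
    then obtain a b where "j = a * 2" "k = b * 2" using \<open>even (j + k)\<close>
      by (metis dvd_div_mult_self even_add)
    then have "X ^ j * Y ^ k = (X ^ a * Y ^ b) * (X ^ a * Y ^ b)"
      by (simp only: mult_2_right power_add mult_ac power_one_right)
    then show ?thesis using sq by simp
  next
    case False
    then obtain a b where "j = a * 2 + 1" "k = b * 2 + 1" using \<open>even (j + k)\<close>
      by (metis add.commute mult.commute even_add oddE)
    then have "X ^ j * Y ^ k = X * Y * ((X ^ a * Y ^ b) * (X ^ a * Y ^ b))"
      by (simp only: mult_2_right power_add mult_ac power_one_right)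
    then have "\<Lambda> (X ^ j * Y ^ k) = 1 / B * (\<Lambda> (Y * ((X * (X ^ a * Y ^ b)) * (X * (X ^ a * Y ^ b))))
        + \<Lambda> (X * ((Y * (X ^ a * Y ^ b)) * (Y * (X ^ a * Y ^ b)))))"
      by (simp only: Bsq smult add)
    then show ?thesis using lo' hi' B by simp
  qed
  \<comment> \<open>An even degree gives \<open>j\<close> and \<open>N M - j\<close> the same
    parity, so that \<open>X ^ j * Y ^ (N M - j)\<close> is a square or \<open>X * Y\<close> times a
    square.\<close>
  define N where "N M = 2 * (M + 1)" for M :: nat
  define w where "w M j = \<Lambda> (smult (real (N M choose j) / B ^ N M) (X ^ j * Y ^ (N M - j)))" for M j
  have wpos: "w M j \<ge> 0" if "j \<le> N M" for M j
    proof -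
    have "even (j + (N M - j))" using that by (simp add: N_def)
    then show ?thesis unfolding w_def smult using B pos[of j "N M - j"] by simp
  qed
  have wsum: "(\<Sum>j\<le>N M. real (j choose k) * w M j) = real (N M choose k) * \<Lambda> (X ^ k) / B ^ k"
    if "k \<le> N M" for k M
  proof -
    have nat: "of_nat m * p = smult (real m) p" for m and p :: "real poly"
      by (simp add: of_nat_poly)
    have "(\<Sum>j\<le>N M. real (j choose k) * w M j) 
      = (\<Sum>j\<le>N M. \<Lambda> (smult (1 / B ^ N M) (of_nat (j choose k) * (of_nat (N M choose j) * X ^ j * Y ^ (N M - j)))))"
      by (rule sum.cong) (simp_all add: w_def smult nat)
    also have "\<dots> = \<Lambda> (smult (1 / B ^ N M) (\<Sum>j\<le>N M. of_nat (j choose k) * (of_nat (N M choose j) * X ^ j * Y ^ (N M - j))))"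
      by (simp only: smult sum sum_distrib_left)
    also have "\<dots> = \<Lambda> (smult (1 / B ^ N M) (of_nat (N M choose k) * X ^ k * [:B:] ^ (N M - k)))"
      by (simp only: sum_bernstein_choose XY)
    also have "\<dots> = \<Lambda> (smult (real (N M choose k) * B ^ (N M - k) / B ^ N M) (X ^ k))"
      by (simp only: nat poly_const_pow mult_smult_left) (simp add: mult_ac)
    also have "\<dots> = real (N M choose k) * B ^ (N M - k) / B ^ N M * \<Lambda> (X ^ k)"
      by (rule smult)
    also have "real (N M choose k) * B ^ (N M - k) / B ^ N M = real (N M choose k) / B ^ k"
      using that B by (simp add: power_diff)
    finally show ?thesis by simp
  qed
  have w1: "(\<Sum>j\<le>N M. w M j) = 1" for M using wsum[of 0 M] one by simp
  define P where "P M = point_measure {..N M} (w M)" for M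
  define \<mu> where "\<mu> M = distr (P M) borel (\<lambda>j. B * real j / real (N M))" for M
  have Pp: "prob_space (P M)" for M
    unfolding P_def using w1 wpos
    by (intro prob_spaceI, simp add: emeasure_point_measure_finite2 space_point_measure, subst sum_ennreal) auto
  have meas: "(\<lambda>j. B * real j / real (N M)) \<in> measurable (P M) borel" for M
    unfolding P_def measurable_point_measure_eq1 by simp
  have rd: "real_distribution (\<mu> M)" for M
    unfolding \<mu>_def by (rule prob_space.real_distribution_distr[OF Pp meas])
  have int: "(\<integral>t. f t \<partial>\<mu> M) = (\<Sum>j\<le>N M. f (B * real j / real (N M)) * w M j)"
    if "f \<in> borel_measurable borel" for f :: "real \<Rightarrow> real" and M
    unfolding \<mu>_def using meas that wpos
    by (subst integral_distr, simp, simp, unfold P_def, subst lebesgue_integral_point_measure_finite)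
       (auto simp: mult.commute)
  have rng: "-1 < B * real j / real (N M)" "0 \<le> B * real j / real (N M)" "B * real j / real (N M) \<le> B" if "j \<le> N M" for j M
  proof -
    show 0: "0 \<le> B * real j / real (N M)" using B by simp
    then show "-1 < B * real j / real (N M)" by linarith
    have "N M > 0" by (simp add: N_def)
    then show "B * real j / real (N M) \<le> B" using B that by (simp add: divide_simps)
  qed
  have "tight \<mu>"
    unfolding tight_def
  proof (intro conjI allI impI rd)
    fix \<epsilon> :: real assume "\<epsilon> > 0"
    \<comment> \<open>Tightness is tested on half-open intervals; the left end -1 keeps the atom at
      0 inside.\<close>
    have "measure (\<mu> M) {-1<..B} = 1" for M
    proof -
      have "measure (\<mu> M) {-1<..B} = (\<integral>t. indicator {-1<..B} t \<partial>\<mu> M)"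
        using real_distribution.events_eq_borel[OF rd] by simp
      also have "\<dots> = (\<Sum>j\<le>N M. w M j)"
        by (subst int, simp, rule sum.cong) (use rng in \<open>auto simp: indicator_def\<close>)
      finally show ?thesis using w1 by simp
    qed
    then show "\<exists>a b. a < b \<and> (\<forall>n. 1 - \<epsilon> < measure (\<mu> n) {a<..b})"
      using \<open>\<epsilon> > 0\<close> B by (intro exI[of _ "-1"] exI[of _ B]) auto
  qed
  from tight_imp_convergent_subsubsequence[OF this strict_mono_id]
  obtain r M where r: "strict_mono r" and M: "real_distribution M" and wc: "weak_conv_m (\<mu> \<circ> r) M"
    by (auto simp: comp_def id_def)
  have lim: "(\<lambda>n. integral\<^sup>L (\<mu> (r n)) f) \<longlonglongrightarrow> integral\<^sup>L M f"
    if "\<And>x. isCont f x" "\<And>x. norm (f x) \<le> C" for f :: "real \<Rightarrow> real" and C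
    using weak_conv_imp_integral_bdd_continuous_conv[of "\<mu> \<circ> r" M f C] that rd M wc by (simp add: comp_def)
  interpret M: real_distribution M by fact
  \<comment> \<open>A bounded continuous test function that vanishes exactly on
    \<open>{0..B}\<close>: it shows that the weak limit still lives there.\<close>
  define g where "g x = min 1 (max 0 (- x) + max 0 (x - B))" for x :: real
  have gc: "isCont g x" for x unfolding g_def by (intro continuous_intros)
  have [measurable]: "g \<in> borel_measurable borel" unfolding g_def by simp
  have g0: "0 \<le> g x" "g x \<le> 1" for x by (auto simp: g_def)
  have "integral\<^sup>L (\<mu> n) g = 0" for n
    by (subst int, simp, rule sum.neutral) (use rng in \<open>auto simp: g_def\<close>)
  then have "(\<lambda>n. 0) \<longlonglongrightarrow> integral\<^sup>L M g"
    using lim[of g 1] gc g0 by simp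
  then have "integral\<^sup>L M g = 0" using LIMSEQ_unique tendsto_const by blast
  moreover have "integrable M g"
    using g0 by (intro M.integrable_const_bound[of _ 1]) auto
  ultimately have "AE x in M. g x = 0"
    using integral_nonneg_eq_0_iff_AE[of M g] g0 by auto
  then have AEb: "AE x in M. 0 \<le> x \<and> x \<le> B"
    by eventually_elim (auto simp: g_def min_def max_def split: if_splits)
  have bp: "bounded_prob B M"
    using AEb M.prob_space_axioms by (simp add: bounded_prob_def)
  have mom: "\<Lambda> (X ^ k) = (\<integral>t. t ^ k \<partial>M)" for k
  proof -
    \<comment> \<open>Weak convergence only tests bounded functions, so the power is cut off outside
      \<open>{0..B}\<close>, where the limit has no mass.\<close>
    define f where "f x = (max 0 (min B x)) ^ k" for x
    have [measurable]: "f \<in> borel_measurable borel" unfolding f_def by simp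
    have fc: "isCont f x" for x unfolding f_def by (intro continuous_intros)
    have fb: "norm (f x) \<le> B ^ k" for x
      using B by (auto simp: f_def intro!: power_mono)
    have "(\<lambda>n. integral\<^sup>L (\<mu> n) f) \<longlonglongrightarrow> \<Lambda> (X ^ k)"
    proof -
      have "\<bar>integral\<^sup>L (\<mu> n) f - \<Lambda> (X ^ k)\<bar> \<le> B ^ k * (2 * real k * real k / real (N n))" if "n \<ge> k" for n
      proof -
        have kN: "2 * k \<le> N n" "N n > 0" using that by (auto simp: N_def)
        have "integral\<^sup>L (\<mu> n) f = (\<Sum>j\<le>N n. B ^ k * (real j / real (N n)) ^ k * w n j)"
        proof (subst int, simp, rule sum.cong)
          fix j assume "j \<in> {..N n}"
          then have "max 0 (min B (B * real j / real (N n))) = B * real j / real (N n)"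
            using rng[of j n] by (simp only: atMost_iff min_absorb2 max_absorb2)
          then show "f (B * real j / real (N n)) * w n j = B ^ k * (real j / real (N n)) ^ k * w n j"
            by (simp add: f_def power_mult_distrib power_divide)
        qed simp
        \<comment> \<open>The exact factorial moment identity \<open>wsum\<close>. The k-th moment
          of the discrete measure has \<open>(j / N) ^ k\<close> in place of the quotient of
          binomials, and \<open>choose_ratio_approx\<close> compares the two.\<close>
        moreover have "\<Lambda> (X ^ k) = (\<Sum>j\<le>N n. B ^ k * (real (j choose k) / real (N n choose k)) * w n j)"
        proof -
          have "real (N n choose k) > 0" using kN by simp
          moreover have "(\<Sum>j\<le>N n. B ^ k * (real (j choose k) / real (N n choose k)) * w n j)
             = B ^ k / real (N n choose k) * (\<Sum>j\<le>N n. real (j choose k) * w n j)"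
            by (simp add: sum_distrib_left mult_ac)
          ultimately show ?thesis using wsum[of k n] kN B by simp
        qed
        ultimately have "\<bar>integral\<^sup>L (\<mu> n) f - \<Lambda> (X ^ k)\<bar> = 
           \<bar>\<Sum>j\<le>N n. B ^ k * (real j / real (N n)) ^ k * w n j - B ^ k * (real (j choose k) / real (N n choose k)) * w n j\<bar>"
          by (simp add: sum_subtractf)
        also have "\<dots> \<le> (\<Sum>j\<le>N n. B ^ k * (2 * real k * real k / real (N n)) * w n j)"
        proof (rule order_trans[OF sum_abs sum_mono])
          fix j assume j: "j \<in> {..N n}"
          have "\<bar>B ^ k * (real j / real (N n)) ^ k * w n j - B ^ k * (real (j choose k) / real (N n choose k)) * w n j\<bar>
            = B ^ k * \<bar>real (j choose k) / real (N n choose k) - (real j / real (N n)) ^ k\<bar> * w n j"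
          proof -
            have "B ^ k * (real j / real (N n)) ^ k * w n j - B ^ k * (real (j choose k) / real (N n choose k)) * w n j
              = B ^ k * ((real j / real (N n)) ^ k - real (j choose k) / real (N n choose k)) * w n j"
              by (simp only: left_diff_distrib right_diff_distrib)
            then show ?thesis using B wpos[of j n] j by (simp only: abs_mult abs_minus_commute) simp
          qed
          also have "\<dots> \<le> B ^ k * (2 * real k * real k / real (N n)) * w n j"
            using choose_ratio_approx[OF kN(1) _ kN(2), of j] B wpos[of j n] j
            by (intro mult_right_mono mult_left_mono) auto
          finally show "\<bar>B ^ k * (real j / real (N n)) ^ k * w n j - B ^ k * (real (j choose k) / real (N n choose k)) * w n j\<bar>
            \<le> B ^ k * (2 * real k * real k / real (N n)) * w n j" .
        qed
        also have "\<dots> = B ^ k * (2 * real k * real k / real (N n))"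
          by (simp only: sum_distrib_left[symmetric] w1 mult_1_right)
        finally show ?thesis .
      qed
      moreover have "(\<lambda>n. B ^ k * (2 * real k * real k / real (N n))) \<longlonglongrightarrow> 0"
        unfolding N_def by real_asymp
      ultimately have "(\<lambda>n. integral\<^sup>L (\<mu> n) f - \<Lambda> (X ^ k)) \<longlonglongrightarrow> 0"
        by - (rule Lim_null_comparison[where f = "\<lambda>n. integral\<^sup>L (\<mu> n) f - \<Lambda> (X ^ k)", OF eventually_sequentiallyI[of k]],
          auto simp only: real_norm_def)
      then show ?thesis by (rule LIM_zero_cancel)
    qed
    from LIMSEQ_subseq_LIMSEQ[OF this r] have "(\<lambda>n. integral\<^sup>L (\<mu> (r n)) f) \<longlonglongrightarrow> \<Lambda> (X ^ k)"
      by (simp only: comp_def)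
    from LIMSEQ_unique[OF lim[OF fc fb] this] have "integral\<^sup>L M f = \<Lambda> (X ^ k)" .
    moreover have "integral\<^sup>L M f = (\<integral>t. t ^ k \<partial>M)"
      by (rule integral_cong_AE, simp, simp) (use AEb in \<open>eventually_elim, auto simp: f_def\<close>)
    ultimately show ?thesis by simp
  qed
  have "\<Lambda> p = (\<integral>t. poly p t \<partial>M)" for p
  proof -
    have "p = (\<Sum>i\<le>degree p. smult (coeff p i) (X ^ i))"
      by (simp only: X_def monom_altdef[symmetric] poly_as_sum_of_monoms)
    then have "\<Lambda> p = \<Lambda> (\<Sum>i\<le>degree p. smult (coeff p i) (X ^ i))" by (rule arg_cong)
    also have "\<dots> = (\<Sum>i\<le>degree p. coeff p i * \<Lambda> (X ^ i))"
      by (simp only: smult sum)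
    finally have "\<Lambda> p = (\<Sum>i\<le>degree p. coeff p i * \<Lambda> (X ^ i))" .
    then show ?thesis by (simp add: bounded_prob_poly_integral[OF bp] mom)
  qed
  with bp show ?thesis by blast
qed

section \<open>Layer cake formula\<close>

text \<open>Integration of \<open>u powr p\<close> by parts twice. The kernel is the positive part
  of \<open>u - a\<close>, not an indicator function, because this is the quantity that the
  interpolation controls.\<close>

lemma powr_layer_cake:
  fixes u p :: real
  assumes p: "p > 1" and u: "u \<ge> 0"
  shows "(\<integral>\<^sup>+a. ennreal (indicator {0<..} a * (p * (p - 1) * a powr (p - 2)) * max 0 (u - a)) \<partial>lborel) = ennreal (u powr p)"
proof (cases "u = 0")
  case True
  have "indicator {0<..} a * (p * (p - 1) * a powr (p - 2)) * max 0 (u - a) = 0" for a :: real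
    using True by (auto simp: indicator_def)
  then have "ennreal (indicator {0<..} a * (p * (p - 1) * a powr (p - 2)) * max 0 (u - a)) = 0" for a :: real
    by (simp only: ennreal_0)
  then show ?thesis using True by simp
next
  case False
  then have u: "u > 0" using u by simp
  define f where "f x = p * (p - 1) * x powr (p - 2) * (u - x)" for x
  \<comment> \<open>An antiderivative of \<open>f\<close> on the positive axis, with
    \<open>F u = u powr p\<close> and limit 0 at 0 because \<open>p > 1\<close>. For
    \<open>p < 2\<close> the weight is singular at 0, which calls for the improper form of the
    fundamental theorem.\<close>
  define F where "F x = p * u * x powr (p - 1) - (p - 1) * x powr p" for x
  have F: "DERIV F x :> f x" if "0 < x" for x
  proof -
    have "((\<lambda>x. p * u * x powr (p - 1) - (p - 1) * x powr p) has_real_derivative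
        p * u * ((p - 1) * x powr (p - 1 - 1)) - (p - 1) * (p * x powr (p - 1))) (at x)"
      using that by (intro DERIV_diff DERIV_cmult has_real_derivative_powr)
    moreover have "x powr (p - 1) = x powr (p - 2) * x"
      using that by (simp add: powr_diff power2_eq_square)
    ultimately show ?thesis unfolding F_def f_def by (simp add: algebra_simps)
  qed
  have f: "isCont f x" if "0 < x" for x
    unfolding f_def using that by (intro continuous_intros) auto
  have FA: "((F \<circ> real_of_ereal) \<longlongrightarrow> 0) (at_right 0)"
  proof -
    have "(F \<longlongrightarrow> 0) (at_right 0)"
      unfolding F_def using p u by real_asymp
    then show ?thesis
      by (simp add: ereal_tendsto_simps1(2)[symmetric] zero_ereal_def comp_def)
  qed
  have FB: "((F \<circ> real_of_ereal) \<longlongrightarrow> u powr p) (at_left (ereal u))"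
  proof -
    have "isCont F u" using F[OF u] by (rule DERIV_isCont)
    then have "(F \<longlongrightarrow> F u) (at_left u)" by (simp add: isCont_def filterlim_at_split)
    moreover have "F u = u powr p"
    proof -
      have "u * u powr (p - 1) = u powr p" using u by (simp add: powr_diff)
      then show ?thesis by (simp add: F_def algebra_simps)
    qed
    ultimately show ?thesis
      by (simp add: ereal_tendsto_simps1(1)[symmetric] comp_def)
  qed
  have *: "set_integrable lborel (einterval 0 (ereal u)) f" "(LBINT x=0..ereal u. f x) = u powr p - 0"
    using interval_integral_FTC_nonneg[of 0 "ereal u" F f 0 "u powr p"] F f FA FB u p
    by (auto simp: f_def)
  have "einterval 0 (ereal u) = {0<..<u}" by (auto simp: einterval_def)
  then have eq: "indicator {0<..} a * (p * (p - 1) * a powr (p - 2)) * max 0 (u - a) = indicator (einterval 0 (ereal u)) a *\<^sub>R f a" for a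
    by (auto simp: indicator_def f_def)
  have "(\<integral>\<^sup>+a. ennreal (indicator (einterval 0 (ereal u)) a *\<^sub>R f a) \<partial>lborel) = ennreal (LINT a|lborel. indicator (einterval 0 (ereal u)) a *\<^sub>R f a)"
  proof (rule nn_integral_eq_integral)
    show "integrable lborel (\<lambda>a. indicator (einterval 0 (ereal u)) a *\<^sub>R f a)"
      using *(1) by (simp add: set_integrable_def)
    have "0 \<le> indicator (einterval 0 (ereal u)) a *\<^sub>R f a" for a
      unfolding eq[symmetric] using p by auto
    then show "AE a in lborel. 0 \<le> indicator (einterval 0 (ereal u)) a *\<^sub>R f a" by simp
  qed
  also have "\<dots> = ennreal (u powr p)"
    using *(2) u by (simp add: interval_lebesgue_integral_def set_lebesgue_integral_def)
  finally show ?thesis unfolding eq .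
qed

lemma nn_integral_powr_layer_cake:
  fixes \<mu> :: "real measure" and U :: "real \<Rightarrow> real"
  assumes "prob_space \<mu>" and [measurable_cong]: "sets \<mu> = sets borel"
    and [measurable]: "U \<in> borel_measurable borel" and U: "\<And>s. U s \<ge> 0" and p: "p > 1"
  shows "(\<integral>\<^sup>+s. ennreal (U s powr p) \<partial>\<mu>) 
    = (\<integral>\<^sup>+a. ennreal (indicator {0<..} a * (p * (p - 1) * a powr (p - 2))) * (\<integral>\<^sup>+s. ennreal (max 0 (U s - a)) \<partial>\<mu>) \<partial>lborel)"
proof -
  interpret prob_space \<mu> by fact
  interpret pair_sigma_finite \<mu> lborel ..
  let ?w = "\<lambda>a::real. indicator {0<..} a * (p * (p - 1) * a powr (p - 2))"
  have w: "?w a \<ge> 0" for a using p by auto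
  have "(\<integral>\<^sup>+s. ennreal (U s powr p) \<partial>\<mu>) = (\<integral>\<^sup>+s. (\<integral>\<^sup>+a. ennreal (?w a * max 0 (U s - a)) \<partial>lborel) \<partial>\<mu>)"
    by (simp only: powr_layer_cake[OF p U])
  also have "\<dots> = (\<integral>\<^sup>+a. (\<integral>\<^sup>+s. ennreal (?w a * max 0 (U s - a)) \<partial>\<mu>) \<partial>lborel)"
    by (rule Fubini'[symmetric]) measurable
  also have "\<dots> = (\<integral>\<^sup>+a. ennreal (?w a) * (\<integral>\<^sup>+s. ennreal (max 0 (U s - a)) \<partial>\<mu>) \<partial>lborel)"
    by (intro nn_integral_cong, subst nn_integral_cmult[symmetric], simp)
       (intro nn_integral_cong, simp only: ennreal_mult'[OF w])
  finally show ?thesis .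
qed

text \<open>After division by \<open>C\<close>, the hypothesis compares the layers of
  \<open>sqrt s / C\<close> under \<open>\<mu>\<close> with those of \<open>sqrt s\<close> under
  \<open>\<nu>\<close> at every height; the layer cake formula adds them up.\<close>

lemma powr_integral_mono:
  fixes \<mu> \<nu> :: "real measure" and p C :: real
  assumes \<mu>: "bounded_prob B \<mu>" and \<nu>: "bounded_prob B' \<nu>" and C: "C > 0" and p: "p \<ge> 1"
    and le: "\<And>a. a > 0 \<Longrightarrow> (\<integral>s. max 0 (sqrt s - C * a) \<partial>\<mu>) \<le> C * (\<integral>s. max 0 (sqrt s - a) \<partial>\<nu>)"
  shows "(\<integral>s. s powr (p / 2) \<partial>\<mu>) \<le> C powr p * (\<integral>s. s powr (p / 2) \<partial>\<nu>)"
proof -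
  \<comment> \<open>\<open>sqrt\<close> is negative at negative arguments. \<open>U\<close> agrees
    with it on the half-line that carries the measures and is nonnegative and continuous
    everywhere.\<close>
  define U where "U s = sqrt (max 0 s)" for s
  have Uc: "continuous_on UNIV U" unfolding U_def by (intro continuous_intros)
  have U0: "U s \<ge> 0" for s by (simp add: U_def)
  have [measurable]: "U \<in> borel_measurable borel" using Uc by (rule borel_measurable_continuous_onI)
  have Upow: "U s powr p = s powr (p / 2)" if "s \<ge> 0" for s
    using that p by (simp add: U_def powr_half_sqrt[symmetric] powr_powr)
  have ps: "prob_space \<mu>" "prob_space \<nu>" and s[measurable_cong]: "sets \<mu> = sets borel" "sets \<nu> = sets borel"
    and AE: "AE s in \<mu>. 0 \<le> s \<and> s \<le> B" "AE s in \<nu>. 0 \<le> s \<and> s \<le> B'"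
    using \<mu> \<nu> by (auto simp: bounded_prob_def)
  have cong: "(\<integral>s. g s \<partial>\<mu>) = (\<integral>s. h s \<partial>\<mu>)" "(\<integral>s. g s \<partial>\<nu>) = (\<integral>s. h s \<partial>\<nu>)"
    if "\<And>s. s \<ge> 0 \<Longrightarrow> g s = h s" "g \<in> borel_measurable borel" "h \<in> borel_measurable borel" for g h :: "real \<Rightarrow> real"
    using AE that by (auto intro!: integral_cong_AE elim!: eventually_mono)
  have le': "(\<integral>s. max 0 (U s / C - a) \<partial>\<mu>) \<le> (\<integral>s. max 0 (U s - a) \<partial>\<nu>)" if "a > 0" for a
  proof -
    have "(\<integral>s. max 0 (U s / C - a) \<partial>\<mu>) = (\<integral>s. (1 / C) * max 0 (sqrt s - C * a) \<partial>\<mu>)"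
      using C by (intro cong) (auto simp: U_def max_def field_simps)
    also have "\<dots> = (1 / C) * (\<integral>s. max 0 (sqrt s - C * a) \<partial>\<mu>)" by simp
    also have "\<dots> \<le> (1 / C) * (C * (\<integral>s. max 0 (sqrt s - a) \<partial>\<nu>))"
      using C by (intro mult_left_mono le that) auto
    also have "\<dots> = (\<integral>s. max 0 (U s - a) \<partial>\<nu>)"
      using C by simp (intro cong, auto simp: U_def)
    finally show ?thesis .
  qed
  have main: "(\<integral>s. (U s / C) powr p \<partial>\<mu>) \<le> (\<integral>s. U s powr p \<partial>\<nu>)"
  \<comment> \<open>At \<open>p = 1\<close> the weight \<open>p * (p - 1) * a powr (p - 2)\<close>
    vanishes; here the heights tend to 0 instead.\<close>
  proof (cases "p = 1")
    case True
    have "(\<integral>s. U s / C \<partial>\<mu>) - a \<le> (\<integral>s. U s \<partial>\<nu>)" if "a > 0" for a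
    proof -
      interpret \<mu>: prob_space \<mu> by fact
      have "(\<integral>s. U s / C \<partial>\<mu>) - a = (\<integral>s. U s / C - a \<partial>\<mu>)"
        by (subst Bochner_Integration.integral_diff)
           (use C in \<open>auto intro!: bounded_prob_integrable_cont[OF \<mu>] continuous_intros Uc simp: \<mu>.prob_space\<close>)
      also have "\<dots> \<le> (\<integral>s. max 0 (U s / C - a) \<partial>\<mu>)"
        using C by (intro integral_mono bounded_prob_integrable_cont[OF \<mu>] continuous_intros Uc) auto
      also have "\<dots> \<le> (\<integral>s. max 0 (U s - a) \<partial>\<nu>)" by (rule le'[OF that])
      also have "\<dots> \<le> (\<integral>s. U s \<partial>\<nu>)"
        using U0 that by (intro integral_mono bounded_prob_integrable_cont[OF \<nu>] continuous_intros Uc) auto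
      finally show ?thesis .
    qed
    then have "(\<integral>s. U s / C \<partial>\<mu>) \<le> (\<integral>s. U s \<partial>\<nu>)"
      by (metis add.commute diff_le_eq field_le_epsilon)
    then show ?thesis using True U0 C by simp
  next
    case False
    then have p1: "p > 1" using p by simp
    have "(\<integral>\<^sup>+s. ennreal ((U s / C) powr p) \<partial>\<mu>) \<le> (\<integral>\<^sup>+s. ennreal (U s powr p) \<partial>\<nu>)"
    proof (subst (1 2) nn_integral_powr_layer_cake)
      show "(\<integral>\<^sup>+a. ennreal (indicator {0<..} a * (p * (p - 1) * a powr (p - 2))) * (\<integral>\<^sup>+s. ennreal (max 0 (U s / C - a)) \<partial>\<mu>) \<partial>lborel)
        \<le> (\<integral>\<^sup>+a. ennreal (indicator {0<..} a * (p * (p - 1) * a powr (p - 2))) * (\<integral>\<^sup>+s. ennreal (max 0 (U s - a)) \<partial>\<nu>) \<partial>lborel)"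
      proof (rule nn_integral_mono)
        fix a :: real
        show "ennreal (indicator {0<..} a * (p * (p - 1) * a powr (p - 2))) * (\<integral>\<^sup>+s. ennreal (max 0 (U s / C - a)) \<partial>\<mu>)
          \<le> ennreal (indicator {0<..} a * (p * (p - 1) * a powr (p - 2))) * (\<integral>\<^sup>+s. ennreal (max 0 (U s - a)) \<partial>\<nu>)"
        proof (cases "a > 0")
          case True
          have "(\<integral>\<^sup>+s. ennreal (max 0 (U s / C - a)) \<partial>\<mu>) = ennreal (\<integral>s. max 0 (U s / C - a) \<partial>\<mu>)"
            using C by (intro nn_integral_eq_integral bounded_prob_integrable_cont[OF \<mu>] continuous_intros Uc) auto
          moreover have "(\<integral>\<^sup>+s. ennreal (max 0 (U s - a)) \<partial>\<nu>) = ennreal (\<integral>s. max 0 (U s - a) \<partial>\<nu>)"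
            by (intro nn_integral_eq_integral bounded_prob_integrable_cont[OF \<nu>] continuous_intros Uc) auto
          ultimately show ?thesis using le'[OF True] by (auto intro!: mult_left_mono ennreal_leI)
        qed simp
      qed
    qed (use ps s U0 C p1 in auto)
    moreover have "(\<integral>\<^sup>+s. ennreal ((U s / C) powr p) \<partial>\<mu>) = ennreal (\<integral>s. (U s / C) powr p \<partial>\<mu>)"
      using C p1 U0 by (intro nn_integral_eq_integral bounded_prob_integrable_cont[OF \<mu>] continuous_on_powr' continuous_intros Uc) auto
    moreover have "(\<integral>\<^sup>+s. ennreal (U s powr p) \<partial>\<nu>) = ennreal (\<integral>s. U s powr p \<partial>\<nu>)"
      using C p1 U0 by (intro nn_integral_eq_integral bounded_prob_integrable_cont[OF \<nu>] continuous_on_powr' continuous_intros Uc) auto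
    ultimately show ?thesis by (simp add: ennreal_le_iff integral_nonneg_AE)
  qed
  have "(\<integral>s. (U s / C) powr p \<partial>\<mu>) = (\<integral>s. s powr (p / 2) / C powr p \<partial>\<mu>)"
    using C U0 by (intro cong) (auto simp: powr_divide Upow)
  moreover have "(\<integral>s. U s powr p \<partial>\<nu>) = (\<integral>s. s powr (p / 2) \<partial>\<nu>)"
    by (intro cong) (auto simp: Upow)
  moreover have "C powr p > 0" using C by simp
  ultimately show ?thesis using main C by (simp add: pos_divide_le_eq mult.commute)
qed

lemma poly_uniform_approx:
  fixes f :: "real \<Rightarrow> real"
  assumes "continuous_on {0..B} f"
  obtains q :: "nat \<Rightarrow> real poly" where "\<And>m s. s \<in> {0..B} \<Longrightarrow> \<bar>poly (q m) s - f s\<bar> < 1 / real (Suc m)"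
proof -
  have "\<exists>q :: real poly. \<forall>s\<in>{0..B}. \<bar>poly q s - f s\<bar> < e" if "e > 0" for e
  proof -
    obtain g where g: "real_polynomial_function g" "\<And>x. x \<in> {0..B} \<Longrightarrow> \<bar>f x - g x\<bar> < e"
      using Stone_Weierstrass_real_polynomial_function[OF compact_Icc assms \<open>e > 0\<close>] by metis
    then obtain a n where "g = (\<lambda>x. \<Sum>i\<le>n. a i * x ^ i)" by (auto simp: real_polynomial_function_iff_sum)
    then have "poly (\<Sum>i\<le>n. monom (a i) i) = g" by (simp add: fun_eq_iff poly_sum poly_monom)
    then show ?thesis using g(2) by (metis abs_minus_commute)
  qed
  then have "\<forall>m. \<exists>q :: real poly. \<forall>s\<in>{0..B}. \<bar>poly q s - f s\<bar> < 1 / real (Suc m)" by simp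
  then obtain q :: "nat \<Rightarrow> real poly" where "\<forall>m. \<forall>s\<in>{0..B}. \<bar>poly (q m) s - f s\<bar> < 1 / real (Suc m)" by metis
  then show ?thesis using that by blast
qed

section \<open>Group algebras\<close>

instantiation poly_mapping :: (type, real_vector) real_vector
begin

lift_definition scaleR_poly_mapping :: "real \<Rightarrow> ('a \<Rightarrow>\<^sub>0 'b) \<Rightarrow> 'a \<Rightarrow>\<^sub>0 'b" is "\<lambda>r x g. r *\<^sub>R x g"
  by (erule finite_subset[rotated]) auto

instance
  by standard (transfer; simp add: fun_eq_iff algebra_simps)+

end

lemma lookup_scaleR [simp]: "Poly_Mapping.lookup (r *\<^sub>R x) g = r *\<^sub>R Poly_Mapping.lookup x g"
  by transfer simp

instantiation poly_mapping :: (type, real_inner) real_inner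
begin

text \<open>For complex coefficients this is the real part of the inner product of l^2, so
  \<open>inner x 1\<close> is the real part of the trace. The norm is the complex one, and for
  selfadjoint elements no information about the trace is lost.\<close>

definition inner_poly_mapping :: "('a \<Rightarrow>\<^sub>0 'b) \<Rightarrow> ('a \<Rightarrow>\<^sub>0 'b) \<Rightarrow> real" where
  "inner x y = (\<Sum>g\<in>Poly_Mapping.keys x. inner (Poly_Mapping.lookup x g) (Poly_Mapping.lookup y g))"

definition norm_poly_mapping_def: "norm (x :: 'a \<Rightarrow>\<^sub>0 'b) = sqrt (inner x x)"

definition sgn_poly_mapping_def: "sgn (x :: 'a \<Rightarrow>\<^sub>0 'b) = x /\<^sub>R norm x"

definition dist_poly_mapping_def: "dist (x :: 'a \<Rightarrow>\<^sub>0 'b) y = norm (x - y)"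

definition uniformity_poly_mapping_def [code del]:
  "(uniformity :: (('a \<Rightarrow>\<^sub>0 'b) \<times> ('a \<Rightarrow>\<^sub>0 'b)) filter) = (INF e\<in>{0<..}. principal {(x, y). dist x y < e})"

definition open_poly_mapping_def [code del]:
  "open (U :: ('a \<Rightarrow>\<^sub>0 'b) set) \<longleftrightarrow> (\<forall>x\<in>U. eventually (\<lambda>(x', y). x' = x \<longrightarrow> y \<in> U) uniformity)"

lemma inner_poly_mapping_superset:
  assumes "finite A" "Poly_Mapping.keys x \<subseteq> A"
  shows "inner x y = (\<Sum>g\<in>A. inner (Poly_Mapping.lookup x g) (Poly_Mapping.lookup y g))"
  unfolding inner_poly_mapping_def
  by (rule sum.mono_neutral_left[OF assms]) (auto simp: in_keys_iff)

instance
proof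
  fix x y z :: "'a \<Rightarrow>\<^sub>0 'b" and r :: real
  let ?A = "Poly_Mapping.keys x \<union> Poly_Mapping.keys y"
  have kA: "Poly_Mapping.keys (x + y) \<subseteq> ?A" by (rule keys_add)
  show "inner x y = inner y x"
    by (subst (1 2) inner_poly_mapping_superset[of ?A]) (auto simp: inner_commute)
  show "inner (x + y) z = inner x z + inner y z"
    by (subst (1 2 3) inner_poly_mapping_superset[of ?A])
       (use kA in \<open>auto simp: lookup_add inner_add_left sum.distrib\<close>)
  show "inner (r *\<^sub>R x) y = r * inner x y"
    by (subst inner_poly_mapping_superset[of "Poly_Mapping.keys x"])
       (auto simp: inner_poly_mapping_def sum_distrib_left in_keys_iff)
  show "0 \<le> inner x x"
    by (auto simp: inner_poly_mapping_def intro!: sum_nonneg)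
  show "inner x x = 0 \<longleftrightarrow> x = 0"
    by (auto simp: inner_poly_mapping_def sum_nonneg_eq_0_iff in_keys_iff intro!: poly_mapping_eqI)
qed (fact sgn_poly_mapping_def dist_poly_mapping_def uniformity_poly_mapping_def open_poly_mapping_def norm_poly_mapping_def)+

end

lemma poly_mapping_sum_singles:
  "x = (\<Sum>g\<in>Poly_Mapping.keys x. Poly_Mapping.single g (Poly_Mapping.lookup x g))"
  by (rule poly_mapping_eqI) (auto simp: lookup_sum lookup_single when_def in_keys_iff)

lemma poly_mapping_single_induct [case_names zero single add]:
  assumes "P 0" "\<And>g c. P (Poly_Mapping.single g c)" "\<And>x y. P x \<Longrightarrow> P y \<Longrightarrow> P (x + y)"
  shows "P (x :: 'a \<Rightarrow>\<^sub>0 'b::comm_monoid_add)"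
proof -
  have "P (\<Sum>g\<in>A. Poly_Mapping.single g (Poly_Mapping.lookup x g))" if "finite A" for A
    using that by (induction A) (auto simp: assms)
  then show ?thesis using poly_mapping_sum_singles[of x] by (metis finite_keys)
qed

instance poly_mapping :: (monoid_add, real_algebra_1) real_algebra_1
proof
  have eq: "r *\<^sub>R x = Poly_Mapping.single 0 (of_real r) * x" for r :: real and x :: "'a \<Rightarrow>\<^sub>0 'b"
    by (rule poly_mapping_eqI) (simp add: lookup_mult lookup_single when_mult mult_when scaleR_conv_of_real)
  have eq': "r *\<^sub>R x = x * Poly_Mapping.single 0 (of_real r)" for r :: real and x :: "'a \<Rightarrow>\<^sub>0 'b"
    unfolding eq by (induction x rule: poly_mapping_single_induct) (simp_all add: mult_single of_real_def distrib_left distrib_right)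
  fix r :: real and x y :: "'a \<Rightarrow>\<^sub>0 'b"
  show "r *\<^sub>R x * y = r *\<^sub>R (x * y)" by (simp only: eq mult.assoc)
  show "x * r *\<^sub>R y = r *\<^sub>R (x * y)" by (simp only: eq' mult.assoc)
qed

lemma inner_single_right [simp]:
  "inner x (Poly_Mapping.single g c) = inner (Poly_Mapping.lookup x g) (c :: 'b::real_inner)"
  by (auto simp: inner_poly_mapping_def lookup_single when_def if_distrib in_keys_iff cong: if_cong)

lemma inner_single_left [simp]:
  "inner (Poly_Mapping.single g c) x = inner (c :: 'b::real_inner) (Poly_Mapping.lookup x g)"
  by (metis inner_commute inner_single_right)

type_synonym 'g group_alg = "'g \<Rightarrow>\<^sub>0 complex"

lift_definition star :: "('g::group_add) group_alg \<Rightarrow> 'g group_alg" is "\<lambda>x g. cnj (x (- g))"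
proof -
  fix x :: "'g \<Rightarrow> complex" assume "finite {g. x g \<noteq> 0}"
  then have "finite (uminus ` {g. x g \<noteq> 0})" by simp
  then show "finite {g. cnj (x (- g)) \<noteq> 0}" by (rule finite_subset[rotated]) force
qed

lemma lookup_star [simp]: "Poly_Mapping.lookup (star x) g = cnj (Poly_Mapping.lookup x (- g))"
  by transfer simp

lemma star_add [simp]: "star (x + y) = star x + star y"
  and star_zero [simp]: "star 0 = 0"
  and star_scaleR [simp]: "star (r *\<^sub>R x) = r *\<^sub>R star x"
  and star_star [simp]: "star (star x) = x"
  by (auto intro!: poly_mapping_eqI simp: lookup_add lookup_minus)

lemma star_single [simp]: "star (Poly_Mapping.single g c) = Poly_Mapping.single (- g) (cnj c)"
proof (rule poly_mapping_eqI)
  fix k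
  have "g = - k \<longleftrightarrow> - g = k" by auto
  then show "Poly_Mapping.lookup (star (Poly_Mapping.single g c)) k = Poly_Mapping.lookup (Poly_Mapping.single (- g) (cnj c)) k"
    by (simp add: lookup_single when_def)
qed

lemma star_one [simp]: "star 1 = 1"
  by (metis complex_cnj_one minus_zero single_one star_single)

lemma star_mult [simp]: "star (x * y) = star y * star x"
proof (induction x rule: poly_mapping_single_induct)
  case (single g c)
  show ?case
    by (induction y rule: poly_mapping_single_induct) (simp_all add: mult_single minus_add algebra_simps)
qed (simp_all add: algebra_simps)

lemma star_power [simp]: "star (x ^ k) = star x ^ k"
  by (induction k) (simp_all add: power_commutes)

lemma inner_star_star: "inner (star x) (star y) = inner x y"
proof (induction x rule: poly_mapping_single_induct)
  case (single g c)
  show ?case by (simp add: inner_complex_def)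
qed (simp_all add: inner_add_left)

lemma inner_mult_left: "inner (x * y) z = inner y (star x * z)"
proof (induction x rule: poly_mapping_single_induct)
  case (single g c)
  show ?case
  proof (induction y rule: poly_mapping_single_induct)
    case (single h d)
    show ?case
    proof (induction z rule: poly_mapping_single_induct)
      case (single k e)
      have "g + h = k \<longleftrightarrow> h = - g + k" by (metis add.assoc add.left_neutral left_minus right_minus)
      then show ?case by (auto simp: mult_single lookup_single when_def inner_complex_def algebra_simps)
    qed (simp_all add: inner_add_right algebra_simps)
  qed (simp_all add: inner_add_left algebra_simps)
qed (simp_all add: inner_add_left inner_add_right algebra_simps)

text \<open>The trace property in disguise: \<open>star\<close> preserves the inner product and
  exchanges left with right multiplication.\<close>

lemma inner_mult_right: "inner (x * y) z = inner x (z * star y)"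
proof -
  have "inner (x * y) z = inner (star y * star x) (star z)" by (simp only: inner_star_star[symmetric, of "x * y"] star_mult)
  also have "\<dots> = inner (star x) (star (z * star y))" by (simp only: inner_mult_left star_star star_mult)
  finally show ?thesis by (simp only: inner_star_star)
qed

definition l1norm :: "'g group_alg \<Rightarrow> real" where
  "l1norm x = (\<Sum>g\<in>Poly_Mapping.keys x. cmod (Poly_Mapping.lookup x g))"

text \<open>A single group element acts as a unitary, since \<open>star\<close> of it is its
  inverse.\<close>

lemma norm_single_mult: "norm (Poly_Mapping.single g c * x) = cmod c * norm x" for x :: "'g::group_add group_alg"
proof -
  have s: "Poly_Mapping.single 0 (complex_of_real r) * x = r *\<^sub>R x" for r
  proof -
    have "Poly_Mapping.single 0 (complex_of_real r) = (r *\<^sub>R 1 :: 'g group_alg)"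
      by (rule poly_mapping_eqI, simp only: lookup_single lookup_scaleR lookup_one) (auto simp: when_def of_real_def)
    then show ?thesis by (simp only: mult_scaleR_left mult_1_left)
  qed
  have "inner (Poly_Mapping.single g c * x) (Poly_Mapping.single g c * x) = inner x (Poly_Mapping.single 0 (complex_of_real ((cmod c)^2)) * x)"
    by (simp only: inner_mult_left star_single mult.assoc[symmetric] mult_single left_minus)
       (simp only: complex_norm_square mult.commute[of "cnj c" c])
  also have "\<dots> = (cmod c)\<^sup>2 * inner x x" unfolding s by simp
  finally show ?thesis by (simp add: norm_eq_sqrt_inner real_sqrt_mult)
qed

lemma norm_mult_le_l1norm: "norm (x * y) \<le> l1norm x * norm y" for x y :: "'g::group_add group_alg"
proof -
  have "x * y = (\<Sum>g\<in>Poly_Mapping.keys x. Poly_Mapping.single g (Poly_Mapping.lookup x g) * y)"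
    by (subst (1) poly_mapping_sum_singles) (rule sum_distrib_right)
  then have "norm (x * y) \<le> (\<Sum>g\<in>Poly_Mapping.keys x. norm (Poly_Mapping.single g (Poly_Mapping.lookup x g) * y))"
    by (simp only: norm_sum)
  then show ?thesis by (simp add: norm_single_mult l1norm_def sum_distrib_right)
qed

lemma l1norm_nonneg: "l1norm x \<ge> 0"
  by (auto simp: l1norm_def intro: sum_nonneg)

lift_definition pmul :: "('g \<Rightarrow> real) \<Rightarrow> 'g group_alg \<Rightarrow> 'g group_alg" is "\<lambda>c x g. c g *\<^sub>R x g"
  by (erule finite_subset[rotated]) auto

lemma lookup_pmul [simp]: "Poly_Mapping.lookup (pmul c x) g = c g *\<^sub>R Poly_Mapping.lookup x g"
  by transfer simp

lemma pmul_diff: "pmul c (x - y) = pmul c x - pmul c y"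
  by (auto intro!: poly_mapping_eqI simp: lookup_add lookup_minus algebra_simps)

lemma keys_pmul: "Poly_Mapping.keys (pmul c x) \<subseteq> Poly_Mapping.keys x"
  by (auto simp: in_keys_iff)

lemma star_pmul: "star (pmul c x) = pmul (\<lambda>g. c (- g)) (star x)"
  by (rule poly_mapping_eqI) simp

lemma inner_pmul: "inner (pmul c x) y = inner x (pmul c y)"
  by (subst (1) inner_poly_mapping_superset[of "Poly_Mapping.keys x"]) (auto simp: inner_poly_mapping_def keys_pmul)

section \<open>Polynomial calculus and spectral measures\<close>

definition poly_eval :: "real poly \<Rightarrow> 'a \<Rightarrow> 'a::real_algebra_1" where
  "poly_eval p a = (\<Sum>i\<le>degree p. coeff p i *\<^sub>R a ^ i)"

lemma poly_eval_eq_sum: "degree p \<le> N \<Longrightarrow> poly_eval p a = (\<Sum>i\<le>N. coeff p i *\<^sub>R a ^ i)"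
  unfolding poly_eval_def by (rule sum.mono_neutral_left) (auto simp: coeff_eq_0)

lemma poly_eval_0 [simp]: "poly_eval 0 a = 0"
  by (simp add: poly_eval_def)

lemma poly_eval_pCons: "poly_eval (pCons c p) a = c *\<^sub>R 1 + a * poly_eval p a"
proof -
  have "poly_eval (pCons c p) a = (\<Sum>i\<le>Suc (degree p). coeff (pCons c p) i *\<^sub>R a ^ i)"
    by (rule poly_eval_eq_sum) (rule degree_pCons_le)
  then show ?thesis unfolding sum.atMost_Suc_shift by (simp add: poly_eval_def sum_distrib_left)
qed

lemma poly_eval_add: "poly_eval (p + q) a = poly_eval p a + poly_eval q a"
proof -
  have "degree (p + q) \<le> max (degree p) (degree q)" by (rule degree_add_le_max)
  then show ?thesis
    by (simp add: poly_eval_eq_sum[of _ "max (degree p) (degree q)"] scaleR_add_left sum.distrib)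
qed

lemma poly_eval_smult: "poly_eval (smult c p) a = c *\<^sub>R poly_eval p a"
proof -
  have "degree (smult c p) \<le> degree p" by (rule degree_smult_le)
  then show ?thesis
    by (simp add: poly_eval_eq_sum[of _ "degree p"] scaleR_sum_right)
qed

lemma poly_eval_diff: "poly_eval (p - q) a = poly_eval p a - poly_eval q a"
  using poly_eval_add[of "p - q" q a] by simp

lemma poly_eval_mult: "poly_eval (p * q) a = poly_eval p a * poly_eval q a"
  by (induction p) (simp_all add: poly_eval_add poly_eval_smult poly_eval_pCons distrib_right mult.assoc)

lemma poly_eval_1 [simp]: "poly_eval 1 a = 1"
  by (simp add: one_pCons poly_eval_pCons)

lemma poly_eval_monom [simp]: "poly_eval (monom 1 k) a = a ^ k"
  by (induction k) (simp_all add: monom_0 monom_Suc poly_eval_pCons one_pCons[symmetric])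

lemma poly_eval_commute: "poly_eval p a * a = a * poly_eval p a"
  by (induction p) (simp_all add: poly_eval_pCons distrib_left distrib_right mult.assoc)

lemma star_poly_eval: "star a = a \<Longrightarrow> star (poly_eval p a) = poly_eval p a"
  by (induction p) (simp_all add: poly_eval_pCons poly_eval_commute)

section \<open>Operator bounds on a subgroup, and spectral measures\<close>

definition add_subgroup :: "'g::group_add set \<Rightarrow> bool" where
  "add_subgroup S \<longleftrightarrow> 0 \<in> S \<and> (\<forall>g\<in>S. \<forall>h\<in>S. g + h \<in> S) \<and> (\<forall>g\<in>S. - g \<in> S)"

lemma supp_mult:
  assumes "add_subgroup S" "Poly_Mapping.keys x \<subseteq> S" "Poly_Mapping.keys y \<subseteq> S"
  shows "Poly_Mapping.keys (x * y :: 'g::group_add group_alg) \<subseteq> S"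
proof
  fix g assume "g \<in> Poly_Mapping.keys (x * y)"
  then obtain a b where "g = a + b" "a \<in> Poly_Mapping.keys x" "b \<in> Poly_Mapping.keys y"
    using keys_mult[of x y] by blast
  then show "g \<in> S" using assms by (auto simp: add_subgroup_def)
qed

lemma supp_star:
  assumes "add_subgroup S" "Poly_Mapping.keys x \<subseteq> S"
  shows "Poly_Mapping.keys (star x) \<subseteq> S"
proof
  fix g assume "g \<in> Poly_Mapping.keys (star x)"
  then have "- g \<in> Poly_Mapping.keys x" by (simp add: in_keys_iff)
  then have "- (- g) \<in> S" using assms unfolding add_subgroup_def by blast
  then show "g \<in> S" by simp
qed

lemma supp_poly_eval:
  assumes "add_subgroup S" "Poly_Mapping.keys a \<subseteq> S"
  shows "Poly_Mapping.keys (poly_eval p a :: 'g::group_add group_alg) \<subseteq> S"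
proof (induction p)
  case (pCons c p)
  have "Poly_Mapping.keys (c *\<^sub>R 1 :: 'g group_alg) \<subseteq> S"
    using assms(1) by (auto simp: in_keys_iff lookup_one when_def add_subgroup_def split: if_splits)
  then show ?case
    using supp_mult[OF assms pCons(2)] keys_add[of "c *\<^sub>R 1" "a * poly_eval p a"] unfolding poly_eval_pCons by blast
qed simp

text \<open>Says that left convolution by \<open>x\<close> has norm at most \<open>M\<close> on
  l^2(S), tested on finitely supported vectors. A relation instead of a supremum spares all
  questions of boundedness until \<open>opnorm\<close> itself is met.\<close>

definition op_bound :: "'g set \<Rightarrow> 'g::group_add group_alg \<Rightarrow> real \<Rightarrow> bool" where
  "op_bound S x M \<longleftrightarrow> 0 \<le> M \<and> (\<forall>\<zeta>. Poly_Mapping.keys \<zeta> \<subseteq> S \<longrightarrow> norm (x * \<zeta>) \<le> M * norm \<zeta>)"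

lemma op_bound_star:
  assumes S: "add_subgroup S" and x: "Poly_Mapping.keys x \<subseteq> S" and M: "op_bound S x M"
  shows "op_bound S (star x) M"
  unfolding op_bound_def
proof (intro conjI allI impI)
  show M0: "0 \<le> M" using M by (simp add: op_bound_def)
  fix \<zeta> :: "'a group_alg" assume \<zeta>: "Poly_Mapping.keys \<zeta> \<subseteq> S"
  have s: "Poly_Mapping.keys (star x * \<zeta>) \<subseteq> S" by (rule supp_mult[OF S supp_star[OF S x] \<zeta>])
  have "norm (star x * \<zeta>) ^ 2 = inner \<zeta> (x * (star x * \<zeta>))"
    by (simp only: power2_norm_eq_inner inner_mult_left star_star)
  also have "\<dots> \<le> norm \<zeta> * norm (x * (star x * \<zeta>))" by (rule norm_cauchy_schwarz)
  also have "\<dots> \<le> norm \<zeta> * (M * norm (star x * \<zeta>))"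
    using M s by (intro mult_left_mono) (auto simp: op_bound_def)
  finally have "norm (star x * \<zeta>) * norm (star x * \<zeta>) \<le> (M * norm \<zeta>) * norm (star x * \<zeta>)"
    by (simp add: power2_eq_square mult_ac)
  then show "norm (star x * \<zeta>) \<le> M * norm \<zeta>"
  proof (cases "star x * \<zeta> = 0")
    case False
    then have "norm (star x * \<zeta>) > 0" by simp
    with \<open>norm (star x * \<zeta>) * norm (star x * \<zeta>) \<le> (M * norm \<zeta>) * norm (star x * \<zeta>)\<close>
    show ?thesis by (rule mult_right_le_imp_le)
  qed (use M0 in simp)
qed

text \<open>A bound for \<open>star x * x\<close>, because the l^1 norm dominates the operator norm.
  Adding 1 makes it positive, as the moment problem demands.\<close>

definition spectral_bound :: "'g group_alg \<Rightarrow> real" where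
  "spectral_bound x = (1 + l1norm x)\<^sup>2"

lemma spectral_bound_pos: "spectral_bound x > 0"
  using l1norm_nonneg[of x] by (simp add: spectral_bound_def)

lemma spectral_measure_exists:
  fixes x \<zeta> :: "'g::group_add group_alg"
  assumes n: "norm \<zeta> = 1"
  shows "\<exists>\<mu>. bounded_prob (spectral_bound x) \<mu> \<and> (\<forall>p. inner (poly_eval p (star x * x) * \<zeta>) \<zeta> = (\<integral>t. poly p t \<partial>\<mu>))"
proof (rule hausdorff_moment_problem[OF spectral_bound_pos])
  let ?a = "star x * x"
  have sa: "star (poly_eval p ?a) = poly_eval p ?a" for p by (rule star_poly_eval) simp
  have comm: "poly_eval (r * (q * q)) ?a * \<zeta> = poly_eval q ?a * (poly_eval r ?a * (poly_eval q ?a * \<zeta>))" for q r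
  proof -
    have "r * (q * q) = q * (r * q)" by (simp only: mult_ac)
    then show ?thesis by (simp only: poly_eval_mult mult.assoc)
  qed
  \<comment> \<open>With \<eta> = q(a) \<zeta>, the three positivity conditions become the signs of
    \<open>inner \<eta> \<eta>\<close>, of the squared norm of \<open>x * \<eta>\<close>, and of its
    difference to \<open>spectral_bound x\<close> times the squared norm of \<eta>.\<close>
  have move: "inner (poly_eval (r * (q * q)) ?a * \<zeta>) \<zeta> = inner (poly_eval r ?a * (poly_eval q ?a * \<zeta>)) (poly_eval q ?a * \<zeta>)" for q r
    unfolding comm by (simp only: inner_mult_left[of "poly_eval q ?a" "poly_eval r ?a * (poly_eval q ?a * \<zeta>)"] sa)
  have X: "poly_eval [:0, 1:] ?a = ?a" by (simp add: poly_eval_pCons)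
  fix p q :: "real poly" and c :: real
  show "inner (poly_eval (p + q) ?a * \<zeta>) \<zeta> = inner (poly_eval p ?a * \<zeta>) \<zeta> + inner (poly_eval q ?a * \<zeta>) \<zeta>"
    by (simp add: poly_eval_add distrib_right inner_add_left)
  show "inner (poly_eval (smult c p) ?a * \<zeta>) \<zeta> = c * inner (poly_eval p ?a * \<zeta>) \<zeta>"
    by (simp add: poly_eval_smult)
  show "inner (poly_eval 1 ?a * \<zeta>) \<zeta> = 1" using n by (simp add: norm_eq_sqrt_inner)
  show "0 \<le> inner (poly_eval (q * q) ?a * \<zeta>) \<zeta>" using move[of 1 q] by (simp only: mult_1_left poly_eval_1 inner_ge_zero)
  have xx: "inner (?a * \<eta>) \<eta> = (norm (x * \<eta>))\<^sup>2" for \<eta>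
    by (simp add: power2_norm_eq_inner mult.assoc inner_mult_left)
  show "0 \<le> inner (poly_eval ([:0, 1:] * (q * q)) ?a * \<zeta>) \<zeta>" unfolding move X xx by simp
  have "(norm (x * \<eta>))\<^sup>2 \<le> spectral_bound x * (norm \<eta>)\<^sup>2" for \<eta>
  proof -
    have "norm (x * \<eta>) \<le> l1norm x * norm \<eta>" by (rule norm_mult_le_l1norm)
    also have "\<dots> \<le> (1 + l1norm x) * norm \<eta>" by (intro mult_right_mono) auto
    finally show ?thesis unfolding spectral_bound_def power_mult_distrib[symmetric] by (rule power_mono) simp
  qed
  moreover have "poly_eval [:spectral_bound x, -1:] ?a = spectral_bound x *\<^sub>R 1 - ?a" by (simp add: poly_eval_pCons)
  moreover have "inner ((spectral_bound x *\<^sub>R 1 - ?a) * \<eta>) \<eta> = spectral_bound x * (norm \<eta>)\<^sup>2 - (norm (x * \<eta>))\<^sup>2" for \<eta>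
    by (simp only: left_diff_distrib inner_diff_left xx mult_scaleR_left mult_1_left inner_scaleR_left power2_norm_eq_inner[of \<eta>])
  ultimately have "0 \<le> inner (poly_eval [:spectral_bound x, -1:] ?a * (poly_eval q ?a * \<zeta>)) (poly_eval q ?a * \<zeta>)"
    by (simp only: diff_ge_0_iff_ge)
  then show "0 \<le> inner (poly_eval ([:spectral_bound x, -1:] * (q * q)) ?a * \<zeta>) \<zeta>"
    by (simp only: move)
qed

definition spectral_measure :: "'g::group_add group_alg \<Rightarrow> real measure" where
  "spectral_measure x = (SOME \<mu>. bounded_prob (spectral_bound x) \<mu> \<and> (\<forall>p. inner (poly_eval p (star x * x)) 1 = (\<integral>t. poly p t \<partial>\<mu>)))"

lemma norm_one_group_alg: "norm (1 :: 'g::group_add group_alg) = 1"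
  by (simp add: norm_eq_sqrt_inner inner_poly_mapping_def)

lemma spectral_measure:
  shows bounded_prob_spectral_measure: "bounded_prob (spectral_bound x) (spectral_measure x)"
    and integral_poly_spectral_measure: "(\<integral>t. poly p t \<partial>spectral_measure x) = inner (poly_eval p (star x * x)) 1"
proof -
  have "\<exists>\<mu>. bounded_prob (spectral_bound x) \<mu> \<and> (\<forall>p. inner (poly_eval p (star x * x)) 1 = (\<integral>t. poly p t \<partial>\<mu>))"
    using spectral_measure_exists[OF norm_one_group_alg, of x] by (simp only: mult_1_right)
  from someI_ex[OF this] show "bounded_prob (spectral_bound x) (spectral_measure x)"
    and "(\<integral>t. poly p t \<partial>spectral_measure x) = inner (poly_eval p (star x * x)) 1"
    unfolding spectral_measure_def[symmetric] by (blast, metis)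
qed

text \<open>The norm estimate of the functional calculus. The squared norm is the integral of
  \<open>s * (poly q s)\<^sup>2\<close> against the spectral measure of the normalized vector, a
  probability measure on the interval where the integrand is bounded.\<close>

lemma norm_mult_poly_eval_le:
  fixes x \<zeta> :: "'g::group_add group_alg"
  assumes q: "\<And>s. 0 \<le> s \<Longrightarrow> s \<le> spectral_bound x \<Longrightarrow> s * (poly q s)\<^sup>2 \<le> M\<^sup>2" and M: "M \<ge> 0"
  shows "norm (x * poly_eval q (star x * x) * \<zeta>) \<le> M * norm \<zeta>"
proof (cases "\<zeta> = 0")
  case False
  define \<eta> where "\<eta> = \<zeta> /\<^sub>R norm \<zeta>"
  have n: "norm \<eta> = 1" using False by (simp add: \<eta>_def)
  let ?a = "star x * x"
  obtain \<mu> where \<mu>: "bounded_prob (spectral_bound x) \<mu>" "\<And>p. inner (poly_eval p ?a * \<eta>) \<eta> = (\<integral>t. poly p t \<partial>\<mu>)"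
    using spectral_measure_exists[OF n, of x] by blast
  have sa: "star (poly_eval p ?a) = poly_eval p ?a" for p by (rule star_poly_eval) simp
  have "(norm (x * poly_eval q ?a * \<eta>))\<^sup>2 = inner (poly_eval q ?a * (?a * (poly_eval q ?a * \<eta>))) \<eta>"
    by (simp only: power2_norm_eq_inner mult.assoc inner_mult_left[of "poly_eval q ?a"] inner_mult_left[of "star x"] sa star_star)
  also have "poly_eval q ?a * (?a * (poly_eval q ?a * \<eta>)) = poly_eval (q * [:0, 1:] * q) ?a * \<eta>"
    by (simp only: poly_eval_mult mult.assoc) (simp add: poly_eval_pCons mult.assoc)
  also have "inner \<dots> \<eta> = (\<integral>t. t * (poly q t)\<^sup>2 \<partial>\<mu>)"
    unfolding \<mu>(2) by (rule Bochner_Integration.integral_cong) (simp_all add: power2_eq_square)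
  also have "\<dots> \<le> M\<^sup>2"
  proof -
    interpret prob_space \<mu> using \<mu>(1) by (simp add: bounded_prob_def)
    have "AE t in \<mu>. 0 \<le> t \<and> t \<le> spectral_bound x" using \<mu>(1) by (simp add: bounded_prob_def)
    then have "AE t in \<mu>. t * (poly q t)\<^sup>2 \<le> M\<^sup>2" by eventually_elim (use q in auto)
    then show ?thesis
      by (intro integral_le_const bounded_prob_integrable_cont[OF \<mu>(1)] continuous_intros)
  qed
  finally have "norm (x * poly_eval q ?a * \<eta>) \<le> M" using M by (rule power2_le_imp_le)
  moreover have "x * poly_eval q ?a * \<zeta> = norm \<zeta> *\<^sub>R (x * poly_eval q ?a * \<eta>)" using False by (simp add: \<eta>_def)
  ultimately show ?thesis
    using mult_left_mono[of "norm (x * poly_eval q ?a * \<eta>)" M "norm \<zeta>"] by (simp add: mult.commute)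
qed simp

lemma norm_poly_eval_sq:
  shows norm_poly_eval: "(norm (poly_eval q (star x * x)))\<^sup>2 = (\<integral>s. (poly q s)\<^sup>2 \<partial>spectral_measure x)"
    and norm_mult_poly_eval: "(norm (x * poly_eval q (star x * x)))\<^sup>2 = (\<integral>s. s * (poly q s)\<^sup>2 \<partial>spectral_measure x)"
proof -
  let ?a = "star x * x"
  have sa: "star (poly_eval p ?a) = poly_eval p ?a" for p by (rule star_poly_eval) simp
  have "(norm (poly_eval q ?a))\<^sup>2 = inner (poly_eval (q * q) ?a) 1"
    unfolding power2_norm_eq_inner poly_eval_mult inner_mult_left[of "poly_eval q ?a" "poly_eval q ?a" 1] sa mult_1_right by (rule refl)
  also have "\<dots> = (\<integral>s. poly (q * q) s \<partial>spectral_measure x)" by (rule integral_poly_spectral_measure[symmetric])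
  also have "\<dots> = (\<integral>s. (poly q s)\<^sup>2 \<partial>spectral_measure x)"
    by (rule Bochner_Integration.integral_cong) (simp_all add: power2_eq_square)
  finally show "(norm (poly_eval q (star x * x)))\<^sup>2 = (\<integral>s. (poly q s)\<^sup>2 \<partial>spectral_measure x)" .
  have X: "poly_eval [:0, 1:] ?a = ?a" by (simp add: poly_eval_pCons)
  have "(norm (x * poly_eval q ?a))\<^sup>2 = inner (star x * (x * poly_eval q ?a)) (poly_eval q ?a)"
    unfolding power2_norm_eq_inner inner_mult_left[of "star x"] star_star by (rule refl)
  also have "\<dots> = inner (poly_eval q ?a * (?a * poly_eval q ?a)) 1"
    unfolding inner_mult_left[of "poly_eval q ?a"] sa mult_1_right mult.assoc by (rule refl)
  also have "\<dots> = inner (poly_eval (q * ([:0, 1:] * q)) ?a) 1"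
    by (simp only: poly_eval_mult X)
  also have "\<dots> = (\<integral>s. poly (q * ([:0, 1:] * q)) s \<partial>spectral_measure x)" by (rule integral_poly_spectral_measure[symmetric])
  also have "\<dots> = (\<integral>s. s * (poly q s)\<^sup>2 \<partial>spectral_measure x)"
    by (rule Bochner_Integration.integral_cong) (simp_all add: power2_eq_square)
  finally show "(norm (x * poly_eval q (star x * x)))\<^sup>2 = (\<integral>s. s * (poly q s)\<^sup>2 \<partial>spectral_measure x)" .
qed

lemma tendsto_integral_uniform:
  fixes f :: "nat \<Rightarrow> real \<Rightarrow> real"
  assumes \<mu>: "bounded_prob B \<mu>" and u: "uniform_limit {0..B} f g sequentially"
    and f: "\<And>m. continuous_on UNIV (f m)" and g: "continuous_on UNIV g"
  shows "(\<lambda>m. \<integral>s. f m s \<partial>\<mu>) \<longlonglongrightarrow> (\<integral>s. g s \<partial>\<mu>)"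
proof (rule tendstoI)
  fix e :: real assume e: "e > 0"
  interpret prob_space \<mu> using \<mu> by (simp add: bounded_prob_def)
  have AE: "AE s in \<mu>. 0 \<le> s \<and> s \<le> B" using \<mu> by (simp add: bounded_prob_def)
  have "\<forall>\<^sub>F m in sequentially. \<forall>s\<in>{0..B}. dist (f m s) (g s) < e / 2"
    using u e by (auto dest: uniform_limitD[where e = "e / 2"])
  then show "\<forall>\<^sub>F m in sequentially. dist (\<integral>s. f m s \<partial>\<mu>) (\<integral>s. g s \<partial>\<mu>) < e"
  proof eventually_elim
    case (elim m)
    have i: "integrable \<mu> (f m)" "integrable \<mu> g" using \<mu> f g bounded_prob_integrable_cont by blast+
    have "dist (\<integral>s. f m s \<partial>\<mu>) (\<integral>s. g s \<partial>\<mu>) = \<bar>\<integral>s. f m s - g s \<partial>\<mu>\<bar>"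
      using i by (simp add: dist_real_def)
    also have "\<dots> \<le> (\<integral>s. \<bar>f m s - g s\<bar> \<partial>\<mu>)" by (rule integral_abs_bound)
    also have "\<dots> \<le> e / 2"
    proof (rule integral_le_const)
      show "integrable \<mu> (\<lambda>s. \<bar>f m s - g s\<bar>)" using i by auto
      show "AE s in \<mu>. \<bar>f m s - g s\<bar> \<le> e / 2"
        using AE by eventually_elim (use elim in \<open>auto simp: dist_real_def less_imp_le\<close>)
    qed
    finally show ?case using e by simp
  qed
qed

section \<open>Interpolation between the operator norm and the trace norm\<close>

text \<open>Hoelder's inequality for the exponents infinity and 1, where the element of L^1 comes factored.\<close>
lemma inner_mult_poly_eval_poly_eval_le:
  assumes S: "add_subgroup S" and x: "Poly_Mapping.keys x \<subseteq> S" and v: "op_bound S v M"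
  shows "inner (v * (x * poly_eval \<alpha> (star x * x) * poly_eval \<beta> (star x * x))) 1
    \<le> M * (sqrt (\<integral>s. s * (poly \<alpha> s)\<^sup>2 \<partial>spectral_measure x) * sqrt (\<integral>s. (poly \<beta> s)\<^sup>2 \<partial>spectral_measure x))"
proof -
  let ?a = "star x * x"
  have M: "M \<ge> 0" using v by (simp add: op_bound_def)
  have sb: "star (poly_eval \<beta> ?a) = poly_eval \<beta> ?a" by (rule star_poly_eval) simp
  have sx: "Poly_Mapping.keys (x * poly_eval \<alpha> ?a) \<subseteq> S"
    by (intro supp_mult supp_poly_eval supp_star S x)
  have "inner (v * (x * poly_eval \<alpha> ?a * poly_eval \<beta> ?a)) 1 = inner (v * (x * poly_eval \<alpha> ?a)) (poly_eval \<beta> ?a)"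
    by (simp only: mult.assoc[symmetric] inner_mult_right[of _ "poly_eval \<beta> ?a" 1] sb mult_1_left)
  also have "\<dots> \<le> norm (v * (x * poly_eval \<alpha> ?a)) * norm (poly_eval \<beta> ?a)" by (rule norm_cauchy_schwarz)
  also have "\<dots> \<le> (M * norm (x * poly_eval \<alpha> ?a)) * norm (poly_eval \<beta> ?a)"
    using v sx by (intro mult_right_mono) (auto simp: op_bound_def)
  also have "\<dots> = M * (sqrt ((norm (x * poly_eval \<alpha> ?a))\<^sup>2) * sqrt ((norm (poly_eval \<beta> ?a))\<^sup>2))" by simp
  finally show ?thesis by (simp only: norm_poly_eval norm_mult_poly_eval)
qed

text \<open>The left side is the trace of \<open>star u * T x\<close>, where \<open>u\<close> is a
  bounded function of \<open>T x\<close>. With \<open>x = b + y\<close>, the bounded part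
  contributes a pairing of \<open>T b\<close> with \<open>u\<close>. For \<open>y\<close>, small in
  the trace norm, the symmetry of the trace pairing moves \<open>T\<close> to \<open>star u\<close>.
  Each of the two pairings is thus bounded against factored, and \<open>T\<close> only ever acts on
  the bounded element.\<close>

lemma pairing_multiplier_le:
  assumes S: "add_subgroup S" and x: "Poly_Mapping.keys x \<subseteq> S"
    and T_supp: "\<And>y. Poly_Mapping.keys y \<subseteq> S \<Longrightarrow> Poly_Mapping.keys (T y) \<subseteq> S"
    and T_diff: "\<And>y y'. T (y - y') = T y - T y'"
    and T_sym: "\<And>y w. inner (w * T y) 1 = inner (T w * y) 1"
    and T_bound: "\<And>y M. Poly_Mapping.keys y \<subseteq> S \<Longrightarrow> op_bound S y M \<Longrightarrow> op_bound S (T y) (C * M)"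
    and a: "a' \<ge> 0" "\<And>s. 0 \<le> s \<Longrightarrow> s \<le> spectral_bound x \<Longrightarrow> s * (1 - poly \<alpha> s * poly \<beta> s)\<^sup>2 \<le> a'\<^sup>2"
    and N: "N \<ge> 0" "\<And>s. 0 \<le> s \<Longrightarrow> s \<le> spectral_bound (T x) \<Longrightarrow> s * (poly \<gamma> s * poly \<delta> s)\<^sup>2 \<le> N\<^sup>2"
  shows "(\<integral>s. s * (poly \<gamma> s * poly \<delta> s) \<partial>spectral_measure (T x))
    \<le> C * a' * (sqrt (\<integral>s. s * (poly \<delta> s)\<^sup>2 \<partial>spectral_measure (T x)) * sqrt (\<integral>s. (poly \<gamma> s)\<^sup>2 \<partial>spectral_measure (T x)))
     + C * N * (sqrt (\<integral>s. s * (poly \<alpha> s)\<^sup>2 \<partial>spectral_measure x) * sqrt (\<integral>s. (poly \<beta> s)\<^sup>2 \<partial>spectral_measure x))"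
proof -
  define z where "z = T x"
  let ?a = "star x * x" and ?c = "star z * z"
  have z: "Poly_Mapping.keys z \<subseteq> S" unfolding z_def by (rule T_supp[OF x])
  have sc: "star (poly_eval p ?c) = poly_eval p ?c" for p by (rule star_poly_eval) simp
  \<comment> \<open>The polynomials imitate
    \<open>\<alpha> * \<beta> = max 0 (sqrt s - a') / sqrt s\<close>. Then \<open>y\<close> has the
    modulus of \<open>x\<close> lowered by \<open>a'\<close>, and \<open>b\<close> has it cut off at
    \<open>a'\<close>.\<close>
  define y where "y = x * poly_eval \<alpha> ?a * poly_eval \<beta> ?a"
  define b where "b = x * poly_eval (1 - \<alpha> * \<beta>) ?a"
  define u where "u = z * poly_eval (\<gamma> * \<delta>) ?c"
  have b_supp: "Poly_Mapping.keys b \<subseteq> S" and u_supp: "Poly_Mapping.keys u \<subseteq> S"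
    unfolding b_def u_def by (intro supp_mult supp_poly_eval supp_star S x z)+
  have yb: "y = x - b"
    by (simp add: y_def b_def poly_eval_diff poly_eval_mult right_diff_distrib mult.assoc)
  have b_bound: "op_bound S b a'"
    using a unfolding op_bound_def b_def by (intro conjI allI impI norm_mult_poly_eval_le) auto
  have u_bound: "op_bound S u N"
    using N unfolding op_bound_def u_def z_def by (intro conjI allI impI norm_mult_poly_eval_le) auto
  have su_supp: "Poly_Mapping.keys (star u) \<subseteq> S" by (rule supp_star[OF S u_supp])
  have Tu: "op_bound S (T (star u)) (C * N)"
    by (rule T_bound[OF su_supp op_bound_star[OF S u_supp u_bound]])
  have Tb: "op_bound S (T b) (C * a')" by (rule T_bound[OF b_supp b_bound])
  have su: "star u = poly_eval \<gamma> ?c * poly_eval \<delta> ?c * star z" by (simp add: u_def sc) (simp add: poly_eval_mult)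
  have "(\<integral>s. s * (poly \<gamma> s * poly \<delta> s) \<partial>spectral_measure z) = (\<integral>s. poly (\<gamma> * \<delta> * [:0, 1:]) s \<partial>spectral_measure z)"
    by (rule Bochner_Integration.integral_cong) simp_all
  also have "\<dots> = inner (poly_eval (\<gamma> * \<delta> * [:0, 1:]) ?c) 1" by (rule integral_poly_spectral_measure)
  also have "poly_eval (\<gamma> * \<delta> * [:0, 1:]) ?c = star u * z"
    by (simp only: poly_eval_mult su mult.assoc) (simp add: poly_eval_pCons mult.assoc)
  also have "star u * z = star u * (T b + T y)"
    using T_diff[of x b] by (simp add: z_def yb)
  also have "inner (star u * (T b + T y)) 1 = inner (star u * T b) 1 + inner (T (star u) * y) 1"
    by (simp only: distrib_left inner_add_left T_sym)
  also have "inner (T (star u) * y) 1 \<le> C * N * (sqrt (\<integral>s. s * (poly \<alpha> s)\<^sup>2 \<partial>spectral_measure x) * sqrt (\<integral>s. (poly \<beta> s)\<^sup>2 \<partial>spectral_measure x))"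
    unfolding y_def by (rule inner_mult_poly_eval_poly_eval_le[OF S x Tu])
  also have "inner (star u * T b) 1 = inner (star (T b) * u) 1"
    by (metis inner_star_star star_mult star_one star_star)
  \<comment> \<open>The same \<open>u\<close>, used above through its operator bound, is now read as
    a factored element of L^1. The order of the factors decides which of \<open>\<gamma>\<close>,
    \<open>\<delta>\<close> is integrated with the weight \<open>s\<close>.\<close>
  also have "u = z * poly_eval \<delta> ?c * poly_eval \<gamma> ?c"
    by (simp only: u_def mult.commute[of \<gamma>] poly_eval_mult mult.assoc)
  also have "inner (star (T b) * \<dots>) 1 \<le> C * a' * (sqrt (\<integral>s. s * (poly \<delta> s)\<^sup>2 \<partial>spectral_measure z) * sqrt (\<integral>s. (poly \<gamma> s)\<^sup>2 \<partial>spectral_measure z))"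
    by (rule inner_mult_poly_eval_poly_eval_le[OF S z op_bound_star[OF S T_supp[OF b_supp] Tb]])
  finally show ?thesis by (simp add: z_def)
qed

lemma uniform_limit_poly_approx:
  assumes "\<And>m s. s \<in> {0..B} \<Longrightarrow> \<bar>poly (q m) s - f s\<bar> < 1 / real (Suc m)"
  shows "uniform_limit {0..B} (\<lambda>m. poly (q m)) f sequentially"
proof (rule uniform_limitI)
  fix e :: real assume "e > 0"
  then have "\<forall>\<^sub>F m in sequentially. 1 / real (Suc m) < e"
    unfolding divide_inverse mult_1_left by (rule order_tendstoD(2)[OF LIMSEQ_inverse_real_of_nat])
  then show "\<forall>\<^sub>F m in sequentially. \<forall>s\<in>{0..B}. dist (poly (q m) s) (f s) < e"
    by eventually_elim (auto simp: dist_real_def intro: less_trans[OF assms])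
qed

text \<open>Let \<open>u\<close> be nearly the partial isometry of \<open>T x\<close> restricted to
  the spectral subspace where its modulus exceeds \<open>C * a\<close>, and let K be the trace of
  that subspace. The bounded part of \<open>x\<close> contributes at most \<open>C * a * K\<close>,
  which is exactly what subtracting the height \<open>C * a\<close> on that subspace removes; the
  rest is at most \<open>C\<close> times the trace of the modulus of \<open>x\<close> above
  \<open>a\<close>.\<close>

lemma integral_tail_multiplier_le:
  assumes S: "add_subgroup S" and x: "Poly_Mapping.keys x \<subseteq> S"
    and T_supp: "\<And>y. Poly_Mapping.keys y \<subseteq> S \<Longrightarrow> Poly_Mapping.keys (T y) \<subseteq> S"
    and T_diff: "\<And>y y'. T (y - y') = T y - T y'"
    and T_sym: "\<And>y w. inner (w * T y) 1 = inner (T w * y) 1"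
    and T_bound: "\<And>y M. Poly_Mapping.keys y \<subseteq> S \<Longrightarrow> op_bound S y M \<Longrightarrow> op_bound S (T y) (C * M)"
    and C: "C > 0" and a: "a > 0"
  shows "(\<integral>s. max 0 (sqrt s - C * a) \<partial>spectral_measure (T x)) \<le> C * (\<integral>s. max 0 (sqrt s - a) \<partial>spectral_measure x)"
proof -
  let ?\<mu> = "spectral_measure x" and ?\<nu> = "spectral_measure (T x)"
  define A where "A = C * a"
  have A: "A > 0" using a C by (simp add: A_def)
  have \<mu>: "bounded_prob (spectral_bound x) ?\<mu>" and \<nu>: "bounded_prob (spectral_bound (T x)) ?\<nu>"
    by (rule bounded_prob_spectral_measure)+
  have cong\<mu>: "(\<integral>s. f s \<partial>?\<mu>) = (\<integral>s. g s \<partial>?\<mu>)" if "\<And>s. s \<ge> 0 \<Longrightarrow> f s = g s" "continuous_on UNIV f" "continuous_on UNIV g"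
    for f g :: "real \<Rightarrow> real"
    using \<mu> that by (auto intro!: integral_cong_AE bounded_prob_integrable_cont[THEN borel_measurable_integrable] elim!: eventually_mono simp: bounded_prob_def)
  have cong\<nu>: "(\<integral>s. f s \<partial>?\<nu>) = (\<integral>s. g s \<partial>?\<nu>)" if "\<And>s. s \<ge> 0 \<Longrightarrow> f s = g s" "continuous_on UNIV f" "continuous_on UNIV g"
    for f g :: "real \<Rightarrow> real"
    using \<nu> that by (auto intro!: integral_cong_AE bounded_prob_integrable_cont[THEN borel_measurable_integrable] elim!: eventually_mono simp: bounded_prob_def)
  define k where "k s = max 0 (sqrt s - a)" for s
  \<comment> \<open>\<open>f * g\<close> is \<open>k s / sqrt s\<close> where \<open>k\<close> is
    nonzero, and the two factors have the same squared L^2 size: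
    \<open>s * (f s)\<^sup>2 = (g s)\<^sup>2 = k s\<close>. The maximum with \<open>a\<close> only
    prevents division by zero.\<close>
  define f where "f s = sqrt (k s) / max (sqrt s) a" for s
  define g where "g s = sqrt (k s)" for s
  have kc: "continuous_on U k" for U unfolding k_def by (intro continuous_intros)
  have fc: "continuous_on U f" for U unfolding f_def using a by (intro continuous_intros kc) auto
  have gc: "continuous_on U g" for U unfolding g_def by (intro continuous_intros kc)
  have k0: "k s \<ge> 0" for s by (simp add: k_def)
  have bd: "bounded (h ` {0..B})" if "continuous_on {0..B} h" for h :: "real \<Rightarrow> real" and B
    using that by (intro compact_imp_bounded compact_continuous_image) auto
  have main: "(\<integral>s. max 0 (sqrt s - A) \<partial>?\<nu>) \<le> C * (\<integral>s. k s \<partial>?\<mu>) + \<eta>" if \<eta>: "\<eta> > 0" for \<eta>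
  proof -
    \<comment> \<open>A ramp of width \<open>\<eta>\<close> in place of the indicator of
      \<open>sqrt s > A\<close>: the functions must be continuous to admit uniform approximation by
      polynomials.\<close>
    define \<kappa> where "\<kappa> s = min 1 (max 0 ((sqrt s - A) / \<eta>))" for s
    define u where "u s = sqrt (\<kappa> s)" for s
    \<comment> \<open>\<open>u * v\<close> is \<open>\<kappa> s / sqrt s\<close>, which turns
      \<open>T x\<close> into an operator of norm at most 1, again split so that both factors have
      squared L^2 size \<open>\<kappa> s\<close>.\<close>
    define v where "v s = sqrt (\<kappa> s) / max (sqrt s) A" for s
    have \<kappa>c: "continuous_on U \<kappa>" for U unfolding \<kappa>_def using \<eta> by (intro continuous_intros) auto
    have uc: "continuous_on U u" for U unfolding u_def by (intro continuous_intros \<kappa>c)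
    have vc: "continuous_on U v" for U unfolding v_def using A by (intro continuous_intros \<kappa>c) auto
    have \<kappa>0: "0 \<le> \<kappa> s" "\<kappa> s \<le> 1" for s by (auto simp: \<kappa>_def)
    have \<kappa>A: "sqrt s > A" if "\<kappa> s \<noteq> 0" for s
      using that \<eta> by (auto simp: \<kappa>_def min_def max_def zero_le_divide_iff split: if_splits)
    obtain p\<alpha> where p\<alpha>: "\<And>m s. s \<in> {0..spectral_bound x} \<Longrightarrow> \<bar>poly (p\<alpha> m) s - f s\<bar> < 1 / real (Suc m)"
      using poly_uniform_approx[OF fc] by blast
    obtain p\<beta> where p\<beta>: "\<And>m s. s \<in> {0..spectral_bound x} \<Longrightarrow> \<bar>poly (p\<beta> m) s - g s\<bar> < 1 / real (Suc m)"
      using poly_uniform_approx[OF gc] by blast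
    obtain p\<gamma> where p\<gamma>: "\<And>m s. s \<in> {0..spectral_bound (T x)} \<Longrightarrow> \<bar>poly (p\<gamma> m) s - u s\<bar> < 1 / real (Suc m)"
      using poly_uniform_approx[OF uc] by blast
    obtain p\<delta> where p\<delta>: "\<And>m s. s \<in> {0..spectral_bound (T x)} \<Longrightarrow> \<bar>poly (p\<delta> m) s - v s\<bar> < 1 / real (Suc m)"
      using poly_uniform_approx[OF vc] by blast
    note ul = uniform_limit_poly_approx[OF p\<alpha>] uniform_limit_poly_approx[OF p\<beta>]
      uniform_limit_poly_approx[OF p\<gamma>] uniform_limit_poly_approx[OF p\<delta>]
    have pc: "continuous_on U (poly q)" for U and q :: "real poly" by (intro continuous_intros)
    note bds = bd[OF fc] bd[OF gc] bd[OF uc] bd[OF vc] bd[OF continuous_on_id]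
      bd[OF continuous_on_real_sqrt[OF continuous_on_id]]
    have lim1: "(\<lambda>m. \<integral>s. s * (poly (p\<gamma> m) s * poly (p\<delta> m) s) \<partial>?\<nu>) \<longlonglongrightarrow> (\<integral>s. s * (u s * v s) \<partial>?\<nu>)"
      by (rule tendsto_integral_uniform[OF \<nu>],
        intro uniform_lim_mult uniform_limit_const ul bd continuous_intros uc vc)
        (auto intro!: continuous_intros uc vc)
    have lim2: "(\<lambda>m. \<integral>s. s * (poly (p\<delta> m) s)\<^sup>2 \<partial>?\<nu>) \<longlonglongrightarrow> (\<integral>s. s * (v s)\<^sup>2 \<partial>?\<nu>)"
      unfolding power2_eq_square by (rule tendsto_integral_uniform[OF \<nu>],
        intro uniform_lim_mult uniform_limit_const ul bd continuous_intros vc)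
        (auto intro!: continuous_intros vc)
    have lim3: "(\<lambda>m. \<integral>s. (poly (p\<gamma> m) s)\<^sup>2 \<partial>?\<nu>) \<longlonglongrightarrow> (\<integral>s. (u s)\<^sup>2 \<partial>?\<nu>)"
      unfolding power2_eq_square by (rule tendsto_integral_uniform[OF \<nu>],
        intro uniform_lim_mult uniform_limit_const ul bd continuous_intros uc)
        (auto intro!: continuous_intros uc)
    have lim4: "(\<lambda>m. \<integral>s. s * (poly (p\<alpha> m) s)\<^sup>2 \<partial>?\<mu>) \<longlonglongrightarrow> (\<integral>s. s * (f s)\<^sup>2 \<partial>?\<mu>)"
      unfolding power2_eq_square by (rule tendsto_integral_uniform[OF \<mu>],
        intro uniform_lim_mult uniform_limit_const ul bd continuous_intros fc)
        (auto intro!: continuous_intros fc)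
    have lim5: "(\<lambda>m. \<integral>s. (poly (p\<beta> m) s)\<^sup>2 \<partial>?\<mu>) \<longlonglongrightarrow> (\<integral>s. (g s)\<^sup>2 \<partial>?\<mu>)"
      unfolding power2_eq_square by (rule tendsto_integral_uniform[OF \<mu>],
        intro uniform_lim_mult uniform_limit_const ul bd continuous_intros gc)
        (auto intro!: continuous_intros gc)
    note lims = lim1 lim2 lim3 lim4 lim5
    have sval: "s * (u s * v s) = sqrt s * \<kappa> s" "s * (v s)\<^sup>2 = \<kappa> s" "(u s)\<^sup>2 = \<kappa> s"
      "s * (f s)\<^sup>2 = k s" "(g s)\<^sup>2 = k s" if "s \<ge> 0" for s
    proof -
      show "(u s)\<^sup>2 = \<kappa> s" "(g s)\<^sup>2 = k s" using \<kappa>0 k0 by (simp_all add: u_def g_def)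
      show "s * (u s * v s) = sqrt s * \<kappa> s"
      proof (cases "\<kappa> s = 0")
        case False
        have "s * (u s * v s) = (sqrt s * sqrt s) * (sqrt (\<kappa> s) * sqrt (\<kappa> s)) / max (sqrt s) A"
          using that by (simp add: u_def v_def)
        also have "\<dots> = (sqrt s * sqrt s) * \<kappa> s / sqrt s" using \<kappa>A[OF False] \<kappa>0 by simp
        also have "\<dots> = sqrt s * \<kappa> s"
          unfolding mult.assoc by (rule nonzero_mult_div_cancel_left) (use \<kappa>A[OF False] A in linarith)
        finally show ?thesis .
      qed (simp add: u_def)
      show "s * (v s)\<^sup>2 = \<kappa> s"
      proof (cases "\<kappa> s = 0")
        case False
        have "s * (v s)\<^sup>2 = s * \<kappa> s / (sqrt s)\<^sup>2" using \<kappa>A[OF False] \<kappa>0 by (simp add: v_def power_divide)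
        then show ?thesis using \<kappa>A[OF False] A that by (auto simp: max_def)
      qed (simp add: v_def)
      show "s * (f s)\<^sup>2 = k s"
      proof (cases "k s = 0")
        case False
        then have *: "sqrt s > a" by (auto simp: k_def max_def split: if_splits)
        have "s * (f s)\<^sup>2 = s * k s / (sqrt s)\<^sup>2" using * k0 by (simp add: f_def power_divide)
        then show ?thesis using * a that by auto
      qed (simp add: f_def)
    qed
    define L where "L = (\<integral>s. sqrt s * \<kappa> s \<partial>?\<nu>)"
    define K where "K = (\<integral>s. \<kappa> s \<partial>?\<nu>)"
    define Y where "Y = (\<integral>s. k s \<partial>?\<mu>)"
    have ints: "(\<integral>s. s * (u s * v s) \<partial>?\<nu>) = L" "(\<integral>s. s * (v s)\<^sup>2 \<partial>?\<nu>) = K" "(\<integral>s. (u s)\<^sup>2 \<partial>?\<nu>) = K"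
      "(\<integral>s. s * (f s)\<^sup>2 \<partial>?\<mu>) = Y" "(\<integral>s. (g s)\<^sup>2 \<partial>?\<mu>) = Y"
      unfolding L_def K_def Y_def
      by (intro cong\<mu> cong\<nu> sval continuous_intros fc gc uc vc kc \<kappa>c; assumption)+
    have KY0: "K \<ge> 0" "Y \<ge> 0" unfolding K_def Y_def using \<kappa>0 k0 by (auto intro!: integral_nonneg_AE)
    \<comment> \<open>The slack \<open>e\<close> absorbs the polynomial approximation in the two
      operator bounds; the integrals pass to the limit with \<open>e\<close> fixed.\<close>
    have step: "L \<le> C * (a + e) * K + C * (1 + e) * Y" if e: "e > 0" for e
    proof -
      have ul1: "uniform_limit {0..spectral_bound x} (\<lambda>m s. sqrt s * (1 - poly (p\<alpha> m) s * poly (p\<beta> m) s)) (\<lambda>s. sqrt s * (1 - f s * g s)) sequentially"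
        by (intro uniform_lim_mult uniform_limit_minus uniform_limit_const ul bd continuous_intros fc gc)
      have ul2: "uniform_limit {0..spectral_bound (T x)} (\<lambda>m s. sqrt s * (poly (p\<gamma> m) s * poly (p\<delta> m) s)) (\<lambda>s. sqrt s * (u s * v s)) sequentially"
        by (intro uniform_lim_mult uniform_limit_minus uniform_limit_const ul bd continuous_intros uc vc)
      \<comment> \<open>The value is the smaller of \<open>sqrt s\<close> and
        \<open>a\<close>.\<close>
      have b1: "\<bar>sqrt s * (1 - f s * g s)\<bar> \<le> a" if "s \<ge> 0" for s
      proof -
        have "f s * g s = k s / max (sqrt s) a" using k0 by (simp add: f_def g_def)
        moreover have "sqrt s * (1 - (sqrt s - a) / sqrt s) = a" if "sqrt s > a"
        proof -
          have "sqrt s \<noteq> 0" using that a by linarith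
          then have "sqrt s * ((sqrt s - a) / sqrt s) = sqrt s - a" 
            unfolding times_divide_eq_right by (rule nonzero_mult_div_cancel_left)
          then show ?thesis by (simp add: right_diff_distrib)
        qed
        ultimately show ?thesis using a that by (cases "sqrt s > a") (simp_all add: k_def max_def)
      qed
      have b2: "\<bar>sqrt s * (u s * v s)\<bar> \<le> 1" if "s \<ge> 0" for s
      proof (cases "\<kappa> s = 0")
        case False
        have "u s * v s = \<kappa> s / sqrt s" using \<kappa>A[OF False] \<kappa>0 by (simp add: u_def v_def)
        then show ?thesis using \<kappa>A[OF False] A \<kappa>0 by auto
      qed (simp add: u_def)
      have "\<forall>\<^sub>F m in sequentially. \<forall>s\<in>{0..spectral_bound x}. dist (sqrt s * (1 - poly (p\<alpha> m) s * poly (p\<beta> m) s)) (sqrt s * (1 - f s * g s)) < e"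
        by (rule uniform_limitD[OF ul1 e])
      moreover have "\<forall>\<^sub>F m in sequentially. \<forall>s\<in>{0..spectral_bound (T x)}. dist (sqrt s * (poly (p\<gamma> m) s * poly (p\<delta> m) s)) (sqrt s * (u s * v s)) < e"
        by (rule uniform_limitD[OF ul2 e])
      ultimately have "\<forall>\<^sub>F m in sequentially. (\<integral>s. s * (poly (p\<gamma> m) s * poly (p\<delta> m) s) \<partial>?\<nu>)
        \<le> C * (a + e) * (sqrt (\<integral>s. s * (poly (p\<delta> m) s)\<^sup>2 \<partial>?\<nu>) * sqrt (\<integral>s. (poly (p\<gamma> m) s)\<^sup>2 \<partial>?\<nu>))
         + C * (1 + e) * (sqrt (\<integral>s. s * (poly (p\<alpha> m) s)\<^sup>2 \<partial>?\<mu>) * sqrt (\<integral>s. (poly (p\<beta> m) s)\<^sup>2 \<partial>?\<mu>))"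
      proof eventually_elim
        case (elim m)
        show ?case
        proof (rule pairing_multiplier_le[OF S x T_supp T_diff T_sym T_bound])
          fix s assume s: "0 \<le> s" "s \<le> spectral_bound x"
          have "\<bar>sqrt s * (1 - poly (p\<alpha> m) s * poly (p\<beta> m) s)\<bar> \<le> \<bar>a + e\<bar>"
            using elim(1) s b1[OF s(1)] by (force simp: dist_real_def)
          then show "s * (1 - poly (p\<alpha> m) s * poly (p\<beta> m) s)\<^sup>2 \<le> (a + e)\<^sup>2"
            using s by (simp only: abs_le_square_iff) (simp add: power_mult_distrib)
        next
          fix s assume s: "0 \<le> s" "s \<le> spectral_bound (T x)"
          have "\<bar>sqrt s * (poly (p\<gamma> m) s * poly (p\<delta> m) s)\<bar> \<le> \<bar>1 + e\<bar>"
            using elim(2) s b2[OF s(1)] by (force simp: dist_real_def)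
          then show "s * (poly (p\<gamma> m) s * poly (p\<delta> m) s)\<^sup>2 \<le> (1 + e)\<^sup>2"
            using s by (simp only: abs_le_square_iff) (simp add: power_mult_distrib)
        qed (use a e in auto)
      qed
      then have "L \<le> C * (a + e) * (sqrt K * sqrt K) + C * (1 + e) * (sqrt Y * sqrt Y)"
        by (rule tendsto_le[OF sequentially_bot _ lims(1)[unfolded ints], rotated])
           (intro tendsto_intros lims[unfolded ints])
      then show ?thesis using KY0 by simp
    qed
    have "L \<le> A * K + C * Y"
    proof (rule field_le_epsilon)
      fix \<epsilon> :: real assume \<epsilon>: "\<epsilon> > 0"
      define D where "D = C * (K + Y) + 1"
      have D: "D > 0" using C KY0 by (simp add: D_def add_nonneg_pos)
      have "L \<le> A * K + C * Y + (\<epsilon> / D) * (C * (K + Y))"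
        using step[of "\<epsilon> / D"] \<epsilon> D by (simp add: A_def algebra_simps)
      also have "(\<epsilon> / D) * (C * (K + Y)) \<le> (\<epsilon> / D) * D"
        using \<epsilon> D by (intro mult_left_mono) (auto simp: D_def)
      finally show "L \<le> A * K + C * Y + \<epsilon>" using D by simp
    qed
    moreover have "(\<integral>s. max 0 (sqrt s - A) \<partial>?\<nu>) - \<eta> \<le> L - A * K"
    proof -
      interpret prob_space ?\<nu> using \<nu> by (simp add: bounded_prob_def)
      have i: "integrable ?\<nu> (\<lambda>s. sqrt s * \<kappa> s)" "integrable ?\<nu> (\<lambda>s. A * \<kappa> s)" "integrable ?\<nu> (\<lambda>s. max 0 (sqrt s - A))"
        by (intro bounded_prob_integrable_cont[OF \<nu>] continuous_intros \<kappa>c)+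
      have "(\<integral>s. max 0 (sqrt s - A) \<partial>?\<nu>) - \<eta> = (\<integral>s. max 0 (sqrt s - A) - \<eta> \<partial>?\<nu>)"
        using i by (simp add: prob_space)
      also have "\<dots> \<le> (\<integral>s. sqrt s * \<kappa> s - A * \<kappa> s \<partial>?\<nu>)"
      proof (rule integral_mono)
        fix s :: real
        show "max 0 (sqrt s - A) - \<eta> \<le> sqrt s * \<kappa> s - A * \<kappa> s"
        \<comment> \<open>Past the ramp the weight is 1. Below its end the positive part is less
          than \<open>\<eta>\<close>, while \<open>(sqrt s - A) * \<kappa> s\<close> is never
          negative because \<open>\<kappa>\<close> vanishes below \<open>A\<close>.\<close>
        proof (cases "sqrt s - A \<ge> \<eta>")
          case True
          then have "\<kappa> s = 1" using \<eta> by (simp add: \<kappa>_def)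
          then show ?thesis using \<eta> True by simp
        next
          case False
          have "0 \<le> (sqrt s - A) * \<kappa> s"
            by (cases "\<kappa> s = 0") (use \<kappa>A[of s] \<kappa>0[of s] in auto)
          then show ?thesis using False \<eta> by (auto simp: algebra_simps)
        qed
      qed (use i in auto)
      also have "\<dots> = L - A * K" using i by (simp add: L_def K_def)
      finally show ?thesis .
    qed
    ultimately show ?thesis unfolding Y_def by linarith
  qed
  show ?thesis
    using field_le_epsilon[of "\<integral>s. max 0 (sqrt s - A) \<partial>?\<nu>" "C * (\<integral>s. k s \<partial>?\<mu>)"] main
    by (simp add: A_def k_def)
qed

theorem integral_powr_multiplier_le:
  assumes S: "add_subgroup S" and x: "Poly_Mapping.keys x \<subseteq> S"
    and T_supp: "\<And>y. Poly_Mapping.keys y \<subseteq> S \<Longrightarrow> Poly_Mapping.keys (T y) \<subseteq> S"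
    and T_diff: "\<And>y y'. T (y - y') = T y - T y'"
    and T_sym: "\<And>y w. inner (w * T y) 1 = inner (T w * y) 1"
    and T_bound: "\<And>y M. Poly_Mapping.keys y \<subseteq> S \<Longrightarrow> op_bound S y M \<Longrightarrow> op_bound S (T y) (C * M)"
    and C: "C > 0" and p: "p \<ge> 1"
  shows "(\<integral>s. s powr (p / 2) \<partial>spectral_measure (T x)) \<le> C powr p * (\<integral>s. s powr (p / 2) \<partial>spectral_measure x)"
  by (rule powr_integral_mono[OF bounded_prob_spectral_measure bounded_prob_spectral_measure C p])
     (rule integral_tail_multiplier_le[OF S x T_supp T_diff T_sym T_bound C])

section \<open>The free group and its Cayley tree\<close>

definition linv :: "letter \<Rightarrow> letter" where
  "linv a = (fst a, \<not> snd a)"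

lemma linv_linv [simp]: "linv (linv a) = a"
  by (simp add: linv_def)

lemma cancel_iff: "fst a = fst b \<and> snd a \<noteq> snd b \<longleftrightarrow> b = linv a" for a b :: letter
  by (cases a; cases b) (auto simp: linv_def)

lemma linv_eq_iff: "b = linv a \<longleftrightarrow> a = linv b"
  by auto

text \<open>Left multiplication of a reduced word by one letter. The group laws reduce to
  \<open>act_linv\<close>, that is, inverse letters act inversely on reduced words.\<close>

fun act :: "letter \<Rightarrow> word \<Rightarrow> word" where
  "act a [] = [a]"
| "act a (b # v) = (if b = linv a then v else a # b # v)"

lemma reduced_Nil [simp]: "reduced []" and reduced_single [simp]: "reduced [a]"
  by (simp_all add: reduced_def)

lemma reduced_Cons: "reduced (a # b # w) \<longleftrightarrow> b \<noteq> linv a \<and> reduced (b # w)"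
proof
  assume r: "reduced (a # b # w)"
  have "reduced (b # w)"
    unfolding reduced_def
  proof (intro allI impI)
    fix i assume "Suc i < length (b # w)"
    then show "\<not> (fst ((b # w) ! i) = fst ((b # w) ! Suc i) \<and> snd ((b # w) ! i) \<noteq> snd ((b # w) ! Suc i))"
      using r[unfolded reduced_def, rule_format, of "Suc i"] by simp
  qed
  moreover have "b \<noteq> linv a"
    using r[unfolded reduced_def, rule_format, of 0] by (auto simp: linv_def)
  ultimately show "b \<noteq> linv a \<and> reduced (b # w)" by simp
next
  assume r: "b \<noteq> linv a \<and> reduced (b # w)"
  show "reduced (a # b # w)"
    unfolding reduced_def
  proof (intro allI impI)
    fix i assume "Suc i < length (a # b # w)"
    then show "\<not> (fst ((a # b # w) ! i) = fst ((a # b # w) ! Suc i) \<and> snd ((a # b # w) ! i) \<noteq> snd ((a # b # w) ! Suc i))"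
      using r cancel_iff[of a b] by (cases i) (auto simp: reduced_def)
  qed
qed

lemma reduced_tl: "reduced (a # w) \<Longrightarrow> reduced w"
  by (cases w) (auto simp: reduced_Cons)

lemma reduced_append:
  "reduced (v @ w) \<longleftrightarrow> reduced v \<and> reduced w \<and> (v \<noteq> [] \<longrightarrow> w \<noteq> [] \<longrightarrow> hd w \<noteq> linv (last v))"
proof (induction v)
  case (Cons a v)
  show ?case
  proof (cases v)
    case Nil
    then show ?thesis by (cases w) (auto simp: reduced_Cons)
  next
    case (Cons b v')
    then show ?thesis using Cons.IH by (auto simp: reduced_Cons)
  qed
qed simp

lemma reduced_rev: "reduced (rev w) \<longleftrightarrow> reduced w"
proof (induction w)
  case (Cons a w)
  then show ?case
    by (cases w) (auto simp: reduced_append reduced_Cons linv_eq_iff[of a])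
qed simp

lemma reduced_map_linv: "reduced (map linv w) \<longleftrightarrow> reduced w"
proof (induction w)
  case IH: (Cons a w)
  show ?case
  proof (cases w)
    case (Cons b v)
    have "linv b = a \<longleftrightarrow> b = linv a" by auto
    then show ?thesis using IH Cons by (simp add: reduced_Cons)
  qed simp
qed simp

lemma winv_eq: "winv w = rev (map linv w)"
  by (simp add: winv_def linv_def)

lemma reduced_winv: "reduced (winv w) \<longleftrightarrow> reduced w"
  by (simp add: winv_eq reduced_rev reduced_map_linv)

lemma act_Cons_reduced: "reduced (a # w) \<Longrightarrow> act a w = a # w"
  by (cases w) (auto simp: reduced_Cons)

lemma reduced_act: "reduced w \<Longrightarrow> reduced (act a w)"
  by (cases w) (auto simp: reduced_Cons intro: reduced_tl)

lemma act_linv: "reduced w \<Longrightarrow> act a (act (linv a) w) = w"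
  by (cases w) (auto simp: act_Cons_reduced)

text \<open>\<open>wcancel\<close> stops at the first pair that does not cancel, whereas the fold
  tests every letter. They agree because in a reduced word no later letter can cancel against the
  one just placed.\<close>

lemma wcancel_eq_fold: "reduced r \<Longrightarrow> wcancel r v = fold act r v"
proof (induction r arbitrary: v)
  case C: (Cons a r)
  have IH: "wcancel r v = fold act r v" for v
    using C by (blast dest: reduced_tl)
  have *: "wcancel r (a # v) = rev r @ a # v" for v
  proof (cases r)
    case (Cons b r')
    then have "b \<noteq> linv a" using C.prems by (simp add: reduced_Cons)
    then have "a \<noteq> linv b" by auto
    then show ?thesis using Cons cancel_iff[of b a] by auto
  qed simp
  show ?case
  proof (cases v)
    case (Cons b v')
    then show ?thesis using cancel_iff[of a b] by (simp add: IH[symmetric] *)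
  next
    case Nil
    then show ?thesis using IH[of "[a]"] *[of "[]"] by simp
  qed
qed simp

lemma wmul_eq_foldr: "reduced u \<Longrightarrow> wmul u v = foldr act u v"
  by (simp add: wmul_def wcancel_eq_fold reduced_rev foldr_conv_fold)

lemma reduced_foldr_act: "reduced v \<Longrightarrow> reduced (foldr act u v)"
  by (induction u) (auto simp: reduced_act)

text \<open>The core of associativity: if \<open>a\<close> cancels the first letter of
  \<open>v\<close>, then on the right the action of \<open>a\<close> undoes the action of that
  letter.\<close>

lemma foldr_act_act:
  assumes "reduced v" "reduced w"
  shows "foldr act (act a v) w = act a (foldr act v w)"
proof (cases v)
  case (Cons b v')
  then show ?thesis
    using act_linv[of "foldr act v' w" a] reduced_foldr_act[OF assms(2)] by auto
qed simp

lemma foldr_act_foldr_act: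
  "reduced v \<Longrightarrow> reduced w \<Longrightarrow> foldr act (foldr act u v) w = foldr act u (foldr act v w)"
  by (induction u) (auto simp: foldr_act_act reduced_foldr_act)

lemma foldr_act_Nil: "reduced u \<Longrightarrow> foldr act u [] = u"
proof (induction u)
  case (Cons a u)
  then have "foldr act u [] = u" by (blast dest: reduced_tl)
  then show ?case using Cons.prems by (simp add: act_Cons_reduced)
qed simp

lemma foldr_act_winv: "reduced w \<Longrightarrow> foldr act (winv u) (foldr act u w) = w"
proof (induction u)
  case (Cons a u)
  then show ?case
    using act_linv[of "foldr act u w" "linv a"] by (simp add: winv_eq reduced_foldr_act)
qed (simp add: winv_eq)

text \<open>The free group on countably many generators. One type serves all \<open>n\<close>; F_n
  reappears as the subgroup \<open>FG_elems n\<close>.\<close>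

typedef free_group = "{w :: word. reduced w}"
  by (rule exI[of _ "[]"]) simp

lemma reduced_Rep [simp]: "reduced (Rep_free_group g)"
  using Rep_free_group by blast

instantiation free_group :: group_add
begin

definition "0 = Abs_free_group []"
definition "g + h = Abs_free_group (wmul (Rep_free_group g) (Rep_free_group h))"
definition "- g = Abs_free_group (winv (Rep_free_group g))"
definition "g - h = g + (- h :: free_group)"

lemma Rep_zero: "Rep_free_group 0 = []"
  by (simp add: zero_free_group_def Abs_free_group_inverse)

lemma Rep_plus: "Rep_free_group (g + h) = wmul (Rep_free_group g) (Rep_free_group h)"
  by (simp add: plus_free_group_def Abs_free_group_inverse wmul_eq_foldr reduced_foldr_act)

lemma Rep_uminus: "Rep_free_group (- g) = winv (Rep_free_group g)"
  by (simp add: uminus_free_group_def Abs_free_group_inverse reduced_winv)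

instance
proof
  fix a b c :: free_group
  show "a + b + c = a + (b + c)"
    by (simp add: Rep_free_group_inject[symmetric] Rep_plus wmul_eq_foldr reduced_foldr_act foldr_act_foldr_act)
  show "0 + a = a" "a + 0 = a"
    by (simp_all add: Rep_free_group_inject[symmetric] Rep_plus Rep_zero wmul_eq_foldr foldr_act_Nil)
  show "- a + a = 0"
    using foldr_act_winv[of "[]" "Rep_free_group a"]
    by (simp add: Rep_free_group_inject[symmetric] Rep_plus Rep_zero Rep_uminus wmul_eq_foldr foldr_act_Nil reduced_winv)
qed (simp add: minus_free_group_def)

end

section \<open>Word length and merging rays in the Cayley tree\<close>

definition glen :: "free_group \<Rightarrow> nat" where
  "glen g = length (Rep_free_group g)"

lemma glen_uminus [simp]: "glen (- g) = glen g"
  by (simp add: glen_def Rep_uminus winv_eq)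

text \<open>The ancestor of the vertex \<open>w\<close> of the Cayley tree at distance \<open>i\<close> on the way to a boundary point:
  letters are removed from the left until the root is reached, and an artificial ray continues beyond it.\<close>

definition anc :: "nat \<Rightarrow> word \<Rightarrow> word \<times> nat" where
  "anc i w = (drop i w, i - length w)"

lemma anc_inj: "anc i w = anc j w \<longleftrightarrow> i = j"
proof
  assume "anc i w = anc j w"
  then have "length (drop i w) = length (drop j w)" "i - length w = j - length w" by (simp_all add: anc_def)
  then show "i = j" by simp
qed simp

text \<open>\<open>c\<close> is the cancelled block. As \<open>r\<close> is the reversed left
  factor, its letters meet those of \<open>v\<close> in the same order, hence
  \<open>map linv c\<close> without reversal.\<close>

lemma wcancel_decomp:
  "\<exists>c k w. v = c @ k \<and> r = map linv c @ w \<and> wcancel r v = rev w @ k"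
proof (induction r v rule: wcancel.induct)
  case (3 a r b v)
  show ?case
  proof (cases "b = linv a")
    case True
    have "\<exists>c k w. v = c @ k \<and> r = map linv c @ w \<and> wcancel r v = rev w @ k"
      by (rule 3) (use True in \<open>simp add: linv_def\<close>)
    then obtain c k w where "v = c @ k" "r = map linv c @ w" "wcancel r v = rev w @ k" by blast
    with True show ?thesis
      using cancel_iff[of a b] by - (rule exI[where x = "b # c"], rule exI[where x = k], rule exI[where x = w], auto)
  next
    case False
    then show ?thesis
      using cancel_iff[of a b] by - (rule exI[where x = "[]"], rule exI[where x = "b # v"], rule exI[where x = "a # r"], auto)
  qed
qed auto

text \<open>The rays from \<open>u k\<close> and from \<open>k\<close> to the common boundary point
  merge after i0 and j0 steps, where i0 counts the letters of \<open>u\<close> that survive and j0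
  those that cancel. So \<open>i0 + j0\<close> is the length of \<open>u\<close>, and this is how a
  radial function of \<open>u\<close> becomes a function of two tree vertices.\<close>

lemma anc_wmul:
  assumes u: "reduced u"
  shows "\<exists>i0 j0. length u = i0 + j0 \<and> j0 \<le> length k \<and>
    (\<forall>i j. anc i (wmul u k) = anc j k \<longleftrightarrow> (\<exists>q. i = i0 + q \<and> j = j0 + q))"
proof -
  obtain c k' w where k: "k = c @ k'" and r: "rev u = map linv c @ w" and m: "wmul u k = rev w @ k'"
    using wcancel_decomp[of k "rev u"] unfolding wmul_def by blast
  have red: "reduced (map linv c @ w)" using u reduced_rev[of u] r by simp
  \<comment> \<open>The rays cannot merge earlier: equality of these two letters would be a
    cancellation inside the reduced word \<open>u\<close>.\<close>
  have diff: "last c \<noteq> hd w" if "c \<noteq> []" "w \<noteq> []"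
    using red that by (auto simp: reduced_append last_map)
  have "length u = length (rev u)" by simp
  also have "\<dots> = length w + length c" unfolding r by simp
  finally have len: "length u = length w + length c" .
  have "(\<exists>q. i = length w + q \<and> j = length c + q)" if e: "anc i (wmul u k) = anc j k" for i j
  proof -
    have d: "drop i (rev w @ k') = drop j (c @ k')" and
      s: "i - (length w + length k') = j - (length c + length k')"
      using e m k by (auto simp: anc_def)
    from d have "length (drop i (rev w @ k')) = length (drop j (c @ k'))" by simp
    then have l: "length w + length k' - i = length c + length k' - j" by simp
    have "i \<ge> length w"
    proof (rule ccontr)
      assume "\<not> i \<ge> length w"
      then have i: "i < length w" and j: "j < length c" using l s by auto
      then have "drop i (rev w) @ k' = drop j c @ k'" using d by simp
      then have "drop i (rev w) = drop j c" by simp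
      moreover have "last (drop i (rev w)) = hd w" using i by (simp add: last_drop last_rev)
      moreover have "last (drop j c) = last c" using j by simp
      moreover have "c \<noteq> []" "w \<noteq> []" using i j by auto
      ultimately show False using diff by metis
    qed
    then show ?thesis using l s by (intro exI[of _ "i - length w"]) linarith
  qed
  moreover have "anc (length w + q) (wmul u k) = anc (length c + q) k" for q
    unfolding anc_def m by (simp add: k)
  ultimately show ?thesis using len k
    by (intro exI[of _ "length w"] exI[of _ "length c"]) auto
qed

section \<open>Radial multipliers\<close>

lemma inner_mult_expand:
  fixes X \<zeta> \<omega> :: "'g::group_add group_alg"
  shows "inner (X * \<zeta>) \<omega> = (\<Sum>u\<in>Poly_Mapping.keys X. \<Sum>k\<in>Poly_Mapping.keys \<zeta>.
     inner (Poly_Mapping.lookup X u * Poly_Mapping.lookup \<zeta> k) (Poly_Mapping.lookup \<omega> (u + k)))"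
proof -
  have "X * \<zeta> = (\<Sum>u\<in>Poly_Mapping.keys X. Poly_Mapping.single u (Poly_Mapping.lookup X u)) *
      (\<Sum>k\<in>Poly_Mapping.keys \<zeta>. Poly_Mapping.single k (Poly_Mapping.lookup \<zeta> k))"
    by (simp only: poly_mapping_sum_singles[symmetric])
  then show ?thesis
    by (simp add: sum_product mult_single inner_sum_left)
qed

text \<open>Left convolution by \<open>X\<close> has the matrix entry \<open>X u\<close> at row
  \<open>u + k\<close> and column \<open>k\<close>. Sandwiching it between diagonal operators and
  summing multiplies each entry by the kernel
  \<open>\<Sum>i\<in>I. \<xi> i (u + k) * \<eta> i k\<close>.\<close>

lemma schur_expand:
  fixes X \<zeta> \<omega> :: "'g::group_add group_alg"
  shows "(\<Sum>i\<in>I. inner (X * pmul (\<eta> i) \<zeta>) (pmul (\<xi> i) \<omega>))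
    = (\<Sum>u\<in>Poly_Mapping.keys X. \<Sum>k\<in>Poly_Mapping.keys \<zeta>. (\<Sum>i\<in>I. \<xi> i (u + k) * \<eta> i k) *
     inner (Poly_Mapping.lookup X u * Poly_Mapping.lookup \<zeta> k) (Poly_Mapping.lookup \<omega> (u + k)))"
proof -
  have "inner (X * pmul (\<eta> i) \<zeta>) (pmul (\<xi> i) \<omega>)
    = (\<Sum>u\<in>Poly_Mapping.keys X. \<Sum>k\<in>Poly_Mapping.keys \<zeta>. (\<xi> i (u + k) * \<eta> i k) *
     inner (Poly_Mapping.lookup X u * Poly_Mapping.lookup \<zeta> k) (Poly_Mapping.lookup \<omega> (u + k)))" for i
  proof -
    have "inner (X * pmul (\<eta> i) \<zeta>) (pmul (\<xi> i) \<omega>)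
      = (\<Sum>u\<in>Poly_Mapping.keys X. \<Sum>k\<in>Poly_Mapping.keys (pmul (\<eta> i) \<zeta>). (\<xi> i (u + k) * \<eta> i k) *
     inner (Poly_Mapping.lookup X u * Poly_Mapping.lookup \<zeta> k) (Poly_Mapping.lookup \<omega> (u + k)))"
      unfolding inner_mult_expand by (simp add: mult.assoc)
    also have "\<dots> = (\<Sum>u\<in>Poly_Mapping.keys X. \<Sum>k\<in>Poly_Mapping.keys \<zeta>. (\<xi> i (u + k) * \<eta> i k) *
     inner (Poly_Mapping.lookup X u * Poly_Mapping.lookup \<zeta> k) (Poly_Mapping.lookup \<omega> (u + k)))"
      by (intro sum.cong sum.mono_neutral_left keys_pmul) (auto simp: in_keys_iff)
    finally show ?thesis .
  qed
  then have "(\<Sum>i\<in>I. inner (X * pmul (\<eta> i) \<zeta>) (pmul (\<xi> i) \<omega>))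
    = (\<Sum>i\<in>I. \<Sum>u\<in>Poly_Mapping.keys X. \<Sum>k\<in>Poly_Mapping.keys \<zeta>. (\<xi> i (u + k) * \<eta> i k) *
     inner (Poly_Mapping.lookup X u * Poly_Mapping.lookup \<zeta> k) (Poly_Mapping.lookup \<omega> (u + k)))" by simp
  also have "\<dots> = (\<Sum>u\<in>Poly_Mapping.keys X. \<Sum>i\<in>I. \<Sum>k\<in>Poly_Mapping.keys \<zeta>. (\<xi> i (u + k) * \<eta> i k) *
     inner (Poly_Mapping.lookup X u * Poly_Mapping.lookup \<zeta> k) (Poly_Mapping.lookup \<omega> (u + k)))"
    by (rule sum.swap)
  also have "\<dots> = (\<Sum>u\<in>Poly_Mapping.keys X. \<Sum>k\<in>Poly_Mapping.keys \<zeta>. \<Sum>i\<in>I. (\<xi> i (u + k) * \<eta> i k) *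
     inner (Poly_Mapping.lookup X u * Poly_Mapping.lookup \<zeta> k) (Poly_Mapping.lookup \<omega> (u + k)))"
    by (rule sum.cong[OF refl]) (rule sum.swap)
  finally show ?thesis by (simp only: sum_distrib_right)
qed

lemma sum_norm_pmul_sq_le:
  assumes "\<And>g. (\<Sum>i\<in>I. (\<xi> i g)\<^sup>2) \<le> A"
  shows "(\<Sum>i\<in>I. (norm (pmul (\<xi> i) \<omega>))\<^sup>2) \<le> A * (norm \<omega>)\<^sup>2"
proof -
  have "(norm (pmul c \<omega>))\<^sup>2 = (\<Sum>g\<in>Poly_Mapping.keys \<omega>. (c g)\<^sup>2 * (cmod (Poly_Mapping.lookup \<omega> g))\<^sup>2)" for c
    unfolding power2_norm_eq_inner
    by (subst inner_poly_mapping_superset[of "Poly_Mapping.keys \<omega>"])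
       (simp_all add: keys_pmul power2_eq_square mult.assoc del: complex_scaleR)
  then have "(\<Sum>i\<in>I. (norm (pmul (\<xi> i) \<omega>))\<^sup>2)
    = (\<Sum>i\<in>I. \<Sum>g\<in>Poly_Mapping.keys \<omega>. (\<xi> i g)\<^sup>2 * (cmod (Poly_Mapping.lookup \<omega> g))\<^sup>2)" by simp
  also have "\<dots> = (\<Sum>g\<in>Poly_Mapping.keys \<omega>. (\<Sum>i\<in>I. (\<xi> i g)\<^sup>2) * (cmod (Poly_Mapping.lookup \<omega> g))\<^sup>2)"
    by (subst sum.swap) (simp add: sum_distrib_right)
  also have "\<dots> \<le> (\<Sum>g\<in>Poly_Mapping.keys \<omega>. A * (cmod (Poly_Mapping.lookup \<omega> g))\<^sup>2)"
    by (intro sum_mono mult_right_mono assms) simp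
  also have "\<dots> = A * (norm \<omega>)\<^sup>2"
    by (simp add: power2_norm_eq_inner inner_poly_mapping_def sum_distrib_left)
  finally show ?thesis .
qed

text \<open>The easy half of Grothendieck's characterization of Schur multipliers: a kernel of inner
  products of vectors with squared norms at most \<open>A\<close> and \<open>B\<close> costs
  \<open>sqrt A * sqrt B\<close>, by the Cauchy-Schwarz inequality in l^2 and then over
  \<open>I\<close>.\<close>

lemma schur_bound:
  fixes X \<zeta> \<omega> :: "'g::group_add group_alg"
  assumes X: "op_bound S X M" and \<zeta>: "Poly_Mapping.keys \<zeta> \<subseteq> S"
    and A: "\<And>g. (\<Sum>i\<in>I. (\<xi> i g)\<^sup>2) \<le> A" and B: "\<And>g. (\<Sum>i\<in>I. (\<eta> i g)\<^sup>2) \<le> B"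
  shows "(\<Sum>i\<in>I. inner (X * pmul (\<eta> i) \<zeta>) (pmul (\<xi> i) \<omega>)) \<le> M * (sqrt A * sqrt B) * (norm \<zeta> * norm \<omega>)"
proof -
  have M: "M \<ge> 0" using X by (simp add: op_bound_def)
  have "inner (X * pmul (\<eta> i) \<zeta>) (pmul (\<xi> i) \<omega>) \<le> M * (norm (pmul (\<xi> i) \<omega>) * norm (pmul (\<eta> i) \<zeta>))" for i
  proof -
    have "inner (X * pmul (\<eta> i) \<zeta>) (pmul (\<xi> i) \<omega>) \<le> norm (X * pmul (\<eta> i) \<zeta>) * norm (pmul (\<xi> i) \<omega>)"
      by (rule norm_cauchy_schwarz)
    also have "norm (X * pmul (\<eta> i) \<zeta>) \<le> M * norm (pmul (\<eta> i) \<zeta>)"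
      using X order_trans[OF keys_pmul \<zeta>] by (simp add: op_bound_def)
    finally show ?thesis by (simp add: mult_right_mono mult_ac)
  qed
  then have "(\<Sum>i\<in>I. inner (X * pmul (\<eta> i) \<zeta>) (pmul (\<xi> i) \<omega>))
    \<le> M * (\<Sum>i\<in>I. \<bar>norm (pmul (\<xi> i) \<omega>)\<bar> * \<bar>norm (pmul (\<eta> i) \<zeta>)\<bar>)"
    by (simp add: sum_distrib_left sum_mono)
  also have "\<dots> \<le> M * (L2_set (\<lambda>i. norm (pmul (\<xi> i) \<omega>)) I * L2_set (\<lambda>i. norm (pmul (\<eta> i) \<zeta>)) I)"
    by (rule mult_left_mono[OF L2_set_mult_ineq M])
  also have "\<dots> \<le> M * (sqrt (A * (norm \<omega>)\<^sup>2) * sqrt (B * (norm \<zeta>)\<^sup>2))"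
  proof -
    have a: "(\<Sum>i\<in>I. (norm (pmul (\<xi> i) \<omega>))\<^sup>2) \<le> A * (norm \<omega>)\<^sup>2"
      by (rule sum_norm_pmul_sq_le) (rule A)
    have b: "(\<Sum>i\<in>I. (norm (pmul (\<eta> i) \<zeta>))\<^sup>2) \<le> B * (norm \<zeta>)\<^sup>2"
      by (rule sum_norm_pmul_sq_le) (rule B)
    have "0 \<le> A * (norm \<omega>)\<^sup>2" by (rule order_trans[OF sum_nonneg a]) simp
    then show ?thesis
      unfolding L2_set_def using M a b
      by (intro mult_left_mono mult_mono real_sqrt_le_mono) (auto intro: sum_nonneg)
  qed
  finally show ?thesis by (simp add: real_sqrt_mult mult_ac)
qed

text \<open>Coordinate \<nu> of a vector attached to the vertex \<open>g\<close>: the sequence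
  \<open>a\<close>, cut off at \<open>K\<close>, laid out along the ray of \<open>g\<close>. A ray
  never repeats a point, so the squared norm is at most that of the sequence.\<close>

definition tree_fun :: "(nat \<Rightarrow> real) \<Rightarrow> nat \<Rightarrow> word \<times> nat \<Rightarrow> free_group \<Rightarrow> real" where
  "tree_fun a K \<nu> g = (\<Sum>i<K. if anc i (Rep_free_group g) = \<nu> then a i else 0)"

lemma sum_tree_fun_sq_le:
  assumes "finite N"
  shows "(\<Sum>\<nu>\<in>N. (tree_fun a K \<nu> g)\<^sup>2) \<le> (\<Sum>i<K. (a i)\<^sup>2)"
proof -
  let ?w = "Rep_free_group g"
  have sq: "(tree_fun a K \<nu> g)\<^sup>2 = (\<Sum>i<K. if anc i ?w = \<nu> then (a i)\<^sup>2 else 0)" for \<nu>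
  proof (cases "\<exists>i<K. anc i ?w = \<nu>")
    case True
    then obtain i where i: "i < K" "anc i ?w = \<nu>" by blast
    then have "anc j ?w = \<nu> \<longleftrightarrow> j = i" for j using anc_inj by metis
    then show ?thesis using i by (simp add: tree_fun_def)
  next
    case False
    then show ?thesis by (auto simp: tree_fun_def)
  qed
  have "(\<Sum>\<nu>\<in>N. (tree_fun a K \<nu> g)\<^sup>2) = (\<Sum>i<K. \<Sum>\<nu>\<in>N. if anc i ?w = \<nu> then (a i)\<^sup>2 else 0)"
    unfolding sq by (rule sum.swap)
  also have "\<dots> \<le> (\<Sum>i<K. (a i)\<^sup>2)"
    using assms by (intro sum_mono) (simp add: sum.delta)
  finally show ?thesis .
qed

text \<open>Only the common part of the two rays contributes to the inner product, and there the
  indices run along a diagonal. \<open>J\<close> exceeds \<open>K\<close> by \<open>j0\<close> so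
  that every partner of an index below \<open>K\<close> is present.\<close>

lemma sum_tree_fun_mult:
  assumes N: "finite N" "\<And>j. j < J \<Longrightarrow> anc j (Rep_free_group k) \<in> N"
    and eq: "\<And>i j. anc i (Rep_free_group g) = anc j (Rep_free_group k) \<longleftrightarrow> (\<exists>q. i = i0 + q \<and> j = j0 + q)"
    and J: "J \<ge> K + j0"
  shows "(\<Sum>\<nu>\<in>N. tree_fun a K \<nu> g * tree_fun b J \<nu> k) = (\<Sum>q<K - i0. a (i0 + q) * b (j0 + q))"
proof -
  let ?w = "Rep_free_group g" and ?v = "Rep_free_group k"
  have "(\<Sum>\<nu>\<in>N. tree_fun a K \<nu> g * tree_fun b J \<nu> k)
    = (\<Sum>\<nu>\<in>N. \<Sum>i<K. \<Sum>j<J. (if anc i ?w = \<nu> then a i else 0) * (if anc j ?v = \<nu> then b j else 0))"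
    by (simp only: tree_fun_def sum_product)
  also have "\<dots> = (\<Sum>i<K. \<Sum>\<nu>\<in>N. \<Sum>j<J. (if anc i ?w = \<nu> then a i else 0) * (if anc j ?v = \<nu> then b j else 0))"
    by (rule sum.swap)
  also have "\<dots> = (\<Sum>i<K. \<Sum>j<J. \<Sum>\<nu>\<in>N. (if anc i ?w = \<nu> then a i else 0) * (if anc j ?v = \<nu> then b j else 0))"
    by (rule sum.cong[OF refl]) (rule sum.swap)
  also have "\<dots> = (\<Sum>i<K. \<Sum>j<J. if anc i ?w = anc j ?v then a i * b j else 0)"
  proof (intro sum.cong refl)
    fix i j assume "j \<in> {..<J}"
    then have "anc j ?v \<in> N" using N by simp
    then show "(\<Sum>\<nu>\<in>N. (if anc i ?w = \<nu> then a i else 0) * (if anc j ?v = \<nu> then b j else 0))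
      = (if anc i ?w = anc j ?v then a i * b j else 0)"
      using N(1) by (simp add: if_distrib[of "\<lambda>x. _ * x"] sum.delta cong: if_cong)
  qed
  also have "\<dots> = (\<Sum>i<K. if i0 \<le> i then a i * b (j0 + (i - i0)) else 0)"
  proof (rule sum.cong[OF refl])
    fix i assume "i \<in> {..<K}"
    then have "i < K" by simp
    show "(\<Sum>j<J. if anc i ?w = anc j ?v then a i * b j else 0) = (if i0 \<le> i then a i * b (j0 + (i - i0)) else 0)"
    proof (cases "i0 \<le> i")
      case True
      have "anc i ?w = anc j ?v \<longleftrightarrow> j = j0 + (i - i0)" for j
        unfolding eq using True by (auto intro: exI[of _ "i - i0"])
      moreover have "j0 + (i - i0) < J" using J \<open>i < K\<close> by simp
      ultimately show ?thesis using True by simp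
    next
      case False
      then show ?thesis by (simp add: eq)
    qed
  qed
  also have "\<dots> = (\<Sum>i\<in>{i0..<K}. a i * b (j0 + (i - i0)))"
    by (rule sum.mono_neutral_cong_right) auto
  also have "\<dots> = (\<Sum>q<K - i0. a (i0 + q) * b (j0 + q))"
    by (rule sum.reindex_bij_witness[of _ "\<lambda>q. i0 + q" "\<lambda>i. i - i0"]) auto
  finally show ?thesis .
qed

text \<open>The trace class Hankel matrix \<open>m (i + j) - m (i + j + 2)\<close> is the sum of the rank one matrices
  \<open>a l i * b l j\<close>; summing it along the diagonal gives \<open>m (i + j)\<close>, and diagonals correspond to the
  common ancestors of two vertices of the tree.\<close>
theorem haagerup_multiplier:
  fixes X :: "free_group group_alg" and a b :: "nat \<Rightarrow> nat \<Rightarrow> real"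
  assumes X: "op_bound S X M" and S: "add_subgroup S" "Poly_Mapping.keys X \<subseteq> S"
    and lim: "\<And>i j. (\<lambda>K. \<Sum>l<K. \<Sum>q<K - i. a l (i + q) * b l (j + q)) \<longlonglongrightarrow> m (i + j)"
    and A: "\<And>l K. (\<Sum>i<K. (a l i)\<^sup>2) \<le> A l" and B: "\<And>l K. (\<Sum>i<K. (b l i)\<^sup>2) \<le> B l"
    and C: "\<And>K. (\<Sum>l<K. sqrt (A l) * sqrt (B l)) \<le> C"
  shows "op_bound S (pmul (\<lambda>g. m (glen g)) X) (C * M)"
proof -
  have M: "M \<ge> 0" using X by (simp add: op_bound_def)
  have C0: "C \<ge> 0" using C[of 0] by simp
  have main: "inner (pmul (\<lambda>g. m (glen g)) X * \<zeta>) \<omega> \<le> C * M * (norm \<zeta> * norm \<omega>)"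
    if \<zeta>: "Poly_Mapping.keys \<zeta> \<subseteq> S" for \<zeta> \<omega>
  proof -
    let ?R = Rep_free_group
    let ?t = "\<lambda>u k. inner (Poly_Mapping.lookup X u * Poly_Mapping.lookup \<zeta> k) (Poly_Mapping.lookup \<omega> (u + k))"
    have "\<forall>u k. \<exists>i j. glen u = i + j \<and> j \<le> glen k \<and>
      (\<forall>i' j'. anc i' (?R (u + k)) = anc j' (?R k) \<longleftrightarrow> (\<exists>q. i' = i + q \<and> j' = j + q))"
      unfolding glen_def Rep_plus using anc_wmul reduced_Rep by blast
    then obtain I J where IJ: "\<And>u k. glen u = I u k + J u k" "\<And>u k. J u k \<le> glen k"
      "\<And>u k i' j'. anc i' (?R (u + k)) = anc j' (?R k) \<longleftrightarrow> (\<exists>q. i' = I u k + q \<and> j' = J u k + q)"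
      by metis
    \<comment> \<open>Bounds the number of letters of \<open>k\<close> that can cancel, uniformly
      over the support of \<zeta>; the second sequence is cut off at \<open>K + D\<close> for this
      reason.\<close>
    define D where "D = (\<Sum>k\<in>Poly_Mapping.keys \<zeta>. glen k)"
    have D: "glen k \<le> D" if "k \<in> Poly_Mapping.keys \<zeta>" for k
      unfolding D_def using that by (intro member_le_sum) auto
    define \<kappa> where "\<kappa> K i j = (\<Sum>l<K. \<Sum>q<K - i. a l (i + q) * b l (j + q))" for K i j
    have fin: "(\<Sum>u\<in>Poly_Mapping.keys X. \<Sum>k\<in>Poly_Mapping.keys \<zeta>. \<kappa> K (I u k) (J u k) * ?t u k)
      \<le> C * M * (norm \<zeta> * norm \<omega>)" for K
    proof -
      define N where "N = (\<Union>k\<in>Poly_Mapping.keys \<zeta>. (\<lambda>j. anc j (?R k)) ` {..<K + D})"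
      have N: "finite N" by (simp add: N_def)
      have "(\<Sum>l<K. \<Sum>\<nu>\<in>N. inner (X * pmul (tree_fun (b l) (K + D) \<nu>) \<zeta>) (pmul (tree_fun (a l) K \<nu>) \<omega>))
        = (\<Sum>l<K. \<Sum>u\<in>Poly_Mapping.keys X. \<Sum>k\<in>Poly_Mapping.keys \<zeta>.
            (\<Sum>q<K - I u k. a l (I u k + q) * b l (J u k + q)) * ?t u k)"
        unfolding schur_expand
      proof (intro sum.cong refl arg_cong2[where f = "(*)"] sum_tree_fun_mult N)
        fix u k j assume k: "k \<in> Poly_Mapping.keys \<zeta>"
        show "K + J u k \<le> K + D" using IJ(2)[of u k] D[OF k] by simp
        show "anc j (?R k) \<in> N" if "j < K + D" using k that by (auto simp: N_def)
      qed (rule IJ(3))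
      also have "\<dots> = (\<Sum>u\<in>Poly_Mapping.keys X. \<Sum>l<K. \<Sum>k\<in>Poly_Mapping.keys \<zeta>.
            (\<Sum>q<K - I u k. a l (I u k + q) * b l (J u k + q)) * ?t u k)"
        by (rule sum.swap)
      also have "\<dots> = (\<Sum>u\<in>Poly_Mapping.keys X. \<Sum>k\<in>Poly_Mapping.keys \<zeta>. \<Sum>l<K.
            (\<Sum>q<K - I u k. a l (I u k + q) * b l (J u k + q)) * ?t u k)"
        by (rule sum.cong[OF refl]) (rule sum.swap)
      also have "\<dots> = (\<Sum>u\<in>Poly_Mapping.keys X. \<Sum>k\<in>Poly_Mapping.keys \<zeta>. \<kappa> K (I u k) (J u k) * ?t u k)"
        by (simp only: \<kappa>_def sum_distrib_right)
      finally have "(\<Sum>u\<in>Poly_Mapping.keys X. \<Sum>k\<in>Poly_Mapping.keys \<zeta>. \<kappa> K (I u k) (J u k) * ?t u k)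
        = (\<Sum>l<K. \<Sum>\<nu>\<in>N. inner (X * pmul (tree_fun (b l) (K + D) \<nu>) \<zeta>) (pmul (tree_fun (a l) K \<nu>) \<omega>))"
        by (rule sym)
      also have "\<dots> \<le> (\<Sum>l<K. M * (sqrt (A l) * sqrt (B l)) * (norm \<zeta> * norm \<omega>))"
        by (intro sum_mono schur_bound[OF X \<zeta>] order_trans[OF sum_tree_fun_sq_le[OF N]] A B)
      also have "\<dots> = M * (\<Sum>l<K. sqrt (A l) * sqrt (B l)) * (norm \<zeta> * norm \<omega>)"
        by (simp only: sum_distrib_left sum_distrib_right)
      also have "\<dots> \<le> M * C * (norm \<zeta> * norm \<omega>)"
        using M by (intro mult_right_mono mult_left_mono C) auto
      finally show ?thesis by (simp only: mult.commute[of M C])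
    qed
    \<comment> \<open>The supports are finite, so the kernels converge term by term, and the limit
      \<open>m (I u k + J u k)\<close> is \<open>m (glen u)\<close>.\<close>
    have "(\<lambda>K. \<Sum>u\<in>Poly_Mapping.keys X. \<Sum>k\<in>Poly_Mapping.keys \<zeta>. \<kappa> K (I u k) (J u k) * ?t u k)
      \<longlonglongrightarrow> (\<Sum>u\<in>Poly_Mapping.keys X. \<Sum>k\<in>Poly_Mapping.keys \<zeta>. m (I u k + J u k) * ?t u k)"
      unfolding \<kappa>_def by (intro tendsto_sum tendsto_mult lim tendsto_const)
    then have "(\<Sum>u\<in>Poly_Mapping.keys X. \<Sum>k\<in>Poly_Mapping.keys \<zeta>. m (I u k + J u k) * ?t u k)
      \<le> C * M * (norm \<zeta> * norm \<omega>)"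
      by (rule LIMSEQ_le_const2) (use fin in blast)
    also have "(\<Sum>u\<in>Poly_Mapping.keys X. \<Sum>k\<in>Poly_Mapping.keys \<zeta>. m (I u k + J u k) * ?t u k)
      = (\<Sum>u\<in>Poly_Mapping.keys X. \<Sum>k\<in>Poly_Mapping.keys \<zeta>. m (glen u) * ?t u k)"
      by (simp only: IJ(1)[symmetric])
    also have "\<dots> = (\<Sum>u\<in>Poly_Mapping.keys (pmul (\<lambda>g. m (glen g)) X). \<Sum>k\<in>Poly_Mapping.keys \<zeta>. m (glen u) * ?t u k)"
      by (rule sum.mono_neutral_right) (auto simp: keys_pmul in_keys_iff)
    also have "\<dots> = inner (pmul (\<lambda>g. m (glen g)) X * \<zeta>) \<omega>"
      unfolding inner_mult_expand by simp
    finally show ?thesis .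
  qed
  show ?thesis
    unfolding op_bound_def
  proof (intro conjI allI impI)
    show "0 \<le> C * M" using M C0 by simp
    fix \<zeta> :: "free_group group_alg" assume \<zeta>: "Poly_Mapping.keys \<zeta> \<subseteq> S"
    let ?y = "pmul (\<lambda>g. m (glen g)) X * \<zeta>"
    show "norm ?y \<le> C * M * norm \<zeta>"
    proof (cases "?y = 0")
      case False
      have "norm ?y * norm ?y \<le> (C * M * norm \<zeta>) * norm ?y"
        using main[OF \<zeta>, of ?y] by (simp add: power2_norm_eq_inner[symmetric] power2_eq_square mult_ac)
      then show ?thesis by (rule mult_right_le_imp_le) (use False in simp)
    qed (use M C0 in simp)
  qed
qed

section \<open>The multipliers for the semigroup and for the inverse of the generator\<close>

lemma sum_step2_telescope:
  fixes m h :: "nat \<Rightarrow> real"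
  assumes "\<And>k. m k - m (k + 2) = h k"
  shows "(\<Sum>q<Q. h (k + 2 * q)) = m k - m (k + 2 * Q)"
proof (induction Q)
  case (Suc Q)
  show ?case using assms[of "k + 2 * Q"] Suc by (simp add: add.assoc)
qed simp

lemma filterlim_add_sub_at_top: "filterlim (\<lambda>K. n + 2 * (K - i :: nat)) at_top sequentially"
  unfolding filterlim_at_top
proof
  fix Z
  show "\<forall>\<^sub>F K in sequentially. Z \<le> n + 2 * (K - i)"
    using eventually_ge_at_top[of "Z + i"] by eventually_elim simp
qed

lemma sum_geometric_le:
  fixes r :: real
  assumes "0 < r" "r < 1"
  shows "(\<Sum>i<K. if d \<le> i then r ^ (2 * i) else 0) \<le> r ^ (2 * d) / (1 - r\<^sup>2)"
proof -
  have r2: "r\<^sup>2 < 1" using assms by (simp add: power_less_one_iff abs_square_less_1)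
  have "(\<Sum>i<K. if d \<le> i then r ^ (2 * i) else 0) = (\<Sum>i\<in>{d..<K}. r ^ (2 * i))"
    by (rule sum.mono_neutral_cong_right) auto
  also have "\<dots> = (\<Sum>q<K - d. r ^ (2 * d) * (r\<^sup>2) ^ q)"
    by (rule sum.reindex_bij_witness[of _ "\<lambda>q. d + q" "\<lambda>i. i - d"])
       (auto simp: power_add[symmetric] power_mult[symmetric] distrib_left[symmetric])
  also have "\<dots> = r ^ (2 * d) * ((1 - (r\<^sup>2) ^ (K - d)) / (1 - r\<^sup>2))"
    using r2 by (simp add: sum_distrib_left[symmetric] sum_gp_strict)
  also have "\<dots> \<le> r ^ (2 * d) * (1 / (1 - r\<^sup>2))"
    using assms r2 by (intro mult_left_mono divide_right_mono) auto
  finally show ?thesis by simp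
qed

text \<open>The Hankel matrix is split into its first \<open>d\<close> rows and a rank one remainder.\<close>

lemma heat_tail_multiplier:
  fixes X :: "free_group group_alg" and r :: real
  assumes X: "op_bound S X M" and S: "add_subgroup S" "Poly_Mapping.keys X \<subseteq> S"
    and r: "0 < r" "r < 1"
  shows "op_bound S (pmul (\<lambda>g. if d \<le> glen g then r ^ glen g else r ^ (d + (d + glen g) mod 2)) X)
    ((real d + 1) * r ^ d * M)"
proof -
  \<comment> \<open>Below \<open>d\<close> the value is that of the first index at least
    \<open>d\<close> of the same parity, which makes the Hankel entries \<open>h k\<close> vanish
    for \<open>k < d\<close>.\<close>
  define m where "m k = (if d \<le> k then r ^ k else r ^ (d + (d + k) mod 2))" for k
  define h where "h k = (if d \<le> k then (1 - r\<^sup>2) * r ^ k else 0)" for k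
  \<comment> \<open>For \<open>l < d\<close> the pair \<open>a l\<close>, \<open>b l\<close> is a
    unit vector and row \<open>l\<close> of the Hankel matrix. For \<open>l = d\<close> it covers
    all later rows at once, since \<open>h (i + j) = (1 - r\<^sup>2) * r ^ i * r ^ j\<close> when
    \<open>d \<le> i\<close>.\<close>
  define a where "a l i = (if l < d then of_bool (i = l) else if l = d \<and> d \<le> i then r ^ i else 0)" for l i :: nat
  define b where "b l j = (if l < d then h (l + j) else if l = d then (1 - r\<^sup>2) * r ^ j else 0)" for l j :: nat
  define A where "A l = (if l < d then 1 else if l = d then r ^ (2 * d) / (1 - r\<^sup>2) else 0)" for l
  define B where "B l = (if l < d then (1 - r\<^sup>2) * r ^ (2 * d) else if l = d then 1 - r\<^sup>2 else 0)" for l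
  have r2: "r\<^sup>2 < 1" using r by (simp add: abs_square_less_1)
  have mh: "m k - m (k + 2) = h k" for k
  proof -
    consider "d \<le> k" | "k + 2 < d" | "k + 2 = d" | "k + 1 = d" by linarith
    then show ?thesis
    proof cases
      case 1
      then show ?thesis by (simp add: m_def h_def power_add power2_eq_square algebra_simps)
    next
      case 2
      then show ?thesis by (simp add: m_def h_def)
    next
      case 3
      then have "(d + k) mod 2 = 0" by presburger
      then show ?thesis using 3 by (simp add: m_def h_def)
    next
      case 4
      then have "(d + k) mod 2 = 1" by presburger
      then show ?thesis using 4 by (auto simp: m_def h_def)
    qed
  qed
  have "op_bound S (pmul (\<lambda>g. m (glen g)) X) ((real d + 1) * r ^ d * M)"
  proof (rule haagerup_multiplier[OF X S])
    fix i j
    have *: "(\<Sum>l<K. \<Sum>q<K - i. a l (i + q) * b l (j + q)) = m (i + j) - m (i + j + 2 * (K - i))" if K: "K > d" for K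
    proof -
      have "(\<Sum>l<K. \<Sum>q<K - i. a l (i + q) * b l (j + q)) = (\<Sum>q<K - i. \<Sum>l<K. a l (i + q) * b l (j + q))"
        by (rule sum.swap)
      also have "\<dots> = (\<Sum>q<K - i. h (i + j + 2 * q))"
      proof (rule sum.cong[OF refl])
        fix q assume "q \<in> {..<K - i}"
        \<comment> \<open>The only rank one term that reaches row \<open>i + q\<close>.\<close>
        define s where "s = (if i + q < d then i + q else d)"
        have "s < K" using K by (auto simp: s_def)
        have e: "i + q + (j + q) = i + j + 2 * q" by simp
        have "r ^ (i + q) * r ^ (j + q) = r ^ (i + j + 2 * q)"
          unfolding power_add[symmetric] e by (rule refl)
        then have "a l (i + q) * b l (j + q) = (if l = s then h (i + j + 2 * q) else 0)" for l
          by (cases "i + q < d") (auto simp: a_def b_def s_def h_def e mult_ac)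
        then show "(\<Sum>l<K. a l (i + q) * b l (j + q)) = h (i + j + 2 * q)"
          using \<open>s < K\<close> by simp
      qed
      also have "\<dots> = m (i + j) - m (i + j + 2 * (K - i))"
        by (rule sum_step2_telescope[of m h, OF mh])
      finally show ?thesis .
    qed
    have "m \<longlonglongrightarrow> 0"
    proof (rule Lim_transform_eventually)
      show "(\<lambda>k. r ^ k) \<longlonglongrightarrow> 0" using r by (intro LIMSEQ_power_zero) simp
      show "\<forall>\<^sub>F k in sequentially. r ^ k = m k"
        using eventually_ge_at_top[of d] by eventually_elim (simp add: m_def)
    qed
    moreover have "filterlim (\<lambda>K. i + j + 2 * (K - i)) at_top sequentially"
      by (rule filterlim_add_sub_at_top)
    ultimately have "(\<lambda>K. m (i + j + 2 * (K - i))) \<longlonglongrightarrow> 0"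
      by (rule filterlim_compose)
    then have "(\<lambda>K. m (i + j) - m (i + j + 2 * (K - i))) \<longlonglongrightarrow> m (i + j) - 0"
      by (intro tendsto_diff tendsto_const)
    moreover have "\<forall>\<^sub>F K in sequentially. m (i + j) - m (i + j + 2 * (K - i)) = (\<Sum>l<K. \<Sum>q<K - i. a l (i + q) * b l (j + q))"
      using eventually_gt_at_top[of d] by eventually_elim (rule *[symmetric])
    ultimately have "(\<lambda>K. \<Sum>l<K. \<Sum>q<K - i. a l (i + q) * b l (j + q)) \<longlonglongrightarrow> m (i + j) - 0"
      by (rule Lim_transform_eventually)
    then show "(\<lambda>K. \<Sum>l<K. \<Sum>q<K - i. a l (i + q) * b l (j + q)) \<longlonglongrightarrow> m (i + j)"
      by (simp only: diff_0_right)
  next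
    fix l K
    show "(\<Sum>i<K. (a l i)\<^sup>2) \<le> A l"
    proof -
      consider "l < d" | "l = d" | "l > d" by linarith
      then show ?thesis
      proof cases
        case 1
        then have "(\<Sum>i<K. (a l i)\<^sup>2) = (\<Sum>i<K. if i = l then 1 else 0)" by (intro sum.cong) (auto simp: a_def)
        also have "\<dots> \<le> 1" by simp
        finally show ?thesis using 1 by (simp add: A_def)
      next
        case 2
        then have "(\<Sum>i<K. (a l i)\<^sup>2) = (\<Sum>i<K. if d \<le> i then r ^ (2 * i) else 0)"
          by (intro sum.cong) (auto simp: a_def power_mult[symmetric] mult.commute)
        then show ?thesis using sum_geometric_le[OF r] 2 by (simp add: A_def)
      qed (simp add: a_def A_def)
    qed
    show "(\<Sum>i<K. (b l i)\<^sup>2) \<le> B l"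
    proof -
      consider "l < d" | "l = d" | "l > d" by linarith
      then show ?thesis
      proof cases
        case 1
        have "(\<Sum>i<K. (b l i)\<^sup>2) = (1 - r\<^sup>2)\<^sup>2 * (\<Sum>i<K. if d \<le> l + i then r ^ (2 * (l + i)) else 0)"
          using 1 unfolding sum_distrib_left
          by (intro sum.cong) (auto simp: b_def h_def power_mult_distrib power_mult[symmetric] mult.commute)
        also have "(\<Sum>i<K. if d \<le> l + i then r ^ (2 * (l + i)) else 0) \<le> (\<Sum>i<l + K. if d \<le> i then r ^ (2 * i) else 0)"
        proof -
          have "(\<Sum>i<K. if d \<le> l + i then r ^ (2 * (l + i)) else 0) = (\<Sum>i\<in>{l..<l + K}. if d \<le> i then r ^ (2 * i) else 0)"
            by (rule sum.reindex_bij_witness[of _ "\<lambda>i. i - l" "\<lambda>i. l + i"]) auto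
          also have "\<dots> \<le> (\<Sum>i<l + K. if d \<le> i then r ^ (2 * i) else 0)"
            using r by (intro sum_mono2) auto
          finally show ?thesis .
        qed
        also have "\<dots> \<le> r ^ (2 * d) / (1 - r\<^sup>2)" by (rule sum_geometric_le[OF r])
        finally show ?thesis using 1 r2 by (simp add: B_def mult_left_mono power2_eq_square)
      next
        case 2
        have "(\<Sum>i<K. (b l i)\<^sup>2) = (1 - r\<^sup>2)\<^sup>2 * (\<Sum>i<K. if 0 \<le> i then r ^ (2 * i) else 0)"
          using 2 unfolding sum_distrib_left
          by (intro sum.cong) (auto simp: b_def power_mult_distrib power_mult[symmetric] mult.commute)
        also have "\<dots> \<le> (1 - r\<^sup>2)\<^sup>2 * (r ^ (2 * 0) / (1 - r\<^sup>2))"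
          by (intro mult_left_mono sum_geometric_le[OF r]) simp
        finally show ?thesis using 2 r2 by (simp add: B_def power2_eq_square)
      qed (simp add: b_def B_def)
    qed
  next
    fix K
    have AB0: "0 \<le> sqrt (A l) * sqrt (B l)" for l
      using r r2 by (auto simp: A_def B_def)
    have "(\<Sum>l<K. sqrt (A l) * sqrt (B l)) \<le> (\<Sum>l<K + Suc d. sqrt (A l) * sqrt (B l))"
      using AB0 by (intro sum_mono2) auto
    also have "\<dots> = (\<Sum>l<Suc d. sqrt (A l) * sqrt (B l))"
      by (rule sum.mono_neutral_right) (auto simp: A_def)
    \<comment> \<open>Each of the \<open>d\<close> rows costs
      \<open>sqrt (1 - r\<^sup>2) * r ^ d\<close>, the remainder \<open>r ^ d\<close>.\<close>
    also have "\<dots> = real d * (sqrt (1 - r\<^sup>2) * r ^ d) + r ^ d"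
    proof -
      have "sqrt (r ^ (2 * d)) = r ^ d" 
        using r real_sqrt_abs[of "r ^ d"] by (simp add: power_mult[symmetric] mult.commute)
      then show ?thesis using r r2 by (simp add: A_def B_def real_sqrt_mult real_sqrt_divide)
    qed
    also have "\<dots> \<le> real d * (1 * r ^ d) + r ^ d"
      using r r2 by (intro add_right_mono mult_left_mono mult_right_mono) auto
    finally show "(\<Sum>l<K. sqrt (A l) * sqrt (B l)) \<le> (real d + 1) * r ^ d" by (simp add: algebra_simps)
  qed
  then show ?thesis by (simp add: m_def)
qed

text \<open>Below \<open>d\<close> the function continues linearly on each parity class. The slope
  is such that the difference of the values at \<open>k\<close> and \<open>k + 2\<close> stays at
  \<open>2 / (d * (d + 2))\<close>, its value at \<open>k = d\<close>.\<close>

definition invlen :: "nat \<Rightarrow> nat \<Rightarrow> real" where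
  "invlen d k = (if d \<le> k then 1 / real k else
     1 / real (d + (d + k) mod 2) + (real (d + (d + k) mod 2) - real k) / (real d * (real d + 2)))"

text \<open>The Hankel matrix \<open>h (i + j)\<close> is the product of the lower triangle of ones with \<open>(g (l + j))\<close>, where
  \<open>g k = h k - h (k + 1)\<close>; extending \<open>h\<close> by a constant below \<open>d\<close> makes \<open>g\<close> vanish there.\<close>

lemma inverse_length_multiplier:
  fixes X :: "free_group group_alg"
  assumes X: "op_bound S X M" and S: "add_subgroup S" "Poly_Mapping.keys X \<subseteq> S" and d: "d \<ge> 1"
  shows "op_bound S (pmul (\<lambda>g. invlen d (glen g)) X) (4 / real d * M)"
proof -
  define h where "h k = 2 / (real (max k d) * (real (max k d) + 2))" for k
  define g where "g k = h k - h (Suc k)" for k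
  define a where "a l i = (if i \<le> l then 1 else 0 :: real)" for l i :: nat
  define b where "b l j = g (l + j)" for l j :: nat
  \<comment> \<open>A telescoping majorant for the tails of the series of
    \<open>(g k)\<^sup>2\<close>. It is tuned so that, times \<open>max s d + 1\<close>, it is the
    square of \<open>\<tau> s\<close>.\<close>
  define \<beta> where "\<beta> s = 4 / ((real (max s d))\<^sup>2 * (real (max s d) + 1) ^ 3)" for s
  \<comment> \<open>Bounds the cost of the s-th rank one term. It is constant below
    \<open>d\<close>, contributing \<open>2 / (d + 1)\<close> in all, and is the difference of
    \<open>2 / s\<close> and \<open>2 / (s + 1)\<close> from \<open>d\<close> on, contributing at
    most \<open>2 / d\<close>; together this stays below \<open>4 / d\<close>.\<close>
  define \<tau> where "\<tau> s = 2 / (real (max s d) * (real (max s d) + 1))" for s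
  have mh: "invlen d k - invlen d (k + 2) = h k" for k
  proof -
    consider "d \<le> k" | "k + 2 < d" | "k + 2 = d" | "k + 1 = d" by linarith
    then show ?thesis
    proof cases
      case 1
      then have "real k > 0" using d by simp
      then show ?thesis using 1 by (simp add: invlen_def h_def max_def field_simps)
    next
      case 2
      then show ?thesis by (simp add: invlen_def h_def diff_divide_distrib add_divide_distrib)
    next
      case 3
      then have "(d + k) mod 2 = 0" by presburger
      then show ?thesis using 3 by (simp add: invlen_def h_def add.commute)
    next
      case 4
      then have "(d + k) mod 2 = 1" by presburger
      then show ?thesis using 4 by (auto simp: invlen_def h_def add.commute)
    qed
  qed
  have h0: "h k \<ge> 0" for k by (simp add: h_def)
  have \<beta>0: "\<beta> s \<ge> 0" for s by (simp add: \<beta>_def)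
  have gsq: "(g k)\<^sup>2 \<le> \<beta> k - \<beta> (Suc k)" for k
  proof (cases "d \<le> k")
    case False
    then have "max k d = d" "max (Suc k) d = d" by auto
    then show ?thesis by (simp add: g_def h_def \<beta>_def)
  next
    case True
    define x where "x = real k"
    have x: "x \<ge> 1" using True d by (simp add: x_def)
    have mx: "max k d = k" "max (Suc k) d = Suc k" using True by auto
    have "g k = 2 * (2 * x + 3) / (x * (x + 1) * (x + 2) * (x + 3))"
      using x by (simp add: g_def h_def mx x_def[symmetric] divide_simps) (simp add: algebra_simps)
    also have "\<dots> \<le> 4 / (x * (x + 1) * (x + 2))"
      using x by (simp add: divide_simps)
    finally have g1: "g k \<le> 4 / (x * (x + 1) * (x + 2))" .
    have "g k = 2 * (2 * x + 3) / (x * (x + 1) * (x + 2) * (x + 3))"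
      using x by (simp add: g_def h_def mx x_def[symmetric] divide_simps) (simp add: algebra_simps)
    then have g0: "g k \<ge> 0" using x by simp
    have "(g k)\<^sup>2 \<le> (4 / (x * (x + 1) * (x + 2)))\<^sup>2"
      by (rule power_mono[OF g1 g0])
    also have "\<dots> = 16 * ((x + 1) * (x + 2)) / (x\<^sup>2 * (x + 1) ^ 3 * (x + 2) ^ 3)"
      using x by (simp add: divide_simps power2_eq_square power3_eq_cube)
    also have "\<dots> \<le> 4 * ((x + 2) ^ 3 - x\<^sup>2 * (x + 1)) / (x\<^sup>2 * (x + 1) ^ 3 * (x + 2) ^ 3)"
    proof (rule divide_right_mono)
      have "4 * ((x + 2) ^ 3 - x\<^sup>2 * (x + 1)) - 16 * ((x + 1) * (x + 2)) = 4 * x\<^sup>2"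
        by (simp add: power2_eq_square power3_eq_cube algebra_simps)
      then show "16 * ((x + 1) * (x + 2)) \<le> 4 * ((x + 2) ^ 3 - x\<^sup>2 * (x + 1))"
        using zero_le_power2[of x] by linarith
    qed (use x in simp)
    also have "\<dots> = \<beta> k - \<beta> (Suc k)"
    proof -
      have "\<beta> k - \<beta> (Suc k) = 4 / (x\<^sup>2 * (x + 1) ^ 3) - 4 / ((x + 1)\<^sup>2 * (x + 2) ^ 3)"
        by (simp add: \<beta>_def mx x_def add_ac)
      also have "4 / (x\<^sup>2 * (x + 1) ^ 3) = 4 * (x + 2) ^ 3 / (x\<^sup>2 * (x + 1) ^ 3 * (x + 2) ^ 3)"
        using x by simp
      also have "4 / ((x + 1)\<^sup>2 * (x + 2) ^ 3) = 4 * (x\<^sup>2 * (x + 1)) / (x\<^sup>2 * (x + 1) ^ 3 * (x + 2) ^ 3)"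
        using x by (simp add: divide_simps) (simp add: power2_eq_square power3_eq_cube)
      finally show ?thesis by (simp add: diff_divide_distrib right_diff_distrib)
    qed
    finally show ?thesis .
  qed
  have gsum: "(\<Sum>j<J. (g (s + j))\<^sup>2) \<le> \<beta> s - \<beta> (s + J)" for s J
  proof (induction J)
    case (Suc J)
    then show ?case using gsq[of "s + J"] by simp
  qed simp
  have \<tau>: "sqrt (real (Suc s)) * sqrt (\<beta> s) \<le> \<tau> s" for s
  proof -
    define y where "y = real (max s d)"
    have y: "y \<ge> 1" "real (Suc s) \<le> y + 1" using d by (auto simp: y_def max_def)
    have "real (Suc s) * \<beta> s \<le> (y + 1) * \<beta> s" using y \<beta>0 by (intro mult_right_mono) auto
    also have "\<dots> = (\<tau> s)\<^sup>2"
      using y by (simp add: \<beta>_def \<tau>_def y_def[symmetric] divide_simps power2_eq_square power3_eq_cube)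
    finally have "sqrt (real (Suc s) * \<beta> s) \<le> \<tau> s"
      using y by (intro real_le_lsqrt) (simp_all add: \<tau>_def \<beta>0)
    then show ?thesis by (simp only: real_sqrt_mult)
  qed
  have \<tau>sum: "(\<Sum>s<K. \<tau> s) \<le> (if K \<le> d then 2 * real K / (real d * (real d + 1)) else 2 / (real d + 1) + 2 / real d - 2 / real K)" for K
  proof (induction K)
    case (Suc K)
    consider "Suc K \<le> d" | "K = d" | "d < K" by linarith
    then show ?case
    proof cases
      case 1
      then have "\<tau> K = 2 / (real d * (real d + 1))" by (simp add: \<tau>_def max_def)
      then show ?thesis using 1 Suc by (simp add: add_divide_distrib)
    next
      case 2
      then have "\<tau> K = 2 / real d - 2 / real (Suc d)" using d by (simp add: \<tau>_def field_simps)
      moreover have "2 * real d / (real d * (real d + 1)) = 2 / (real d + 1)" using d by simp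
      ultimately show ?thesis using 2 Suc by simp
    next
      case 3
      then have "\<tau> K = 2 / real K - 2 / real (Suc K)" using d by (simp add: \<tau>_def max_def field_simps)
      then show ?thesis using 3 Suc by simp
    qed
  qed simp
  show ?thesis
  proof (rule haagerup_multiplier[OF X S, where a = a and b = b and A = "\<lambda>l. real (Suc l)" and B = \<beta>])
    fix i j :: nat
    \<comment> \<open>Cutting off the index \<open>l\<close> at \<open>K\<close> stops the
      telescoping sum of \<open>g\<close> early and leaves the values \<open>h (K + j + q)\<close>.
      There are at most \<open>K\<close> of them, each at most \<open>2 / K\<^sup>2\<close>, so
      their sum tends to 0.\<close>
    have *: "(\<Sum>l<K. \<Sum>q<K - i. a l (i + q) * b l (j + q))
      = invlen d (i + j) - invlen d (i + j + 2 * (K - i)) - (\<Sum>q<K - i. h (K + j + q))" for K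
    proof -
      have "(\<Sum>l<K. \<Sum>q<K - i. a l (i + q) * b l (j + q)) = (\<Sum>q<K - i. \<Sum>l<K. a l (i + q) * b l (j + q))"
        by (rule sum.swap)
      also have "\<dots> = (\<Sum>q<K - i. h (i + j + 2 * q) - h (K + j + q))"
      proof (rule sum.cong[OF refl])
        fix q assume q: "q \<in> {..<K - i}"
        have "(\<Sum>l<K. a l (i + q) * b l (j + q)) = (\<Sum>l\<in>{i + q..<K}. h (l + (j + q)) - h (Suc l + (j + q)))"
          by (rule sum.mono_neutral_cong_right) (auto simp: a_def b_def g_def)
        also have "\<dots> = h (i + q + (j + q)) - h (K + (j + q))"
          using q sum_Suc_diff'[of "i + q" K "\<lambda>l. - h (l + (j + q))"] by simp
        finally show "(\<Sum>l<K. a l (i + q) * b l (j + q)) = h (i + j + 2 * q) - h (K + j + q)"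
          by (simp add: mult_2 add_ac)
      qed
      finally show ?thesis by (simp add: sum_subtractf sum_step2_telescope[of "invlen d" h, OF mh])
    qed
    have lim_m: "invlen d \<longlonglongrightarrow> 0"
    proof (rule Lim_transform_eventually)
      show "(\<lambda>k. 1 / real k) \<longlonglongrightarrow> 0" by real_asymp
      show "\<forall>\<^sub>F k in sequentially. 1 / real k = invlen d k"
        using eventually_ge_at_top[of d] by eventually_elim (simp add: invlen_def)
    qed
    have fl: "filterlim (\<lambda>K. i + j + 2 * (K - i)) at_top sequentially"
      by (rule filterlim_add_sub_at_top)
    have lim_h: "(\<lambda>K. \<Sum>q<K - i. h (K + j + q)) \<longlonglongrightarrow> 0"
    proof (rule tendsto_sandwich[OF _ _ tendsto_const])
      show "\<forall>\<^sub>F K in sequentially. 0 \<le> (\<Sum>q<K - i. h (K + j + q))"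
        using h0 by (intro always_eventually allI sum_nonneg) auto
      show "\<forall>\<^sub>F K in sequentially. (\<Sum>q<K - i. h (K + j + q)) \<le> 2 / real K"
        using eventually_ge_at_top[of 1]
      proof eventually_elim
        case (elim K)
        have "h (K + j + q) \<le> 2 / (real K * real K)" for q
          unfolding h_def using elim by (intro divide_left_mono mult_mono) auto
        then have "(\<Sum>q<K - i. h (K + j + q)) \<le> (\<Sum>q<K - i. 2 / (real K * real K))"
          by (intro sum_mono)
        also have "\<dots> \<le> real K * (2 / (real K * real K))"
          by (simp only: sum_constant card_lessThan, intro mult_right_mono) auto
        finally show ?case using elim by simp
      qed
      show "(\<lambda>K. 2 / real K) \<longlonglongrightarrow> 0" by real_asymp
    qed
    have "(\<lambda>K. invlen d (i + j) - invlen d (i + j + 2 * (K - i)) - (\<Sum>q<K - i. h (K + j + q)))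
      \<longlonglongrightarrow> invlen d (i + j) - 0 - 0"
      by (intro tendsto_diff tendsto_const lim_h filterlim_compose[OF lim_m fl])
    then show "(\<lambda>K. \<Sum>l<K. \<Sum>q<K - i. a l (i + q) * b l (j + q)) \<longlonglongrightarrow> invlen d (i + j)"
      unfolding * by simp
  next
    fix l K
    have "(\<Sum>i<K. (a l i)\<^sup>2) = (\<Sum>i<K. if i \<le> l then 1 else 0)" by (intro sum.cong) (auto simp: a_def)
    also have "\<dots> = (\<Sum>i\<in>{..<K} \<inter> {..l}. 1)" by (rule sum.mono_neutral_cong_right) auto
    also have "\<dots> \<le> (\<Sum>i\<in>{..l}. 1)" by (intro sum_mono2) auto
    finally show "(\<Sum>i<K. (a l i)\<^sup>2) \<le> real (Suc l)" by simp
    show "(\<Sum>i<K. (b l i)\<^sup>2) \<le> \<beta> l"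
      unfolding b_def using gsum[of l K] \<beta>0[of "l + K"] by linarith
  next
    fix K
    have "(\<Sum>l<K. sqrt (real (Suc l)) * sqrt (\<beta> l)) \<le> (\<Sum>s<K. \<tau> s)" by (rule sum_mono) (rule \<tau>)
    also have "\<dots> \<le> 4 / real d"
    proof (cases "K \<le> d")
      case True
      have "2 * real K / (real d * (real d + 1)) \<le> 2 * real d / (real d * (real d + 1))"
        using True by (intro divide_right_mono) auto
      also have "\<dots> = 2 / (real d + 1)" using d by simp
      also have "\<dots> \<le> 4 / real d" using d by (simp add: field_simps)
      finally show ?thesis using \<tau>sum[of K] True by simp
    next
      case False
      have "2 / (real d + 1) \<le> 2 / real d" using d by (simp add: field_simps)
      moreover have "0 \<le> 2 / real K" by simp
      moreover have "2 / real d + 2 / real d = 4 / real d" by simp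
      moreover have "(\<Sum>s<K. \<tau> s) \<le> 2 / (real d + 1) + 2 / real d - 2 / real K"
        using \<tau>sum[of K] False by simp
      ultimately show ?thesis by linarith
    qed
    finally show "(\<Sum>l<K. sqrt (real (Suc l)) * sqrt (\<beta> l)) \<le> 4 / real d" .
  qed
qed

section \<open>Coefficient functions\<close>

definition coeff_fun :: "free_group group_alg \<Rightarrow> word \<Rightarrow> complex" where
  "coeff_fun X w = (if reduced w then Poly_Mapping.lookup X (Abs_free_group w) else 0)"

definition FG_elems :: "nat \<Rightarrow> free_group set" where
  "FG_elems n = {g. Rep_free_group g \<in> FG n}"

lemma coeff_fun_Rep [simp]: "coeff_fun X (Rep_free_group g) = Poly_Mapping.lookup X g"
  by (simp add: coeff_fun_def Rep_free_group_inverse)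

lemma coeff_fun_not_reduced: "\<not> reduced w \<Longrightarrow> coeff_fun X w = 0"
  by (simp add: coeff_fun_def)

lemma coeff_fun_eqI:
  assumes "\<And>g. Poly_Mapping.lookup X g = f (Rep_free_group g)" "\<And>w. \<not> reduced w \<Longrightarrow> f w = 0"
  shows "coeff_fun X = f"
proof
  fix w
  show "coeff_fun X w = f w"
  proof (cases "reduced w")
    case True
    then have "w = Rep_free_group (Abs_free_group w)" by (simp add: Abs_free_group_inverse)
    then show ?thesis using assms(1)[of "Abs_free_group w"] coeff_fun_Rep[of X "Abs_free_group w"] by simp
  qed (simp add: assms(2) coeff_fun_not_reduced)
qed

lemma fsupp_coeff_fun: "fsupp (coeff_fun X) = Rep_free_group ` Poly_Mapping.keys X"
proof (intro set_eqI iffI)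
  fix w assume "w \<in> fsupp (coeff_fun X)"
  then have "reduced w" "coeff_fun X w \<noteq> 0" using coeff_fun_not_reduced by (auto simp: fsupp_def)
  then show "w \<in> Rep_free_group ` Poly_Mapping.keys X"
    by (intro image_eqI[of _ _ "Abs_free_group w"]) (simp_all add: Abs_free_group_inverse coeff_fun_def in_keys_iff)
qed (auto simp: fsupp_def in_keys_iff)

lemma inj_Rep: "inj_on Rep_free_group A"
  by (auto intro: inj_onI simp: Rep_free_group_inject)

lemma is_poly_coeff_fun: "is_poly n (coeff_fun X) \<longleftrightarrow> Poly_Mapping.keys X \<subseteq> FG_elems n"
  by (auto simp: is_poly_def fsupp_coeff_fun FG_elems_def)

lemma is_poly_obtains_coeff_fun:
  assumes "is_poly n x"
  obtains X where "x = coeff_fun X" "Poly_Mapping.keys X \<subseteq> FG_elems n"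
proof -
  have "finite (Rep_free_group -` fsupp x)"
    using assms by (intro finite_vimageI inj_Rep) (simp add: is_poly_def)
  then have fin: "finite {g. x (Rep_free_group g) \<noteq> 0}" by (simp add: fsupp_def vimage_def)
  define X where "X = Abs_poly_mapping (\<lambda>g. x (Rep_free_group g))"
  have "coeff_fun X = x"
  proof (rule coeff_fun_eqI)
    show "Poly_Mapping.lookup X g = x (Rep_free_group g)" for g using fin by (simp add: X_def)
    show "x w = 0" if "\<not> reduced w" for w
      using assms that by (auto simp: is_poly_def fsupp_def FG_def)
  qed
  then show ?thesis using that[of X] assms is_poly_coeff_fun[of n X] by simp
qed

lemma add_subgroup_FG_elems: "add_subgroup (FG_elems n)"
proof -
  have act: "\<forall>b\<in>set (act a v). fst b < n" if "fst a < n" "\<forall>b\<in>set v. fst b < n" for a v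
    using that by (cases v) auto
  have "\<forall>b\<in>set (foldr act u v). fst b < n" if "\<forall>b\<in>set u. fst b < n" "\<forall>b\<in>set v. fst b < n" for u v
    using that(1)
  proof (induction u)
    case (Cons a u)
    then show ?case using act[of a "foldr act u v"] by simp
  qed (use that in simp)
  note foldr = this
  have mem: "g \<in> FG_elems n \<longleftrightarrow> (\<forall>b\<in>set (Rep_free_group g). fst b < n)" for g
    by (simp add: FG_elems_def FG_def)
  show ?thesis
    unfolding add_subgroup_def
  proof (intro conjI ballI)
    show "0 \<in> FG_elems n" by (simp add: mem Rep_zero)
    fix g h assume "g \<in> FG_elems n" "h \<in> FG_elems n"
    then show "g + h \<in> FG_elems n" unfolding mem Rep_plus wmul_eq_foldr[OF reduced_Rep] by (rule foldr)
  next
    fix g assume "g \<in> FG_elems n"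
    then show "- g \<in> FG_elems n" unfolding mem Rep_uminus winv_def by simp
  qed
qed

lemma coeff_fun_mult: "coeff_fun (X * Y) = conv (coeff_fun X) (coeff_fun Y)"
proof (rule coeff_fun_eqI)
  have c: "conv (coeff_fun X) (coeff_fun Y) w = (\<Sum>h\<in>Poly_Mapping.keys X. \<Sum>k\<in>Poly_Mapping.keys Y.
      if Rep_free_group (h + k) = w then Poly_Mapping.lookup X h * Poly_Mapping.lookup Y k else 0)" for w
    unfolding conv_def fsupp_coeff_fun by (simp add: sum.reindex inj_Rep Rep_plus cong: if_cong)
  fix g
  have "X * Y = (\<Sum>h\<in>Poly_Mapping.keys X. Poly_Mapping.single h (Poly_Mapping.lookup X h)) *
      (\<Sum>k\<in>Poly_Mapping.keys Y. Poly_Mapping.single k (Poly_Mapping.lookup Y k))"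
    by (simp only: poly_mapping_sum_singles[symmetric])
  then show "Poly_Mapping.lookup (X * Y) g = conv (coeff_fun X) (coeff_fun Y) (Rep_free_group g)"
    unfolding c by (simp add: sum_product mult_single lookup_sum lookup_single when_def Rep_free_group_inject)
next
  fix w assume "\<not> reduced w"
  then have "Rep_free_group g \<noteq> w" for g by auto
  then show "conv (coeff_fun X) (coeff_fun Y) w = 0"
    by (simp add: conv_def fsupp_coeff_fun sum.reindex inj_Rep Rep_plus[symmetric])
qed

lemma coeff_fun_one: "coeff_fun 1 = unit_el"
  by (rule coeff_fun_eqI) (auto simp: unit_el_def lookup_one when_def Rep_zero[symmetric] Rep_free_group_inject)

lemma coeff_fun_star: "coeff_fun (star X) = adj (coeff_fun X)"
proof (rule coeff_fun_eqI)
  show "Poly_Mapping.lookup (star X) g = adj (coeff_fun X) (Rep_free_group g)" for g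
    by (simp add: adj_def Rep_uminus[symmetric])
  show "adj (coeff_fun X) w = 0" if "\<not> reduced w" for w
    using that by (simp add: adj_def coeff_fun_not_reduced reduced_winv)
qed

lemma coeff_fun_power: "coeff_fun (A ^ k) = cpow (coeff_fun A) k"
  by (induction k) (simp_all add: coeff_fun_one coeff_fun_mult)

lemma tau_coeff_fun: "tau (coeff_fun X) = Poly_Mapping.lookup X 0"
  using coeff_fun_Rep[of X 0] by (simp add: tau_def Rep_zero)

lemma l2sq_coeff_fun: "l2sq (coeff_fun X) = (norm X)\<^sup>2"
  by (simp add: l2sq_def fsupp_coeff_fun sum.reindex inj_Rep power2_norm_eq_inner[of X] inner_poly_mapping_def power2_norm_eq_inner)

text \<open>The moments in \<open>spec_meas\<close> are complex traces, whereas \<open>inner\<close>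
  gives real parts only. For selfadjoint elements the trace is real and the two agree.\<close>

lemma complex_of_real_inner_one:
  assumes "star X = X"
  shows "complex_of_real (inner X 1) = Poly_Mapping.lookup X 0"
proof -
  have "Poly_Mapping.lookup X 0 = cnj (Poly_Mapping.lookup X 0)"
    using assms lookup_star[of X 0] by simp
  then have "Im (Poly_Mapping.lookup X 0) = 0" by (simp add: complex_eq_iff)
  moreover have "inner X 1 = inner (Poly_Mapping.lookup X 0) 1"
    using inner_single_right[of X 0 1] by simp
  ultimately show ?thesis by (simp add: inner_complex_def complex_eq_iff)
qed

text \<open>The definite description is resolved by existence, from the moment problem, and by
  uniqueness among all compactly supported measures with these moments, whatever their
  bound.\<close>

lemma spec_meas_coeff_fun: "spec_meas (coeff_fun X) = spectral_measure X"
  unfolding spec_meas_def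
proof (rule the_equality)
  let ?a = "star X * X"
  have mom: "tau (cpow (conv (adj (coeff_fun X)) (coeff_fun X)) k) = complex_of_real (\<integral>t. t ^ k \<partial>spectral_measure X)" for k
  proof -
    have "(\<integral>t. t ^ k \<partial>spectral_measure X) = (\<integral>t. poly (monom 1 k) t \<partial>spectral_measure X)" by (simp add: poly_monom)
    also have "\<dots> = inner (?a ^ k) 1" by (simp only: integral_poly_spectral_measure poly_eval_monom)
    also have "complex_of_real \<dots> = Poly_Mapping.lookup (?a ^ k) 0"
      by (rule complex_of_real_inner_one) simp
    finally show ?thesis by (simp add: coeff_fun_star[symmetric] coeff_fun_mult[symmetric] coeff_fun_power[symmetric] tau_coeff_fun)
  qed
  have bp: "bounded_prob (spectral_bound X) (spectral_measure X)" by (rule bounded_prob_spectral_measure)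
  show "prob_space (spectral_measure X) \<and> sets (spectral_measure X) = sets borel \<and> (\<exists>R. AE t in spectral_measure X. 0 \<le> t \<and> t \<le> R) \<and>
    (\<forall>k. integrable (spectral_measure X) (\<lambda>t. t ^ k) \<and>
      complex_of_real (\<integral>t. t ^ k \<partial>spectral_measure X) = tau (cpow (conv (adj (coeff_fun X)) (coeff_fun X)) k))"
  proof (intro conjI allI)
    show "integrable (spectral_measure X) (\<lambda>t. t ^ k)" for k
      by (intro bounded_prob_integrable_cont[OF bp] continuous_intros)
    show "\<exists>R. AE t in spectral_measure X. 0 \<le> t \<and> t \<le> R"
      using bp unfolding bounded_prob_def by blast
  qed (use bp in \<open>simp_all only: bounded_prob_def mom\<close>)
  fix \<mu> :: "real measure"
  assume \<mu>: "prob_space \<mu> \<and> sets \<mu> = sets borel \<and> (\<exists>R. AE t in \<mu>. 0 \<le> t \<and> t \<le> R) \<and>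
    (\<forall>k. integrable \<mu> (\<lambda>t. t ^ k) \<and>
      complex_of_real (\<integral>t. t ^ k \<partial>\<mu>) = tau (cpow (conv (adj (coeff_fun X)) (coeff_fun X)) k))"
  then obtain R where "bounded_prob R \<mu>" unfolding bounded_prob_def by blast
  then show "\<mu> = spectral_measure X"
    using bp by (rule bounded_prob_unique) (use \<mu> in \<open>simp only: mom of_real_eq_iff\<close>)
qed

text \<open>The supremum in \<open>opnorm\<close> is over a nonempty set, by the zero vector, that
  is bounded by the l^1 norm; so it is the least \<open>op_bound\<close>.\<close>

lemma opnorm_coeff_fun:
  assumes X: "Poly_Mapping.keys X \<subseteq> FG_elems n"
  shows op_bound_opnorm: "op_bound (FG_elems n) X (opnorm n (coeff_fun X))"
    and opnorm_le: "op_bound (FG_elems n) X M \<Longrightarrow> opnorm n (coeff_fun X) \<le> M"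
proof -
  let ?S = "{sqrt (l2sq (conv (coeff_fun X) \<xi>)) | \<xi>. is_poly n \<xi> \<and> l2sq \<xi> \<le> 1}"
  have S: "?S = {norm (X * \<zeta>) | \<zeta>. Poly_Mapping.keys \<zeta> \<subseteq> FG_elems n \<and> norm \<zeta> \<le> 1}"
  proof (intro set_eqI iffI)
    fix c assume "c \<in> ?S"
    then obtain \<xi> where \<xi>: "is_poly n \<xi>" "l2sq \<xi> \<le> 1" "c = sqrt (l2sq (conv (coeff_fun X) \<xi>))" by blast
    obtain \<zeta> where \<zeta>: "\<xi> = coeff_fun \<zeta>" "Poly_Mapping.keys \<zeta> \<subseteq> FG_elems n" using is_poly_obtains_coeff_fun[OF \<xi>(1)] .
    have "c = norm (X * \<zeta>)" using \<xi>(3) by (simp add: \<zeta>(1) coeff_fun_mult[symmetric] l2sq_coeff_fun)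
    moreover have "norm \<zeta> \<le> 1" using \<xi>(2) by (simp add: \<zeta>(1) l2sq_coeff_fun power_le_one_iff)
    ultimately show "c \<in> {norm (X * \<zeta>) | \<zeta>. Poly_Mapping.keys \<zeta> \<subseteq> FG_elems n \<and> norm \<zeta> \<le> 1}" using \<zeta> by blast
  next
    fix c assume "c \<in> {norm (X * \<zeta>) | \<zeta>. Poly_Mapping.keys \<zeta> \<subseteq> FG_elems n \<and> norm \<zeta> \<le> 1}"
    then obtain \<zeta> where \<zeta>: "c = norm (X * \<zeta>)" "Poly_Mapping.keys \<zeta> \<subseteq> FG_elems n" "norm \<zeta> \<le> 1" by blast
    then have "c = sqrt (l2sq (conv (coeff_fun X) (coeff_fun \<zeta>)))" "is_poly n (coeff_fun \<zeta>)" "l2sq (coeff_fun \<zeta>) \<le> 1"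
      by (simp_all add: coeff_fun_mult[symmetric] l2sq_coeff_fun is_poly_coeff_fun power_le_one_iff)
    then show "c \<in> ?S" by blast
  qed
  have zero: "norm (X * 0) \<in> ?S" 
  proof -
    have "Poly_Mapping.keys (0 :: free_group group_alg) \<subseteq> FG_elems n \<and> norm (0 :: free_group group_alg) \<le> 1" by simp
    then show ?thesis unfolding S by blast
  qed
  have bdd: "bdd_above ?S"
    unfolding S
  proof (rule bdd_aboveI, clarify)
    fix \<zeta> :: "free_group group_alg" assume "norm \<zeta> \<le> 1"
    then have "l1norm X * norm \<zeta> \<le> l1norm X * 1" using l1norm_nonneg by (intro mult_left_mono)
    then show "norm (X * \<zeta>) \<le> l1norm X" using norm_mult_le_l1norm[of X \<zeta>] by simp
  qed
  show "op_bound (FG_elems n) X (opnorm n (coeff_fun X))"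
    unfolding op_bound_def
  proof (intro conjI allI impI)
    show "0 \<le> opnorm n (coeff_fun X)" unfolding opnorm_def using cSup_upper[OF zero bdd] by simp
    fix \<zeta> :: "free_group group_alg" assume \<zeta>: "Poly_Mapping.keys \<zeta> \<subseteq> FG_elems n"
    show "norm (X * \<zeta>) \<le> opnorm n (coeff_fun X) * norm \<zeta>"
    proof (cases "\<zeta> = 0")
      case False
      define \<eta> where "\<eta> = \<zeta> /\<^sub>R norm \<zeta>"
      have "Poly_Mapping.keys \<eta> \<subseteq> FG_elems n" "norm \<eta> \<le> 1"
        using \<zeta> False by (auto simp: \<eta>_def in_keys_iff)
      then have "norm (X * \<eta>) \<in> ?S" unfolding S by blast
      then have "norm (X * \<eta>) \<le> opnorm n (coeff_fun X)" unfolding opnorm_def by (rule cSup_upper[OF _ bdd])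
      then have "norm \<zeta> * norm (X * \<eta>) \<le> norm \<zeta> * opnorm n (coeff_fun X)" by (rule mult_left_mono) simp
      moreover have "norm \<zeta> * norm (X * \<eta>) = norm (X * \<zeta>)" using False by (simp add: \<eta>_def)
      ultimately show ?thesis by (simp add: mult.commute)
    qed simp
  qed
  show "opnorm n (coeff_fun X) \<le> M" if M: "op_bound (FG_elems n) X M"
    unfolding opnorm_def
  proof (rule cSup_least)
    fix c assume "c \<in> ?S"
    then obtain \<zeta> where \<zeta>: "c = norm (X * \<zeta>)" "Poly_Mapping.keys \<zeta> \<subseteq> FG_elems n" "norm \<zeta> \<le> 1"
      unfolding S by blast
    have "c \<le> M * norm \<zeta>" "M \<ge> 0" using M \<zeta> by (auto simp: op_bound_def)
    moreover have "M * norm \<zeta> \<le> M * 1" using \<zeta>(3) \<open>M \<ge> 0\<close> by (rule mult_left_mono)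
    ultimately show "c \<le> M" by simp
  qed (use zero in blast)
qed

lemma lpnorm_nonneg:
  assumes "Poly_Mapping.keys X \<subseteq> FG_elems n"
  shows "0 \<le> lpnorm n p (coeff_fun X)"
  using op_bound_opnorm[OF assms] by (simp add: lpnorm_def op_bound_def)

lemma lpnorm_radial_multiplier_le:
  assumes X: "Poly_Mapping.keys X \<subseteq> FG_elems n" and p: "1 \<le> p" and C: "C > 0"
    and bound: "\<And>Y M. Poly_Mapping.keys Y \<subseteq> FG_elems n \<Longrightarrow> op_bound (FG_elems n) Y M \<Longrightarrow>
      op_bound (FG_elems n) (pmul (\<lambda>g. m (glen g)) Y) (C * M)"
  shows "lpnorm n p (coeff_fun (pmul (\<lambda>g. m (glen g)) X)) \<le> C * lpnorm n p (coeff_fun X)"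
proof (cases "p = \<infinity>")
  case True
  have "Poly_Mapping.keys (pmul (\<lambda>g. m (glen g)) X) \<subseteq> FG_elems n" by (rule order_trans[OF keys_pmul X])
  from opnorm_le[OF this bound[OF X op_bound_opnorm[OF X]]] show ?thesis
    using True by (simp add: lpnorm_def)
next
  case False
  let ?T = "pmul (\<lambda>g. m (glen g))"
  define q where "q = enn2real p"
  have "enn2real 1 \<le> enn2real p" using p False by (intro enn2real_mono) (simp_all add: less_top)
  then have q: "q \<ge> 1" by (simp add: q_def)
  have "(\<integral>s. s powr (q / 2) \<partial>spectral_measure (?T X)) \<le> C powr q * (\<integral>s. s powr (q / 2) \<partial>spectral_measure X)"
  proof (rule integral_powr_multiplier_le[OF add_subgroup_FG_elems X _ _ _ bound C q])
    fix y w :: "free_group group_alg"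
    show "Poly_Mapping.keys (?T y) \<subseteq> FG_elems n" if "Poly_Mapping.keys y \<subseteq> FG_elems n" by (rule order_trans[OF keys_pmul that])
    show "?T (y - w) = ?T y - ?T w" by (rule pmul_diff)
    \<comment> \<open>Here the multiplier must be real and take equal values at \<open>g\<close> and
      \<open>- g\<close>, which word length guarantees.\<close>
    have st: "star (?T w) = ?T (star w)" by (simp add: star_pmul)
    have "inner (w * ?T y) 1 = inner (?T y) (star w)" by (simp add: inner_mult_left)
    also have "\<dots> = inner y (star (?T w))" unfolding st by (rule inner_pmul)
    also have "\<dots> = inner (?T w * y) 1" by (simp only: inner_mult_left mult_1_right)
    finally show "inner (w * ?T y) 1 = inner (?T w * y) 1" .
  qed
  then have "(\<integral>s. s powr (q / 2) \<partial>spectral_measure (?T X)) powr (1 / q) \<le> (C powr q * (\<integral>s. s powr (q / 2) \<partial>spectral_measure X)) powr (1 / q)"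
    using q by (intro powr_mono2) (auto intro: integral_nonneg_AE)
  also have "\<dots> = C * (\<integral>s. s powr (q / 2) \<partial>spectral_measure X) powr (1 / q)"
    using q C by (subst powr_mult) (auto simp: powr_powr intro: integral_nonneg_AE)
  finally show ?thesis using False by (simp add: lpnorm_def spec_meas_coeff_fun q_def)
qed

theorem theorem1p5:
  fixes n d :: nat and p :: ennreal and t :: real and x :: "word \<Rightarrow> complex"
  assumes "n \<ge> 1" and "1 \<le> p" and "d \<ge> 1"
    and "is_poly n x" and "\<forall>g. length g < d \<longrightarrow> x g = 0"
    and "t \<ge> 0"
  shows "lpnorm n p (Pt t x) \<le> (real d + 3) * exp (- t * real d) * lpnorm n p x
       \<and> lpnorm n p (Lop x) \<ge> real d / 4 * lpnorm n p x"
proof -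
  obtain X where x: "x = coeff_fun X" and X: "Poly_Mapping.keys X \<subseteq> FG_elems n"
    using is_poly_obtains_coeff_fun[OF assms(4)] .
  have low: "Poly_Mapping.lookup X g = 0" if "glen g < d" for g
    using assms(5)[rule_format, of "Rep_free_group g"] that by (simp add: x glen_def)
  have "lpnorm n p (Pt t x) \<le> (real d + 3) * exp (- t * real d) * lpnorm n p x"
  \<comment> \<open>The multiplier estimate needs \<open>r < 1\<close>, both for the decay of
    \<open>m\<close> and for the geometric sums; at \<open>t = 0\<close> the semigroup is the
    identity.\<close>
  proof (cases "t = 0")
    case True
    then have "Pt t x = x" by (simp add: Pt_def fun_eq_iff)
    moreover have "1 * lpnorm n p x \<le> (real d + 3) * lpnorm n p x"
      using lpnorm_nonneg[OF X] by (intro mult_right_mono) (simp_all add: x)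
    ultimately show ?thesis using True by simp
  next
    case False
    define r where "r = exp (- t)"
    have r: "0 < r" "r < 1" using False assms(6) by (auto simp: r_def)
    have rp: "r ^ k = exp (- t * real k)" for k by (simp add: r_def exp_of_nat_mult[symmetric] mult.commute)
    define m where "m k = (if d \<le> k then r ^ k else r ^ (d + (d + k) mod 2))" for k
    have "coeff_fun (pmul (\<lambda>g. m (glen g)) X) = Pt t x"
    proof (rule coeff_fun_eqI)
      fix g
      show "Poly_Mapping.lookup (pmul (\<lambda>g. m (glen g)) X) g = Pt t x (Rep_free_group g)"
        using low[of g] by (cases "d \<le> glen g") (auto simp: x Pt_def m_def rp glen_def[symmetric] scaleR_conv_of_real)
    qed (simp add: Pt_def x coeff_fun_not_reduced)
    then have "lpnorm n p (Pt t x) = lpnorm n p (coeff_fun (pmul (\<lambda>g. m (glen g)) X))" by simp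
    also have "\<dots> \<le> ((real d + 1) * r ^ d) * lpnorm n p x"
      unfolding x
      by (rule lpnorm_radial_multiplier_le[OF X assms(2)])
         (use r heat_tail_multiplier[OF _ add_subgroup_FG_elems _ r] in \<open>auto simp: m_def add_pos_nonneg\<close>)
    also have "\<dots> \<le> ((real d + 3) * r ^ d) * lpnorm n p x"
      using r lpnorm_nonneg[OF X] by (intro mult_right_mono) (simp_all add: x)
    finally show ?thesis by (simp only: rp)
  qed
  moreover have "lpnorm n p (Lop x) \<ge> real d / 4 * lpnorm n p x"
  proof -
    define Y where "Y = pmul (\<lambda>g. real (glen g)) X"
    have Y: "Poly_Mapping.keys Y \<subseteq> FG_elems n" unfolding Y_def by (rule order_trans[OF keys_pmul X])
    have "coeff_fun Y = Lop x"
    proof (rule coeff_fun_eqI)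
      show "Poly_Mapping.lookup Y g = Lop x (Rep_free_group g)" for g
        by (simp add: Y_def x Lop_def glen_def scaleR_conv_of_real)
    qed (simp add: Lop_def x coeff_fun_not_reduced)
    \<comment> \<open>The multiplier inverts the length on indices at least \<open>d\<close>, and
      the coefficients below \<open>d\<close> vanish; so bounding it on \<open>Y\<close> is the
      lower bound for the generator.\<close>
    moreover have "pmul (\<lambda>g. invlen d (glen g)) Y = X"
    proof (rule poly_mapping_eqI)
      fix g
      show "Poly_Mapping.lookup (pmul (\<lambda>g. invlen d (glen g)) Y) g = Poly_Mapping.lookup X g"
        using low[of g] assms(3) by (cases "d \<le> glen g") (auto simp: Y_def invlen_def)
    qed
    moreover have "lpnorm n p (coeff_fun (pmul (\<lambda>g. invlen d (glen g)) Y)) \<le> 4 / real d * lpnorm n p (coeff_fun Y)"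
      by (rule lpnorm_radial_multiplier_le[OF Y assms(2)])
         (use assms(3) inverse_length_multiplier[OF _ add_subgroup_FG_elems _ assms(3)] in auto)
    ultimately have "lpnorm n p x \<le> 4 / real d * lpnorm n p (Lop x)" by (simp add: x)
    then show ?thesis using assms(3) by (simp add: field_simps)
  qed
  ultimately show ?thesis by blast
qed

end
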